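(* Let $k$ be an algebraically closed field of characteristic $p>0$, let $r\ge2$ and $2\le n\le p$. With $\mathrm{Hom}$ and $\mathrm{Ext}$ taken in $\mathrm{mod}\,B(n,r)$, we have (a) $\mathrm{EIP}(n,r)=\{M\in\mathrm{mod}\,B(n,r)\mid \mathrm{Ext}^1(X_\alpha^1,M)=0\ \forall\alpha\in k^r\setminus0\}$, (b) $\mathrm{EKP}(n,r)=\{M\in\mathrm{mod}\,B(n,r)\mid \mathrm{Hom}(X_\alpha^1,M)=0\ \forall\alpha\in k^r\setminus0\}$, (c) for $1\le j\le n-1$, $\mathrm{CR}^j(n,r)=\{M\in\mathrm{mod}\,B(n,r)\mid \exists c_j:\ \dim_k\mathrm{Ext}^1(X_\alpha^j,M)=c_j\ \forall\alpha\in k^r\setminus0\}$.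
   Context: The generalized Beilinson algebra $B(n,r)$ is the path algebra over $k$ of the quiver with vertices $0,1,\dots,n-1$ and $r$ arrows $\gamma_1^{(i)},\dots,\gamma_r^{(i)}: i\to i+1$ for each $0\le i\le n-2$, modulo the ideal generated by $\gamma_s^{(j)}\gamma_t^{(j-1)}-\gamma_t^{(j)}\gamma_s^{(j-1)}$ for $s,t\in\{1,\dots,r\}$, $1\le j\le n-2$ (paths are composed from right to left). $\mathrm{mod}\,B(n,r)$ is the category of finite-dimensional left modules; for a module $M$ write $M_i=e_iM$ with $e_i$ the primitive idempotent of vertex $i$, so $M=\bigoplus_{i=0}^{n-1}M_i$. For $\alpha=(\alpha_1,\dots,\alpha_r)\in k^r\setminus 0$, let $\alpha_M:M\to M$ be left multiplication by $\sum_{i=0}^{n-2}(\alpha_1\gamma_1^{(i)}+\cdots+\alpha_r\gamma_r^{(i)})$. Full subcategories of $\mathrm{mod}\,B(n,r)$: $\mathrm{EIP}(n,r)=\{M \mid \mathrm{im}(\alpha_M)=\bigoplus_{i=1}^{n-1}M_i\ \forall \alpha\in k^r\setminus 0\}$; $\mathrm{EKP}(n,r)=\{M \mid \ker(\alpha_M)=M_{n-1}\ \forall \alpha\in k^r\setminus 0\}$; $\mathrm{CR}^j(n,r)=\{M\mid\exists c_j\in\mathbb{N}_0:\ \mathrm{rk}(\alpha_M)^j=c_j\ \forall\alpha\in k^r\setminus0\}$. Let $P(i)=B(n,r)e_i$. For $\alpha\in k^r\setminus0$, $0\le i\le n-2$ and $1\le j\le n-i-1$, let $\alpha(i)_j:P(i+j)\to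 P(i)$ be the (injective) $B(n,r)$-linear map with $e_{i+j}\mapsto(\alpha_1\gamma_1^{(i+j-1)}+\cdots+\alpha_r\gamma_r^{(i+j-1)})\cdots(\alpha_1\gamma_1^{(i)}+\cdots+\alpha_r\gamma_r^{(i)})$. Put $X_\alpha^{i,j}=\mathrm{coker}\,\alpha(i)_j$ and, for $1\le j\le n-1$, $X_\alpha^j=\bigoplus_{i=0}^{n-j-1}X_\alpha^{i,j}$. *)

theory Defs
  imports
    "HOL-Library.Poly_Mapping"
    "HOL-Computational_Algebra.Polynomial"
    "HOL-Algebra.QuotRing"
    "Graph_Theory.Arc_Walk"
    "Jordan_Normal_Form.VS_Connect"
begin

section \<open>Left modules over (not necessarily commutative) algebras\<close>

text \<open>
  The record \<^type>\<open>module\<close> of HOL-Algebra is used both for a \<open>k\<close>-algebra \<open>A\<close> (its \<open>smult\<close> is the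
  scalar multiplication by \<open>k\<close>) and for a left \<open>A\<close>-module (its \<open>smult\<close> is the action of \<open>A\<close>, its
  \<open>mult\<close> and \<open>one\<close> are irrelevant). The locale \<^locale>\<open>module\<close> demands a commutative ring, hence
  the variant below.
\<close>

locale left_module = R?: ring R + M?: abelian_group M
  for R :: "('a, 'b) ring_scheme" (structure) and M :: "('a, 'm, 'c) module_scheme" (structure) +
  assumes act_closed: "\<lbrakk>a \<in> carrier R; x \<in> carrier M\<rbrakk> \<Longrightarrow> a \<odot>\<^bsub>M\<^esub> x \<in> carrier M"
    and act_l_distr: "\<lbrakk>a \<in> carrier R; b \<in> carrier R; x \<in> carrier M\<rbrakk> \<Longrightarrow>
      (a \<oplus>\<^bsub>R\<^esub> b) \<odot>\<^bsub>M\<^esub> x = a \<odot>\<^bsub>M\<^esub> x \<oplus>\<^bsub>M\<^esub> b \<odot>\<^bsub>M\<^esub> x"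
    and act_r_distr: "\<lbrakk>a \<in> carrier R; x \<in> carrier M; y \<in> carrier M\<rbrakk> \<Longrightarrow>
      a \<odot>\<^bsub>M\<^esub> (x \<oplus>\<^bsub>M\<^esub> y) = a \<odot>\<^bsub>M\<^esub> x \<oplus>\<^bsub>M\<^esub> a \<odot>\<^bsub>M\<^esub> y"
    and act_assoc: "\<lbrakk>a \<in> carrier R; b \<in> carrier R; x \<in> carrier M\<rbrakk> \<Longrightarrow>
      (a \<otimes>\<^bsub>R\<^esub> b) \<odot>\<^bsub>M\<^esub> x = a \<odot>\<^bsub>M\<^esub> (b \<odot>\<^bsub>M\<^esub> x)"
    and act_one: "x \<in> carrier M \<Longrightarrow> \<one>\<^bsub>R\<^esub> \<odot>\<^bsub>M\<^esub> x = x"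

definition kspace :: "('k, 'a) module \<Rightarrow> ('a, 'm) module \<Rightarrow> ('k, 'm) module" where
  "kspace A M = \<lparr>carrier = carrier M, mult = mult M, one = one M, zero = zero M, add = add M,
     smult = (\<lambda>c x. (c \<odot>\<^bsub>A\<^esub> \<one>\<^bsub>A\<^esub>) \<odot>\<^bsub>M\<^esub> x)\<rparr>"

definition fd_modules :: "('k::field, 'a) module \<Rightarrow> ('a, 'm) module set" where
  "fd_modules A = {M. left_module A M \<and> vectorspace.fin_dim class_ring (kspace A M)}"

text \<open>
  As in \<^const>\<open>FactRing\<close>, of which this is the extension by scalar multiplication: the quotient of
  an algebra by a two-sided ideal as well as the quotient of a module by a submodule.
\<close>

definition quot_module :: "('a, 'm) module \<Rightarrow> 'm set \<Rightarrow> ('a, 'm set) module" where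
  "quot_module M N = ring.extend (M Quot N)
     (module.fields (\<lambda>a X. \<Union>x\<in>X. N +>\<^bsub>M\<^esub> (a \<odot>\<^bsub>M\<^esub> x)))"

definition regular_module :: "('k, 'a) module \<Rightarrow> ('a, 'a) module" where
  "regular_module A = \<lparr>carrier = carrier A, mult = mult A, one = one A, zero = zero A, add = add A,
     smult = mult A\<rparr>"

text \<open>Only used for finite index sets, where the product is the direct sum.\<close>

definition direct_sum_module :: "'i set \<Rightarrow> ('i \<Rightarrow> ('a, 'm) module) \<Rightarrow> ('a, 'i \<Rightarrow> 'm) module" where
  "direct_sum_module I M = \<lparr>carrier = (\<Pi>\<^sub>E i\<in>I. carrier (M i)), mult = undefined, one = undefined,
     zero = (\<lambda>i\<in>I. \<zero>\<^bsub>M i\<^esub>), add = (\<lambda>x y. \<lambda>i\<in>I. x i \<oplus>\<^bsub>M i\<^esub> y i),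
     smult = (\<lambda>a x. \<lambda>i\<in>I. a \<odot>\<^bsub>M i\<^esub> x i)\<rparr>"

definition free_module :: "('k, 'a) module \<Rightarrow> nat \<Rightarrow> ('a, nat \<Rightarrow> 'a) module" where
  "free_module A m = direct_sum_module {..<m} (\<lambda>_. regular_module A)"

section \<open>Hom and Ext as vector spaces\<close>

definition Hom :: "('k, 'a) module \<Rightarrow> ('a, 'x) module \<Rightarrow> ('a, 'm) module \<Rightarrow> ('k, 'x \<Rightarrow> 'm) module" where
  "Hom A X M = \<lparr>carrier = module_hom A X M \<inter> extensional (carrier X), mult = undefined,
     one = undefined, zero = (\<lambda>x\<in>carrier X. \<zero>\<^bsub>M\<^esub>), add = (\<lambda>f g. \<lambda>x\<in>carrier X. f x \<oplus>\<^bsub>M\<^esub> g x),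
     smult = (\<lambda>c f. \<lambda>x\<in>carrier X. c \<odot>\<^bsub>kspace A M\<^esub> f x)\<rparr>"

definition free_cover :: "('k, 'a) module \<Rightarrow> ('a, 'x) module \<Rightarrow> nat \<times> ((nat \<Rightarrow> 'a) \<Rightarrow> 'x) \<Rightarrow> bool" where
  "free_cover A X = (\<lambda>(m, q). q \<in> module_hom A (free_module A m) X \<and>
     q ` carrier (free_module A m) = carrier X)"

text \<open>
  \<open>Ext\<^sup>1(X, M)\<close> is the first derived functor of \<open>Hom(-, M)\<close>: for a projective presentation
  \<open>0 \<rightarrow> K \<rightarrow> P \<rightarrow> X \<rightarrow> 0\<close> it is the cokernel of the restriction map \<open>Hom(P, M) \<rightarrow> Hom(K, M)\<close>. Any
  \<open>X\<close> that is finite-dimensional over \<open>k\<close> has a presentation with \<open>P\<close> free of finite rank, and one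
  of these is chosen; up to isomorphism the result is independent of the choice. If \<open>A\<close> is
  finite-dimensional, such a \<open>P\<close> is a projective object of the category of finite-dimensional modules.
\<close>

definition Ext1 :: "('k, 'a) module \<Rightarrow> ('a, 'x) module \<Rightarrow> ('a, 'm) module \<Rightarrow>
    ('k, ((nat \<Rightarrow> 'a) \<Rightarrow> 'm) set) module" where
  "Ext1 A X M = (let (m, q) = (SOME mq. free_cover A X mq);
       P = free_module A m;
       K = a_kernel P X q
     in quot_module (Hom A (P\<lparr>carrier := K\<rparr>) M) ((\<lambda>f. restrict f K) ` carrier (Hom A P M)))"

section \<open>Path algebras\<close>

text \<open>
  A path is given by its source and the list of its arrows in the order of traversal. Since paths
  are composed from right to left, the product \<open>b a\<close> of two paths runs through \<open>a\<close> first.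
\<close>

type_synonym ('v, 'e) path = "'v \<times> 'e list"

definition quiver_paths :: "('v, 'e) pre_digraph \<Rightarrow> ('v, 'e) path set" where
  "quiver_paths G = {(u, p). \<exists>v. pre_digraph.awalk G u p v}"

definition path_mult :: "('v, 'e) pre_digraph \<Rightarrow>
    (('v, 'e) path \<Rightarrow>\<^sub>0 'k::field) \<Rightarrow> (('v, 'e) path \<Rightarrow>\<^sub>0 'k) \<Rightarrow> (('v, 'e) path \<Rightarrow>\<^sub>0 'k)" where
  "path_mult G f g = (\<Sum>(v, q)\<in>Poly_Mapping.keys f. \<Sum>(u, p)\<in>Poly_Mapping.keys g.
     if pre_digraph.awlast G u p = v
     then Poly_Mapping.single (u, p @ q) (Poly_Mapping.lookup f (v, q) * Poly_Mapping.lookup g (u, p))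
     else 0)"

definition path_algebra :: "('v, 'e) pre_digraph \<Rightarrow> ('k::field, ('v, 'e) path \<Rightarrow>\<^sub>0 'k) module" where
  "path_algebra G = \<lparr>carrier = {f. Poly_Mapping.keys f \<subseteq> quiver_paths G}, mult = path_mult G,
     one = (\<Sum>v\<in>verts G. Poly_Mapping.single (v, []) 1), zero = 0, add = (+),
     smult = (\<lambda>c. Poly_Mapping.map ((*) c))\<rparr>"

section \<open>The generalized Beilinson algebra\<close>

text \<open>
  The arrow \<open>(i, s)\<close> is the \<open>s\<close>-th arrow \<open>i \<rightarrow> i + 1\<close>. The labels \<open>s\<close> run through \<open>0, \<dots>, r - 1\<close>, to
  match the indexing of the entries of a vector in \<^term>\<open>carrier_vec r\<close>.
\<close>

definition beilinson_quiver :: "nat \<Rightarrow> nat \<Rightarrow> (nat, nat \<times> nat) pre_digraph" where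
  "beilinson_quiver n r = \<lparr>verts = {..<n}, arcs = {(i, s). Suc i < n \<and> s < r}, tail = fst,
     head = (\<lambda>(i, s). Suc i)\<rparr>"

text \<open>The product of the arrows \<open>(j, s)\<close> and \<open>(j - 1, t)\<close> is the path \<open>[(j - 1, t), (j, s)]\<close>.\<close>

definition beilinson_relations :: "nat \<Rightarrow> nat \<Rightarrow> ((nat, nat \<times> nat) path \<Rightarrow>\<^sub>0 'k::field) set" where
  "beilinson_relations n r =
     {Poly_Mapping.single (j - 1, [(j - 1, t), (j, s)]) 1 - Poly_Mapping.single (j - 1, [(j - 1, s), (j, t)]) 1
      | j s t. 1 \<le> j \<and> Suc j < n \<and> s < r \<and> t < r}"

type_synonym 'k beil = "((nat, nat \<times> nat) path \<Rightarrow>\<^sub>0 'k) set"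

definition beilinson_ideal :: "nat \<Rightarrow> nat \<Rightarrow> 'k::field beil" where
  "beilinson_ideal n r = genideal (path_algebra (beilinson_quiver n r)) (beilinson_relations n r)"

definition beilinson_algebra :: "nat \<Rightarrow> nat \<Rightarrow> ('k::field, 'k beil) module" where
  "beilinson_algebra n r = quot_module (path_algebra (beilinson_quiver n r)) (beilinson_ideal n r)"

definition path_class :: "nat \<Rightarrow> nat \<Rightarrow> (nat, nat \<times> nat) path \<Rightarrow> 'k::field beil" where
  "path_class n r p =
     beilinson_ideal n r +>\<^bsub>path_algebra (beilinson_quiver n r)\<^esub> Poly_Mapping.single p 1"

definition idem :: "nat \<Rightarrow> nat \<Rightarrow> nat \<Rightarrow> 'k::field beil" where
  "idem n r i = path_class n r (i, [])"

definition arrow :: "nat \<Rightarrow> nat \<Rightarrow> nat \<Rightarrow> nat \<Rightarrow> 'k::field beil" where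
  "arrow n r i s = path_class n r (i, [(i, s)])"

definition arrow_comb :: "nat \<Rightarrow> nat \<Rightarrow> 'k::field vec \<Rightarrow> nat \<Rightarrow> 'k beil" where
  "arrow_comb n r \<alpha> i = (\<Oplus>\<^bsub>beilinson_algebra n r\<^esub>s\<in>{..<r}.
     (\<alpha> $ s) \<odot>\<^bsub>beilinson_algebra n r\<^esub> arrow n r i s)"

text \<open>\<open>arrow_comb_power n r \<alpha> i j\<close> is the product of the \<open>arrow_comb n r \<alpha> l\<close> with \<open>l\<close> descending
  from \<open>i + j - 1\<close> to \<open>i\<close>.\<close>

primrec arrow_comb_power :: "nat \<Rightarrow> nat \<Rightarrow> 'k::field vec \<Rightarrow> nat \<Rightarrow> nat \<Rightarrow> 'k beil" where
  "arrow_comb_power n r \<alpha> i 0 = idem n r i"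
| "arrow_comb_power n r \<alpha> i (Suc j) =
     arrow_comb n r \<alpha> (i + j) \<otimes>\<^bsub>beilinson_algebra n r\<^esub> arrow_comb_power n r \<alpha> i j"

definition proj_module :: "nat \<Rightarrow> nat \<Rightarrow> nat \<Rightarrow> ('k::field beil, 'k beil) module" where
  "proj_module n r i = (regular_module (beilinson_algebra n r))\<lparr>carrier :=
     (\<lambda>b. b \<otimes>\<^bsub>beilinson_algebra n r\<^esub> idem n r i) ` carrier (beilinson_algebra n r)\<rparr>"

text \<open>
  A linear map \<open>B e\<^sub>i\<^sub>+\<^sub>j \<rightarrow> B e\<^sub>i\<close> with \<open>e\<^sub>i\<^sub>+\<^sub>j \<mapsto> w\<close> sends \<open>x = x e\<^sub>i\<^sub>+\<^sub>j\<close> to \<open>x w\<close>.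
\<close>

definition alpha_map :: "nat \<Rightarrow> nat \<Rightarrow> 'k::field vec \<Rightarrow> nat \<Rightarrow> nat \<Rightarrow> 'k beil \<Rightarrow> 'k beil" where
  "alpha_map n r \<alpha> i j = (\<lambda>x\<in>carrier (proj_module n r (i + j)).
     x \<otimes>\<^bsub>beilinson_algebra n r\<^esub> arrow_comb_power n r \<alpha> i j)"

definition X_summand :: "nat \<Rightarrow> nat \<Rightarrow> 'k::field vec \<Rightarrow> nat \<Rightarrow> nat \<Rightarrow> ('k beil, 'k beil set) module" where
  "X_summand n r \<alpha> i j = quot_module (proj_module n r i)
     (alpha_map n r \<alpha> i j ` carrier (proj_module n r (i + j)))"

definition X_module :: "nat \<Rightarrow> nat \<Rightarrow> 'k::field vec \<Rightarrow> nat \<Rightarrow> ('k beil, nat \<Rightarrow> 'k beil set) module" where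
  "X_module n r \<alpha> j = direct_sum_module {..<n - j} (\<lambda>i. X_summand n r \<alpha> i j)"

section \<open>The subcategories of modules\<close>

definition alpha_mult :: "nat \<Rightarrow> nat \<Rightarrow> 'k::field vec \<Rightarrow> ('k beil, 'm) module \<Rightarrow> 'm \<Rightarrow> 'm" where
  "alpha_mult n r \<alpha> M x =
     (\<Oplus>\<^bsub>beilinson_algebra n r\<^esub>i\<in>{..<n - 1}. arrow_comb n r \<alpha> i) \<odot>\<^bsub>M\<^esub> x"

definition vertex_part :: "nat \<Rightarrow> nat \<Rightarrow> ('k::field beil, 'm) module \<Rightarrow> nat \<Rightarrow> 'm set" where
  "vertex_part n r M i = (\<lambda>x. idem n r i \<odot>\<^bsub>M\<^esub> x) ` carrier M"

definition EIP :: "nat \<Rightarrow> nat \<Rightarrow> ('k::field beil, 'm) module set" where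
  "EIP n r = {M \<in> fd_modules (beilinson_algebra n r). \<forall>\<alpha>\<in>carrier_vec r - {0\<^sub>v r}.
     alpha_mult n r \<alpha> M ` carrier M =
       {\<Oplus>\<^bsub>M\<^esub>i\<in>{1..n - 1}. x i | x. x \<in> (\<Pi> i\<in>{1..n - 1}. vertex_part n r M i)}}"

definition EKP :: "nat \<Rightarrow> nat \<Rightarrow> ('k::field beil, 'm) module set" where
  "EKP n r = {M \<in> fd_modules (beilinson_algebra n r). \<forall>\<alpha>\<in>carrier_vec r - {0\<^sub>v r}.
     a_kernel M M (alpha_mult n r \<alpha> M) = vertex_part n r M (n - 1)}"

definition alpha_rank :: "nat \<Rightarrow> nat \<Rightarrow> nat \<Rightarrow> 'k::field vec \<Rightarrow> ('k beil, 'm) module \<Rightarrow> nat" where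
  "alpha_rank n r j \<alpha> M = vectorspace.dim class_ring
     ((kspace (beilinson_algebra n r) M)\<lparr>carrier := (alpha_mult n r \<alpha> M ^^ j) ` carrier M\<rparr>)"

definition CR :: "nat \<Rightarrow> nat \<Rightarrow> nat \<Rightarrow> ('k::field beil, 'm) module set" where
  "CR j n r = {M \<in> fd_modules (beilinson_algebra n r). \<exists>c. \<forall>\<alpha>\<in>carrier_vec r - {0\<^sub>v r}.
     alpha_rank n r j \<alpha> M = c}"

end

theory Submission
  imports Defs
begin

text \<open>
Write \<open>B\<close> for the Beilinson algebra, \<open>e\<^sub>i\<close> for its vertex idempotents and \<open>w\<^sub>i = \<alpha>\<dots>\<alpha>\<close> for the
product of \<open>j\<close> linear forms that leads from vertex \<open>i\<close> to vertex \<open>i + j\<close>. The module \<open>X\<close> attached to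
\<open>\<alpha>\<close> and \<open>j\<close> has one generator \<open>x\<^sub>i\<close> with \<open>e\<^sub>i x\<^sub>i = x\<^sub>i\<close> for each \<open>i < n - j\<close>, and its only relations are
\<open>w\<^sub>i x\<^sub>i = 0\<close>. A homomorphism \<open>X \<rightarrow> M\<close> is therefore a family of \<open>u\<^sub>i \<in> M\<^sub>i\<close> with \<open>w\<^sub>i u\<^sub>i = 0\<close>, so for
\<open>j = 1\<close> all of them vanish exactly if \<open>\<alpha>\<close> is injective on \<open>M\<^sub>0, \<dots>, M\<^sub>n\<^sub>-\<^sub>2\<close>. This is the kernel
condition (\<open>Hom_trivial_iff\<close>, \<open>EKP_condition_iff\<close>).

The relations are moreover free of further syzygies: right multiplication by \<open>w\<^sub>i\<close> is injective on
\<open>B e\<^sub>i\<^sub>+\<^sub>j\<close> (\<open>arrow_comb_power_cancel\<close>). Hence \<open>Ext\<^sup>1(X, M)\<close> is the cokernel of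
\<open>\<alpha>\<^sub>M\<^sup>j\<close> as a map \<open>M \<rightarrow> M\<^sub>j \<oplus> \<dots> \<oplus> M\<^sub>n\<^sub>-\<^sub>1\<close>. Since \<open>Ext\<^sup>1\<close> is computed from an unknown free cover
\<open>q : F \<rightarrow> X\<close> with kernel \<open>K\<close>, Schanuel's comparison of resolutions is made explicit. Lifting \<open>q\<close> along
the generators gives coordinates \<open>f\<^sub>i : F \<rightarrow> B e\<^sub>i\<close>; on \<open>K\<close> the relations force \<open>f\<^sub>i(\<kappa>) = c\<^sub>i(\<kappa>) w\<^sub>i\<close> with a
unique \<open>c\<^sub>i(\<kappa>) \<in> B e\<^sub>i\<^sub>+\<^sub>j\<close>, and \<open>v \<mapsto> (\<kappa> \<mapsto> \<Sum>\<^sub>i c\<^sub>i(\<kappa>) v)\<close> induces a linear map from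
\<open>M\<^sub>j \<oplus> \<dots> \<oplus> M\<^sub>n\<^sub>-\<^sub>1\<close> onto \<open>Ext\<^sup>1(X, M)\<close> whose kernel is the image of \<open>\<alpha>\<^sub>M\<^sup>j\<close> (\<open>cocycle_in_N_iff\<close>,
\<open>hom_is_cocycle_mod_N\<close>). The image condition is the vanishing of this cokernel for \<open>j = 1\<close>, and
rank-nullity yields \<open>dim Ext\<^sup>1(X, M) + rk \<alpha>\<^sub>M\<^sup>j = dim M\<^sub>j + \<dots> + dim M\<^sub>n\<^sub>-\<^sub>1\<close>, where the right-hand side
does not involve \<open>\<alpha>\<close>; thus one summand is constant in \<open>\<alpha>\<close> if and only if the other one is.

The injectivity needs a concrete model of \<open>B\<close>. Sending a path from \<open>u\<close> to \<open>v\<close> to the commutative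
monomial of its labels defines a multiplicative map from the path algebra to \<open>n \<times> n\<close> matrices of
polynomials. Its kernel is the ideal of relations (\<open>beilinson_ideal_eq\<close>), because two words with the
same monomial differ by swaps of neighbouring letters, and each swap changes the path by a multiple of
a relation. So \<open>e\<^sub>v B e\<^sub>u\<close> lies in
a polynomial ring, where \<open>\<alpha>\<close> acts as multiplication by a nonzero linear polynomial; polynomial rings
over a field have no zero divisors.
\<close>


section \<open>Left modules, submodules and quotients\<close>

lemma left_moduleI:
  fixes R (structure) and M (structure)
  assumes "ring R" "abelian_group M"
    and "\<And>a x. \<lbrakk>a \<in> carrier R; x \<in> carrier M\<rbrakk> \<Longrightarrow> a \<odot>\<^bsub>M\<^esub> x \<in> carrier M"
    and "\<And>a b x. \<lbrakk>a \<in> carrier R; b \<in> carrier R; x \<in> carrier M\<rbrakk> \<Longrightarrow>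
      (a \<oplus>\<^bsub>R\<^esub> b) \<odot>\<^bsub>M\<^esub> x = a \<odot>\<^bsub>M\<^esub> x \<oplus>\<^bsub>M\<^esub> b \<odot>\<^bsub>M\<^esub> x"
    and "\<And>a x y. \<lbrakk>a \<in> carrier R; x \<in> carrier M; y \<in> carrier M\<rbrakk> \<Longrightarrow>
      a \<odot>\<^bsub>M\<^esub> (x \<oplus>\<^bsub>M\<^esub> y) = a \<odot>\<^bsub>M\<^esub> x \<oplus>\<^bsub>M\<^esub> a \<odot>\<^bsub>M\<^esub> y"
    and "\<And>a b x. \<lbrakk>a \<in> carrier R; b \<in> carrier R; x \<in> carrier M\<rbrakk> \<Longrightarrow>
      (a \<otimes>\<^bsub>R\<^esub> b) \<odot>\<^bsub>M\<^esub> x = a \<odot>\<^bsub>M\<^esub> (b \<odot>\<^bsub>M\<^esub> x)"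
    and "\<And>x. x \<in> carrier M \<Longrightarrow> \<one>\<^bsub>R\<^esub> \<odot>\<^bsub>M\<^esub> x = x"
  shows "left_module R M"
  by (intro left_module.intro left_module_axioms.intro) (fact assms)+

context left_module
begin

lemma act_zero_left: "x \<in> carrier M \<Longrightarrow> \<zero>\<^bsub>R\<^esub> \<odot>\<^bsub>M\<^esub> x = \<zero>\<^bsub>M\<^esub>"
proof -
  assume x: "x \<in> carrier M"
  have "\<zero>\<^bsub>R\<^esub> \<odot>\<^bsub>M\<^esub> x = \<zero>\<^bsub>R\<^esub> \<odot>\<^bsub>M\<^esub> x \<oplus>\<^bsub>M\<^esub> \<zero>\<^bsub>R\<^esub> \<odot>\<^bsub>M\<^esub> x"
    using act_l_distr[of "\<zero>\<^bsub>R\<^esub>" "\<zero>\<^bsub>R\<^esub>" x] x by simp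
  then show ?thesis
    using x by (metis act_closed R.zero_closed M.add.r_cancel_one')
qed

lemma act_zero_right: "a \<in> carrier R \<Longrightarrow> a \<odot>\<^bsub>M\<^esub> \<zero>\<^bsub>M\<^esub> = \<zero>\<^bsub>M\<^esub>"
  by (metis M.r_zero M.zero_closed act_closed act_r_distr M.add.r_cancel_one')

lemma act_minus_one: "x \<in> carrier M \<Longrightarrow> (\<ominus>\<^bsub>R\<^esub> \<one>\<^bsub>R\<^esub>) \<odot>\<^bsub>M\<^esub> x = \<ominus>\<^bsub>M\<^esub> x"
proof -
  assume x: "x \<in> carrier M"
  have "(\<ominus>\<^bsub>R\<^esub> \<one>\<^bsub>R\<^esub>) \<odot>\<^bsub>M\<^esub> x \<oplus>\<^bsub>M\<^esub> x = ((\<ominus>\<^bsub>R\<^esub> \<one>\<^bsub>R\<^esub>) \<oplus>\<^bsub>R\<^esub> \<one>\<^bsub>R\<^esub>) \<odot>\<^bsub>M\<^esub> x"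
    using x by (simp add: act_l_distr act_one)
  then show ?thesis
    using x by (simp add: R.l_neg act_zero_left act_closed M.minus_equality)
qed

lemma act_minus_right:
  assumes "a \<in> carrier R" "x \<in> carrier M" shows "a \<odot>\<^bsub>M\<^esub> (\<ominus>\<^bsub>M\<^esub> x) = \<ominus>\<^bsub>M\<^esub> (a \<odot>\<^bsub>M\<^esub> x)"
proof -
  have "a \<odot>\<^bsub>M\<^esub> (\<ominus>\<^bsub>M\<^esub> x) \<oplus>\<^bsub>M\<^esub> a \<odot>\<^bsub>M\<^esub> x = \<zero>\<^bsub>M\<^esub>"
    using assms by (simp add: act_r_distr[symmetric] M.l_neg act_zero_right)
  then show ?thesis
    using assms by (simp add: act_closed M.minus_equality)
qed

lemma act_finsum_right:
  assumes "a \<in> carrier R" "f \<in> S \<rightarrow> carrier M"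
  shows "a \<odot>\<^bsub>M\<^esub> finsum M f S = finsum M (\<lambda>i. a \<odot>\<^bsub>M\<^esub> f i) S"
  using assms(2)
proof (induct S rule: infinite_finite_induct)
  case (insert i S)
  then have "f i \<in> carrier M" "f \<in> S \<rightarrow> carrier M" "(\<lambda>i. a \<odot>\<^bsub>M\<^esub> f i) \<in> S \<rightarrow> carrier M"
    using assms(1) by (auto intro: act_closed)
  with insert assms(1) show ?case
    by (simp add: M.finsum_closed act_r_distr act_closed)
qed (use assms(1) in \<open>auto simp: act_zero_right\<close>)

lemma act_finsum_left:
  assumes "x \<in> carrier M" "f \<in> S \<rightarrow> carrier R"
  shows "finsum R f S \<odot>\<^bsub>M\<^esub> x = finsum M (\<lambda>i. f i \<odot>\<^bsub>M\<^esub> x) S"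
  using assms(2)
proof (induct S rule: infinite_finite_induct)
  case (insert i S)
  then have "f i \<in> carrier R" "f \<in> S \<rightarrow> carrier R" "(\<lambda>i. f i \<odot>\<^bsub>M\<^esub> x) \<in> S \<rightarrow> carrier M"
    using assms(1) by (auto intro: act_closed)
  with insert assms(1) show ?case
    by (simp add: R.finsum_closed act_l_distr act_closed)
qed (use assms(1) in \<open>auto simp: act_zero_left\<close>)

end

text \<open>
Closure under negation is left out because \<open>- x = (- 1) x\<close>. The notion serves both for \<open>A\<close>-submodules
and, with the ground field as ring, for subspaces.
\<close>

definition left_submodule ::
    "('a, 'b) ring_scheme \<Rightarrow> 'm set \<Rightarrow> ('a, 'm, 'c) module_scheme \<Rightarrow> bool" where
  "left_submodule R N M \<longleftrightarrow> N \<subseteq> carrier M \<and> \<zero>\<^bsub>M\<^esub> \<in> N \<and> (\<forall>x\<in>N. \<forall>y\<in>N. x \<oplus>\<^bsub>M\<^esub> y \<in> N) \<and>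
     (\<forall>a\<in>carrier R. \<forall>x\<in>N. a \<odot>\<^bsub>M\<^esub> x \<in> N)"

lemma left_submoduleI:
  assumes "N \<subseteq> carrier M" "\<zero>\<^bsub>M\<^esub> \<in> N" "\<And>x y. x \<in> N \<Longrightarrow> y \<in> N \<Longrightarrow> x \<oplus>\<^bsub>M\<^esub> y \<in> N"
    "\<And>a x. a \<in> carrier R \<Longrightarrow> x \<in> N \<Longrightarrow> a \<odot>\<^bsub>M\<^esub> x \<in> N"
  shows "left_submodule R N M"
  using assms unfolding left_submodule_def by blast

context left_module
begin

lemma submodule_minus_closed:
  assumes "left_submodule R N M" "x \<in> N" shows "\<ominus>\<^bsub>M\<^esub> x \<in> N"
  using assms act_minus_one[of x] unfolding left_submodule_def
  by (metis R.add.inv_closed R.one_closed subsetD)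

lemma submodule_abelian_subgroup:
  assumes "left_submodule R N M" shows "abelian_subgroup N M"
proof (rule abelian_subgroupI3)
  show "additive_subgroup N M"
    using assms submodule_minus_closed[OF assms] unfolding left_submodule_def
    by (intro additive_subgroup.intro M.add.subgroupI) (auto simp: a_inv_def)
qed (rule M.abelian_group_axioms)

lemma submodule_left_module:
  assumes N: "left_submodule R N M" shows "left_module R (M\<lparr>carrier := N\<rparr>)"
proof (rule left_moduleI)
  note N' = N[unfolded left_submodule_def]
  show "abelian_group (M\<lparr>carrier := N\<rparr>)"
    by (rule abelian_groupI)
      (use N' submodule_minus_closed[OF N] in
        \<open>auto simp: M.a_ac subset_iff intro!: bexI[of _ "\<ominus>\<^bsub>M\<^esub> x" for x] M.l_neg M.r_neg\<close>)
qed (use N[unfolded left_submodule_def] in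
    \<open>auto simp: subset_iff R.ring_axioms act_l_distr act_r_distr act_assoc act_one\<close>)

end

lemma quot_module_sel:
  shows carrier_quot_module: "carrier (quot_module M N) = a_rcosets\<^bsub>M\<^esub> N"
    and mult_quot_module: "mult (quot_module M N) = rcoset_mult M N"
    and one_quot_module: "one (quot_module M N) = N +>\<^bsub>M\<^esub> \<one>\<^bsub>M\<^esub>"
    and zero_quot_module: "zero (quot_module M N) = N"
    and add_quot_module: "add (quot_module M N) = set_add M"
    and smult_quot_module: "smult (quot_module M N) = (\<lambda>a X. \<Union>x\<in>X. N +>\<^bsub>M\<^esub> (a \<odot>\<^bsub>M\<^esub> x))"
  by (simp_all add: quot_module_def ring.defs module.defs FactRing_def)

lemma carrier_quot_module_image: "carrier (quot_module M N) = (\<lambda>x. N +>\<^bsub>M\<^esub> x) ` carrier M"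
  by (auto simp: carrier_quot_module A_RCOSETS_def')

context
  fixes R :: "('a, 'b) ring_scheme" and M :: "('a, 'm) module"
  assumes left_module: "left_module R M"
begin

interpretation left_module R M by (fact left_module)

lemma coset_eq_iff:
  assumes "left_submodule R N M" "x \<in> carrier M" "y \<in> carrier M"
  shows "N +>\<^bsub>M\<^esub> x = N +>\<^bsub>M\<^esub> y \<longleftrightarrow> x \<ominus>\<^bsub>M\<^esub> y \<in> N"
proof -
  interpret N: abelian_subgroup N M by (rule submodule_abelian_subgroup[OF assms(1)])
  show ?thesis
    using assms N.a_rcos_module[of y x] N.a_repr_independence'[of x y] N.a_rcos_self[of x]
    by (auto simp: M.minus_eq)
qed

lemma coset_eq_zero_iff:
  assumes "left_submodule R N M" "x \<in> carrier M"
  shows "N +>\<^bsub>M\<^esub> x = N \<longleftrightarrow> x \<in> N"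
proof -
  interpret N: abelian_subgroup N M by (rule submodule_abelian_subgroup[OF assms(1)])
  show ?thesis
    using assms N.a_rcos_const N.a_rcos_self[of x] by blast
qed

lemma coset_add:
  assumes "left_submodule R N M" "x \<in> carrier M" "y \<in> carrier M"
  shows "(N +>\<^bsub>M\<^esub> x) \<oplus>\<^bsub>quot_module M N\<^esub> (N +>\<^bsub>M\<^esub> y) = N +>\<^bsub>M\<^esub> (x \<oplus>\<^bsub>M\<^esub> y)"
proof -
  interpret N: abelian_subgroup N M by (rule submodule_abelian_subgroup[OF assms(1)])
  show ?thesis using assms by (simp add: add_quot_module N.a_rcos_sum)
qed

text \<open>
The action on a quotient is defined as a union over all representatives; it is the coset of one
representative because all members of the union are equal.
\<close>

lemma coset_act:
  assumes N: "left_submodule R N M" and a: "a \<in> carrier R" and x: "x \<in> carrier M"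
  shows "a \<odot>\<^bsub>quot_module M N\<^esub> (N +>\<^bsub>M\<^esub> x) = N +>\<^bsub>M\<^esub> (a \<odot>\<^bsub>M\<^esub> x)"
proof -
  interpret N: abelian_subgroup N M by (rule submodule_abelian_subgroup[OF N])
  have "N +>\<^bsub>M\<^esub> (a \<odot>\<^bsub>M\<^esub> y) = N +>\<^bsub>M\<^esub> (a \<odot>\<^bsub>M\<^esub> x)" if y: "y \<in> N +>\<^bsub>M\<^esub> x" for y
  proof -
    have yM: "y \<in> carrier M" using y x N.a_subset M.a_r_coset_subset_G by blast
    have "N +>\<^bsub>M\<^esub> y = N +>\<^bsub>M\<^esub> x" using y x N.a_repr_independence'[of y x] by simp
    then have "y \<ominus>\<^bsub>M\<^esub> x \<in> N" using coset_eq_iff[OF N yM x] by simp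
    then have "a \<odot>\<^bsub>M\<^esub> (y \<ominus>\<^bsub>M\<^esub> x) \<in> N" using N a unfolding left_submodule_def by blast
    then show ?thesis
      using coset_eq_iff[OF N] a x yM
      by (simp add: act_closed M.minus_eq act_r_distr act_minus_right)
  qed
  moreover have "N +>\<^bsub>M\<^esub> x \<noteq> {}"
    using N.a_rcos_self[OF x] by blast
  ultimately show ?thesis
    unfolding smult_quot_module by (intro SUP_eq_const)
qed

lemma quot_left_module:
  assumes N: "left_submodule R N M" shows "left_module R (quot_module M N)"
proof (rule left_moduleI)
  interpret N: abelian_subgroup N M by (rule submodule_abelian_subgroup[OF N])
  note simps = carrier_quot_module_image coset_add[OF N] coset_act[OF N]
  show "abelian_group (quot_module M N)"
  proof (rule abelian_groupI)
    show z: "\<zero>\<^bsub>quot_module M N\<^esub> \<in> carrier (quot_module M N)"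
      using coset_eq_zero_iff[OF N, of "\<zero>\<^bsub>M\<^esub>"]
      by (auto simp: carrier_quot_module_image zero_quot_module image_iff intro!: bexI[of _ "\<zero>\<^bsub>M\<^esub>"])
    fix X assume "X \<in> carrier (quot_module M N)"
    then obtain x where x: "x \<in> carrier M" "X = N +>\<^bsub>M\<^esub> x" by (auto simp: simps)
    have z: "\<zero>\<^bsub>quot_module M N\<^esub> = N +>\<^bsub>M\<^esub> \<zero>\<^bsub>M\<^esub>"
      using coset_eq_zero_iff[OF N, of "\<zero>\<^bsub>M\<^esub>"] by (simp add: zero_quot_module)
    show "\<zero>\<^bsub>quot_module M N\<^esub> \<oplus>\<^bsub>quot_module M N\<^esub> X = X"
      unfolding z using x by (simp add: simps)
    show "\<exists>Y\<in>carrier (quot_module M N). Y \<oplus>\<^bsub>quot_module M N\<^esub> X = \<zero>\<^bsub>quot_module M N\<^esub>"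
      unfolding z using x by (intro bexI[of _ "N +>\<^bsub>M\<^esub> (\<ominus>\<^bsub>M\<^esub> x)"]) (auto simp: simps M.l_neg)
  qed (auto simp: simps M.a_ac)
qed (auto simp: carrier_quot_module_image coset_add[OF N] coset_act[OF N] R.ring_axioms
    act_closed act_l_distr act_r_distr act_assoc act_one)

end

text \<open>
Everything below is done with left modules; this gives access to dimensions and rank-nullity.
\<close>

lemma class_ring_vectorspace:
  assumes "left_module (class_ring :: 'k::field ring) V" shows "vectorspace class_ring V"
proof -
  interpret left_module "class_ring :: 'k ring" V by fact
  have cring: "cring (class_ring :: 'k ring)"
    using class_field[where ?'a = 'k] by (simp add: field_def domain_def)
  show ?thesis
    by (intro vectorspace.intro moduleI class_field cring M.abelian_group_axioms)
      (use act_closed act_assoc act_one act_l_distr act_r_distr in auto)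
qed

lemma module_homI:
  assumes "\<And>x. x \<in> carrier M \<Longrightarrow> f x \<in> carrier N"
    "\<And>x y. x \<in> carrier M \<Longrightarrow> y \<in> carrier M \<Longrightarrow> f (x \<oplus>\<^bsub>M\<^esub> y) = f x \<oplus>\<^bsub>N\<^esub> f y"
    "\<And>a x. a \<in> carrier R \<Longrightarrow> x \<in> carrier M \<Longrightarrow> f (a \<odot>\<^bsub>M\<^esub> x) = a \<odot>\<^bsub>N\<^esub> f x"
  shows "f \<in> module_hom R M N"
  using assms unfolding module_hom_def by auto

lemma module_hom_mem: "f \<in> module_hom R M N \<Longrightarrow> x \<in> carrier M \<Longrightarrow> f x \<in> carrier N"
  unfolding module_hom_def by auto

lemma module_hom_zero:
  assumes "left_module R M" "left_module R N" "f \<in> module_hom R M N"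
  shows "f \<zero>\<^bsub>M\<^esub> = \<zero>\<^bsub>N\<^esub>"
proof -
  interpret M: left_module R M by fact
  interpret N: left_module R N by fact
  have "f (\<zero>\<^bsub>R\<^esub> \<odot>\<^bsub>M\<^esub> \<zero>\<^bsub>M\<^esub>) = \<zero>\<^bsub>R\<^esub> \<odot>\<^bsub>N\<^esub> f \<zero>\<^bsub>M\<^esub>"
    using assms(3) by (simp add: module_hom_smult)
  then show ?thesis
    using assms(3) by (simp add: M.act_zero_left N.act_zero_left module_hom_mem)
qed

lemma module_hom_finsum:
  assumes "left_module R M" "left_module R N" "f \<in> module_hom R M N" "g \<in> S \<rightarrow> carrier M"
  shows "f (finsum M g S) = finsum N (\<lambda>i. f (g i)) S"
proof -
  interpret M: left_module R M by fact
  interpret N: left_module R N by fact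
  show ?thesis
    using assms(4)
  proof (induct S rule: infinite_finite_induct)
    case (insert i S)
    then have "g i \<in> carrier M" "g \<in> S \<rightarrow> carrier M" "(\<lambda>i. f (g i)) \<in> S \<rightarrow> carrier N"
      using assms(3) by (auto intro: module_hom_mem)
    with insert assms(3) show ?case
      by (simp add: M.M.finsum_closed module_hom_add module_hom_mem)
  qed (use module_hom_zero[OF assms(1-3)] in auto)
qed

lemma module_hom_minus:
  assumes "left_module R M" "left_module R N" "f \<in> module_hom R M N"
    "x \<in> carrier M" "y \<in> carrier M"
  shows "f (x \<ominus>\<^bsub>M\<^esub> y) = f x \<ominus>\<^bsub>N\<^esub> f y"
proof -
  interpret M: left_module R M by fact
  interpret N: left_module R N by fact
  have "f (\<ominus>\<^bsub>M\<^esub> y) = \<ominus>\<^bsub>N\<^esub> f y"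
    using assms(3,5) module_hom_smult[OF assms(3), of "\<ominus>\<^bsub>R\<^esub> \<one>\<^bsub>R\<^esub>" y]
    by (simp add: M.act_minus_one N.act_minus_one module_hom_mem)
  then show ?thesis
    using assms by (simp add: M.M.minus_eq N.M.minus_eq module_hom_add)
qed

lemma a_kernel_iff: "x \<in> a_kernel M N f \<longleftrightarrow> x \<in> carrier M \<and> f x = \<zero>\<^bsub>N\<^esub>"
  by (auto simp: a_kernel_def kernel_def)

lemma kernel_left_submodule:
  assumes "left_module R M" "left_module R N" "f \<in> module_hom R M N"
  shows "left_submodule R (a_kernel M N f) M"
proof -
  interpret M: left_module R M by fact
  interpret N: left_module R N by fact
  show ?thesis
    using assms module_hom_zero[OF assms]
    by (intro left_submoduleI)
      (auto simp: a_kernel_iff M.act_closed module_hom_add module_hom_smult N.act_zero_right)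
qed

lemma image_left_submodule:
  assumes "left_module R M" "left_module R N" "f \<in> module_hom R M N"
  shows "left_submodule R (f ` carrier M) N"
proof -
  interpret M: left_module R M by fact
  interpret N: left_module R N by fact
  show ?thesis
  proof (rule left_submoduleI)
    show "\<zero>\<^bsub>N\<^esub> \<in> f ` carrier M"
      using module_hom_zero[OF assms] by (metis M.M.zero_closed imageI)
  qed (use assms(3) in \<open>auto simp: module_hom_mem M.act_closed
        simp flip: module_hom_add module_hom_smult\<close>)
qed

lemma carrier_direct_sum: "carrier (direct_sum_module I M) = (\<Pi>\<^sub>E i\<in>I. carrier (M i))"
  and zero_direct_sum: "zero (direct_sum_module I M) = (\<lambda>i\<in>I. \<zero>\<^bsub>M i\<^esub>)"
  and add_direct_sum: "add (direct_sum_module I M) = (\<lambda>x y. \<lambda>i\<in>I. x i \<oplus>\<^bsub>M i\<^esub> y i)"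
  and smult_direct_sum: "smult (direct_sum_module I M) = (\<lambda>a x. \<lambda>i\<in>I. a \<odot>\<^bsub>M i\<^esub> x i)"
  by (simp_all add: direct_sum_module_def)

lemmas direct_sum_sel = carrier_direct_sum zero_direct_sum add_direct_sum smult_direct_sum

lemma direct_sum_left_module:
  assumes R: "ring R" and M: "\<And>i. i \<in> I \<Longrightarrow> left_module R (M i)"
  shows "left_module R (direct_sum_module I M)"
proof (rule left_moduleI[OF R])
  have ab: "\<And>i. i \<in> I \<Longrightarrow> abelian_group (M i)"
    using M by (auto simp: left_module_def)
  show "abelian_group (direct_sum_module I M)"
  proof (rule abelian_groupI, goal_cases)
    case 1 then show ?case using ab
      by (auto simp: direct_sum_sel PiE_iff abelian_group.axioms(1) intro: abelian_monoid.a_closed)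
  next
    case 2 then show ?case using ab
      by (auto simp: direct_sum_sel abelian_group.axioms(1) intro: abelian_monoid.zero_closed)
  next
    case 3 then show ?case using ab
      by (auto simp: direct_sum_sel PiE_iff abelian_group.axioms(1) abelian_monoid.a_assoc intro!: restrict_ext)
  next
    case 4 then show ?case using ab
      by (auto simp: direct_sum_sel PiE_iff abelian_group.axioms(1) abelian_monoid.a_comm intro!: restrict_ext)
  next
    case (5 x) then show ?case using ab
      by (auto simp: direct_sum_sel PiE_iff abelian_group.axioms(1) abelian_monoid.l_zero
        intro!: extensionalityI[of _ I x])
  next
    case (6 x) then show ?case using ab
      by (auto simp: direct_sum_sel PiE_iff abelian_group.l_neg intro!: bexI[of _ "\<lambda>i\<in>I. \<ominus>\<^bsub>M i\<^esub> x i"] restrict_ext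
         abelian_group.a_inv_closed)
  qed
qed (use M in \<open>auto simp: direct_sum_sel PiE_iff left_module.act_l_distr left_module.act_r_distr[of R]
  left_module.act_assoc left_module.act_one extensional_def
  intro!: restrict_ext ext left_module.act_closed\<close>)

lemma direct_sum_finsum:
  assumes R: "ring R" and M: "\<And>i. i \<in> I \<Longrightarrow> left_module R (M i)"
    and f: "f \<in> S \<rightarrow> carrier (direct_sum_module I M)" and i: "i \<in> I"
  shows "finsum (direct_sum_module I M) f S i = finsum (M i) (\<lambda>s. f s i) S"
proof -
  interpret left_module R "direct_sum_module I M" by (rule direct_sum_left_module[OF R M])
  interpret Mi: left_module R "M i" by (rule M[OF i])
  have "(\<lambda>x. x i) \<in> module_hom R (direct_sum_module I M) (M i)"
    by (rule module_homI) (use i in \<open>auto simp: direct_sum_sel PiE_iff\<close>)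
  from module_hom_finsum[OF left_module_axioms Mi.left_module_axioms this f] show ?thesis .
qed

section \<open>Algebras over a field, spaces of homomorphisms and free modules\<close>

text \<open>
The last two axioms say that \<open>c \<odot> \<one>\<close> is central and that \<open>c \<odot> a = (c \<odot> \<one>) a\<close>. This makes the space of
homomorphisms between two left modules a vector space.
\<close>

locale field_algebra = ring A + vs: left_module "class_ring :: 'k ring" A
  for A :: "('k::field, 'a) module" (structure) +
  assumes smult_mult_left: "\<lbrakk>a \<in> carrier A; b \<in> carrier A\<rbrakk> \<Longrightarrow> c \<odot> (a \<otimes> b) = (c \<odot> a) \<otimes> b"
    and smult_mult_right: "\<lbrakk>a \<in> carrier A; b \<in> carrier A\<rbrakk> \<Longrightarrow> c \<odot> (a \<otimes> b) = a \<otimes> (c \<odot> b)"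
begin

lemma smult_closed: "a \<in> carrier A \<Longrightarrow> c \<odot> a \<in> carrier A"
  using vs.act_closed[of c a] by simp

lemma smult_as_mult: "a \<in> carrier A \<Longrightarrow> c \<odot> a = (c \<odot> \<one>) \<otimes> a"
  using smult_mult_left[of \<one> a c] by simp

lemma smult_one_central: "a \<in> carrier A \<Longrightarrow> (c \<odot> \<one>) \<otimes> a = a \<otimes> (c \<odot> \<one>)"
  using smult_mult_right[of a \<one> c] smult_as_mult[of a c] by simp

lemma ideal_left_submodule:
  assumes "ideal J A" shows "left_submodule (class_ring :: 'k ring) J A"
proof -
  interpret J: ideal J A by fact
  show ?thesis
  proof (rule left_submoduleI)
    fix c :: 'k and x assume "x \<in> J"
    then show "c \<odot> x \<in> J"
      using J.I_l_closed[of x "c \<odot> \<one>"] smult_as_mult[of x c] J.a_subset by (auto simp: smult_closed)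
  qed (use J.a_subset in auto)
qed

end

lemma ring_transfer:
  assumes "ring R" "carrier S = carrier R" "mult S = mult R" "one S = one R" "zero S = zero R" "add S = add R"
  shows "ring S"
proof -
  interpret ring R by fact
  show ?thesis
    by (intro ringI abelian_groupI monoidI)
      (auto simp: assms(2-) a_ac m_assoc l_distr r_distr intro!: bexI[of _ "\<ominus>\<^bsub>R\<^esub> x" for x] l_neg)
qed

lemma field_algebra_quotient:
  assumes "field_algebra A" and J: "ideal J A" shows "field_algebra (quot_module A J)"
proof -
  interpret field_algebra A by fact
  interpret J: ideal J A by fact
  note sub = ideal_left_submodule[OF J]
  have "ring (quot_module A J)"
    by (rule ring_transfer[OF J.quotient_is_ring]) (simp_all add: quot_module_sel FactRing_def)
  moreover have "left_module class_ring (quot_module A J)"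
    by (rule quot_left_module[OF vs.left_module_axioms sub])
  ultimately show ?thesis
    using coset_act[OF vs.left_module_axioms sub]
    by (intro field_algebra.intro field_algebra_axioms.intro)
      (auto simp: carrier_quot_module_image mult_quot_module J.rcoset_mult_add smult_closed
        smult_mult_left smult_mult_right[symmetric] simp flip: smult_mult_left
        intro!: arg_cong[where f = "(+>\<^bsub>A\<^esub>) J"] smult_mult_right smult_mult_left)
qed

lemma kspace_sel:
  shows carrier_kspace: "carrier (kspace A M) = carrier M"
    and zero_kspace: "zero (kspace A M) = zero M"
    and add_kspace: "add (kspace A M) = add M"
    and smult_kspace: "smult (kspace A M) = (\<lambda>c x. (c \<odot>\<^bsub>A\<^esub> \<one>\<^bsub>A\<^esub>) \<odot>\<^bsub>M\<^esub> x)"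
  by (simp_all add: kspace_def)

lemma Hom_sel:
  shows carrier_Hom: "carrier (Hom A X M) = module_hom A X M \<inter> extensional (carrier X)"
    and zero_Hom: "zero (Hom A X M) = (\<lambda>x\<in>carrier X. \<zero>\<^bsub>M\<^esub>)"
    and add_Hom: "add (Hom A X M) = (\<lambda>f g. \<lambda>x\<in>carrier X. f x \<oplus>\<^bsub>M\<^esub> g x)"
    and smult_Hom: "smult (Hom A X M) = (\<lambda>c f. \<lambda>x\<in>carrier X. (c \<odot>\<^bsub>A\<^esub> \<one>\<^bsub>A\<^esub>) \<odot>\<^bsub>M\<^esub> f x)"
  by (simp_all add: Hom_def kspace_sel)

lemma regular_sel:
  shows carrier_regular: "carrier (regular_module A) = carrier A"
    and zero_regular: "zero (regular_module A) = zero A"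
    and add_regular: "add (regular_module A) = add A"
    and smult_regular: "smult (regular_module A) = mult A"
  by (simp_all add: regular_module_def)

lemma finsum_regular: "finsum (regular_module A) = finsum A"
  by (rule ext)+ (simp add: finsum_def finprod_def regular_module_def)

lemma regular_left_module: assumes "ring A" shows "left_module A (regular_module A)"
proof -
  interpret ring A by fact
  show ?thesis
    by (intro left_moduleI abelian_groupI)
      (auto simp: regular_sel a_ac m_assoc l_distr r_distr ring_axioms
        intro!: bexI[of _ "\<ominus>\<^bsub>A\<^esub> x" for x] l_neg)
qed

context field_algebra
begin

lemma scalar_add: "(c + d) \<odot> \<one> = (c \<odot> \<one>) \<oplus> (d \<odot> \<one>)"
  using vs.act_l_distr[of c d \<one>] by simp

lemma scalar_mult: "(c * d) \<odot> \<one> = (c \<odot> \<one>) \<otimes> (d \<odot> \<one>)"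
  using vs.act_assoc[of c d \<one>] smult_as_mult[of "d \<odot> \<one>" c] by (simp add: smult_closed)

lemma scalar_one: "1 \<odot> \<one> = \<one>"
  using vs.act_one[of \<one>] by simp

lemma scalar_act_commute:
  assumes "left_module A M" "a \<in> carrier A" "x \<in> carrier M"
  shows "(c \<odot> \<one>) \<odot>\<^bsub>M\<^esub> (a \<odot>\<^bsub>M\<^esub> x) = a \<odot>\<^bsub>M\<^esub> ((c \<odot> \<one>) \<odot>\<^bsub>M\<^esub> x)"
proof -
  interpret M: left_module A M by fact
  show ?thesis
    using assms by (simp add: M.act_assoc[symmetric] smult_closed smult_one_central)
qed

lemma kspace_left_module:
  assumes "left_module A M" shows "left_module (class_ring :: 'k ring) (kspace A M)"
proof -
  interpret M: left_module A M by fact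
  show ?thesis
    by (intro left_moduleI abelian_groupI class_ring.ring_axioms)
      (auto simp: kspace_sel M.act_closed M.act_l_distr M.act_r_distr M.act_assoc M.act_one M.M.a_ac
        smult_closed scalar_add scalar_mult scalar_one
        intro!: bexI[of _ "\<ominus>\<^bsub>M\<^esub> x" for x] M.M.l_neg)
qed

lemma Hom_left_module:
  assumes "left_module A X" "left_module A M"
  shows "left_module (class_ring :: 'k ring) (Hom A X M)"
proof -
  interpret X: left_module A X by fact
  interpret M: left_module A M by fact
  note mem = module_hom_mem[of _ A X M]
  have inv: "(\<lambda>x\<in>carrier X. \<ominus>\<^bsub>M\<^esub> f x) \<in> module_hom A X M" if "f \<in> module_hom A X M" for f
    using that
    by (intro module_homI) (auto simp: mem module_hom_add module_hom_smult X.act_closed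
        M.M.minus_add M.act_minus_right)
  show ?thesis
  proof (intro left_moduleI abelian_groupI class_ring.ring_axioms, goal_cases)
    case (1 f g) then show ?case
      by (auto simp: Hom_sel mem module_hom_add module_hom_smult X.act_closed M.act_r_distr M.M.a_ac
         intro!: module_homI)
  next
    case 2 show ?case
      by (auto simp: Hom_sel X.act_closed M.act_zero_right intro!: module_homI)
  next
    case (6 f) then show ?case
      by (intro bexI[of _ "\<lambda>x\<in>carrier X. \<ominus>\<^bsub>M\<^esub> f x"])
        (auto simp: Hom_sel mem M.M.l_neg inv intro!: restrict_ext)
  next
    case (7 c f) then show ?case
      by (auto simp: Hom_sel mem module_hom_add module_hom_smult X.act_closed M.act_r_distr
          M.act_closed smult_closed scalar_act_commute[OF assms(2)] intro!: module_homI)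
  qed (auto simp: Hom_sel mem M.M.a_ac M.act_closed M.act_l_distr M.act_r_distr M.act_assoc M.act_one
      smult_closed scalar_add scalar_mult scalar_one extensional_def intro!: ext)
qed

end

lemma free_left_module: "ring A \<Longrightarrow> left_module A (free_module A m)"
  unfolding free_module_def by (intro direct_sum_left_module regular_left_module)

lemma free_sel:
  shows carrier_free: "carrier (free_module A m) = (\<Pi>\<^sub>E i\<in>{..<m}. carrier A)"
    and zero_free: "zero (free_module A m) = (\<lambda>i\<in>{..<m}. \<zero>\<^bsub>A\<^esub>)"
    and add_free: "add (free_module A m) = (\<lambda>x y. \<lambda>i\<in>{..<m}. x i \<oplus>\<^bsub>A\<^esub> y i)"
    and smult_free: "smult (free_module A m) = (\<lambda>a x. \<lambda>i\<in>{..<m}. a \<otimes>\<^bsub>A\<^esub> x i)"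
  by (simp_all add: free_module_def direct_sum_sel regular_sel)

definition free_unit :: "('k, 'a) module \<Rightarrow> nat \<Rightarrow> nat \<Rightarrow> nat \<Rightarrow> 'a" where
  "free_unit A m t = (\<lambda>s\<in>{..<m}. if s = t then \<one>\<^bsub>A\<^esub> else \<zero>\<^bsub>A\<^esub>)"

lemma (in ring) finsum_delta:
  assumes "finite S" "i \<in> S" "f i \<in> carrier R"
  shows "(\<Oplus>j\<in>S. if j = i then f j else \<zero>) = f i"
proof -
  have "(\<Oplus>j\<in>S. if j = i then f j else \<zero>) = (\<Oplus>j\<in>S. if i = j then f i else \<zero>)"
    using assms(3) by (intro finsum_cong') auto
  also have "\<dots> = f i"
    using add.finprod_singleton[of i S "\<lambda>_. f i"] assms by simp
  finally show ?thesis .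
qed

lemma free_module_expand:
  assumes "ring A" and b: "b \<in> carrier (free_module A m)"
  shows "b = finsum (free_module A m) (\<lambda>t. b t \<odot>\<^bsub>free_module A m\<^esub> free_unit A m t) {..<m}"
    (is "b = ?s")
proof -
  interpret ring A by fact
  interpret F: left_module A "free_module A m" by (rule free_left_module) fact
  have bc: "b t \<in> carrier A" if "t < m" for t
    using b that by (auto simp: free_sel)
  have mem: "(\<lambda>t. b t \<odot>\<^bsub>free_module A m\<^esub> free_unit A m t) \<in> {..<m} \<rightarrow> carrier (free_module A m)"
    using bc by (auto intro!: F.act_closed simp: free_sel free_unit_def)
  show ?thesis
  proof (rule extensionalityI[of _ "{..<m}"])
    show "b \<in> extensional {..<m}" "?s \<in> extensional {..<m}"
      using b F.M.finsum_closed[OF mem] unfolding carrier_free PiE_def by blast+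
    fix s assume s: "s \<in> {..<m}"
    have "?s s = finsum A (\<lambda>t. (b t \<odot>\<^bsub>free_module A m\<^esub> free_unit A m t) s) {..<m}"
      using direct_sum_finsum[OF \<open>ring A\<close>, of "{..<m}" "\<lambda>_. regular_module A", folded free_module_def,
          OF regular_left_module[OF \<open>ring A\<close>] mem s]
      by (simp add: finsum_regular)
    also have "\<dots> = finsum A (\<lambda>t. if t = s then b t else \<zero>\<^bsub>A\<^esub>) {..<m}"
      using s bc by (intro finsum_cong') (auto simp: free_sel free_unit_def)
    also have "\<dots> = b s"
      using s bc by (intro finsum_delta) auto
    finally show "b s = ?s s" by simp
  qed
qed

text \<open>
Any coordinate functions on \<open>F\<close> can be combined with any vectors of \<open>U\<close>. All homomorphisms that are
constructed below have this form.
\<close>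

lemma linear_comb_hom:
  assumes "ring A" and U: "left_module A U" and F: "left_module A F"
    and f: "\<And>i. i \<in> S \<Longrightarrow> f i \<in> module_hom A F (regular_module A)"
    and u: "\<And>i. i \<in> S \<Longrightarrow> u i \<in> carrier U"
  shows "(\<lambda>b. finsum U (\<lambda>i. f i b \<odot>\<^bsub>U\<^esub> u i) S) \<in> module_hom A F U"
proof -
  interpret ring A by fact
  interpret F: left_module A F by fact
  interpret U: left_module A U by fact
  have fc: "i \<in> S \<Longrightarrow> b \<in> carrier F \<Longrightarrow> f i b \<in> carrier A" for i b
    using module_hom_mem[OF f] by (simp add: regular_sel)
  show ?thesis
  proof (rule module_homI)
    fix b c assume "b \<in> carrier F" "c \<in> carrier F"
    moreover from this have "finsum U (\<lambda>i. f i (b \<oplus>\<^bsub>F\<^esub> c) \<odot>\<^bsub>U\<^esub> u i) S =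
        finsum U (\<lambda>i. f i b \<odot>\<^bsub>U\<^esub> u i \<oplus>\<^bsub>U\<^esub> f i c \<odot>\<^bsub>U\<^esub> u i) S"
      using module_hom_add[OF f] u fc
      by (intro U.M.finsum_cong') (auto simp: regular_sel U.act_l_distr U.act_closed)
    ultimately show "finsum U (\<lambda>i. f i (b \<oplus>\<^bsub>F\<^esub> c) \<odot>\<^bsub>U\<^esub> u i) S =
        finsum U (\<lambda>i. f i b \<odot>\<^bsub>U\<^esub> u i) S \<oplus>\<^bsub>U\<^esub> finsum U (\<lambda>i. f i c \<odot>\<^bsub>U\<^esub> u i) S"
      using u fc by (simp add: U.M.finsum_addf U.act_closed Pi_def)
  next
    fix a b assume "a \<in> carrier A" "b \<in> carrier F"
    moreover from this have "finsum U (\<lambda>i. f i (a \<odot>\<^bsub>F\<^esub> b) \<odot>\<^bsub>U\<^esub> u i) S =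
        finsum U (\<lambda>i. a \<odot>\<^bsub>U\<^esub> (f i b \<odot>\<^bsub>U\<^esub> u i)) S"
      using module_hom_smult[OF f] u fc
      by (intro U.M.finsum_cong') (auto simp: regular_sel U.act_assoc U.act_closed)
    ultimately show "finsum U (\<lambda>i. f i (a \<odot>\<^bsub>F\<^esub> b) \<odot>\<^bsub>U\<^esub> u i) S =
        a \<odot>\<^bsub>U\<^esub> finsum U (\<lambda>i. f i b \<odot>\<^bsub>U\<^esub> u i) S"
      using u fc by (simp add: U.act_finsum_right U.act_closed Pi_def)
  qed (use u fc in \<open>auto intro!: U.M.finsum_closed U.act_closed\<close>)
qed

section \<open>Modules presented by generators with one relation each\<close>

text \<open>
A module with generators \<open>x i\<close> that are fixed by idempotents \<open>s i\<close>, and with the single relation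
\<open>w i \<odot> x i = 0\<close> for each of them, where \<open>w i\<close> leads from the source idempotent \<open>s i\<close> to the target
idempotent \<open>t i\<close>. In other words, \<open>X\<close> is the cokernel of \<open>\<Oplus> A t\<^sub>i \<rightarrow> \<Oplus> A s\<^sub>i\<close>, and \<open>w_cancel\<close> says that this
map is injective, i.e. that it is a projective resolution of \<open>X\<close>. The target idempotents are
orthogonal so that the components \<open>t\<^sub>i M\<close> form a direct sum inside \<open>M\<close>.
\<close>

locale diagonal_presentation =
  field_algebra A + X: left_module A X + M: left_module A M
  for A :: "('k::field, 'a) module" (structure) and X :: "('a, 'x) module"
    and M :: "('a, 'm) module" +
  fixes I :: "'i set" and x :: "'i \<Rightarrow> 'x" and s t w :: "'i \<Rightarrow> 'a"
  assumes finite_I: "finite I"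
    and x_mem: "i \<in> I \<Longrightarrow> x i \<in> carrier X"
    and s_mem: "i \<in> I \<Longrightarrow> s i \<in> carrier A"
    and t_mem: "i \<in> I \<Longrightarrow> t i \<in> carrier A"
    and w_mem: "i \<in> I \<Longrightarrow> w i \<in> carrier A"
    and s_idem: "i \<in> I \<Longrightarrow> s i \<otimes> s i = s i"
    and s_x: "i \<in> I \<Longrightarrow> s i \<odot>\<^bsub>X\<^esub> x i = x i"
    and t_orth: "\<lbrakk>i \<in> I; l \<in> I\<rbrakk> \<Longrightarrow> t i \<otimes> t l = (if i = l then t i else \<zero>)"
    and t_w: "i \<in> I \<Longrightarrow> t i \<otimes> w i = w i"
    and w_s: "i \<in> I \<Longrightarrow> w i \<otimes> s i = w i"
    and generating: "y \<in> carrier X \<Longrightarrow> \<exists>b\<in>I \<rightarrow> carrier A. y = (\<Oplus>\<^bsub>X\<^esub>i\<in>I. b i \<odot>\<^bsub>X\<^esub> x i)"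
    and relations: "b \<in> I \<rightarrow> carrier A \<Longrightarrow> (\<Oplus>\<^bsub>X\<^esub>i\<in>I. b i \<odot>\<^bsub>X\<^esub> x i) = \<zero>\<^bsub>X\<^esub> \<longleftrightarrow>
      (\<forall>i\<in>I. \<exists>c\<in>carrier A. b i \<otimes> s i = c \<otimes> w i)"
    and w_cancel: "\<lbrakk>i \<in> I; c \<in> carrier A; c \<otimes> w i = \<zero>\<rbrakk> \<Longrightarrow> c \<otimes> t i = \<zero>"
begin

lemma w_x: assumes i: "i \<in> I" shows "w i \<odot>\<^bsub>X\<^esub> x i = \<zero>\<^bsub>X\<^esub>"
proof -
  let ?b = "\<lambda>l. if l = i then w i else \<zero>"
  have b: "?b \<in> I \<rightarrow> carrier A" using w_mem i by auto
  have "(\<Oplus>\<^bsub>X\<^esub>l\<in>I. ?b l \<odot>\<^bsub>X\<^esub> x l) = (\<Oplus>\<^bsub>X\<^esub>l\<in>I. if i = l then w i \<odot>\<^bsub>X\<^esub> x i else \<zero>\<^bsub>X\<^esub>)"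
    using i by (intro X.M.finsum_cong') (auto simp: X.act_closed w_mem x_mem X.act_zero_left)
  also have "\<dots> = w i \<odot>\<^bsub>X\<^esub> x i"
    using X.M.add.finprod_singleton[of i I "\<lambda>_. w i \<odot>\<^bsub>X\<^esub> x i"] i finite_I
    by (simp add: X.act_closed w_mem x_mem)
  finally have "w i \<odot>\<^bsub>X\<^esub> x i = (\<Oplus>\<^bsub>X\<^esub>l\<in>I. ?b l \<odot>\<^bsub>X\<^esub> x l)" by simp
  also have "\<dots> = \<zero>\<^bsub>X\<^esub>"
    unfolding relations[OF b] using i
    by (auto simp: w_s w_mem s_mem intro: bexI[of _ \<one>] bexI[of _ \<zero>])
  finally show ?thesis .
qed

text \<open>
\<open>Hom(\<Oplus> A t\<^sub>i, M)\<close>, realised as the sum of the subspaces \<open>t\<^sub>i M\<close> of \<open>M\<close>.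
\<close>

definition target_part :: "'m set" where
  "target_part = {v \<in> carrier M. v = (\<Oplus>\<^bsub>M\<^esub>i\<in>I. t i \<odot>\<^bsub>M\<^esub> v)}"

text \<open>
The image of \<open>Hom(\<Oplus> A s\<^sub>i, M) \<rightarrow> Hom(\<Oplus> A t\<^sub>i, M)\<close>, the map that multiplies the \<open>i\<close>-th component by \<open>w\<^sub>i\<close>.
\<close>

definition relation_image :: "'m set" where
  "relation_image = {\<Oplus>\<^bsub>M\<^esub>i\<in>I. w i \<odot>\<^bsub>M\<^esub> u i | u. u \<in> I \<rightarrow> carrier M}"

lemma t_act_sum:
  assumes z: "\<And>l. l \<in> I \<Longrightarrow> z l \<in> carrier M" "\<And>l. l \<in> I \<Longrightarrow> t l \<odot>\<^bsub>M\<^esub> z l = z l" and i: "i \<in> I"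
  shows "t i \<odot>\<^bsub>M\<^esub> (\<Oplus>\<^bsub>M\<^esub>l\<in>I. z l) = z i"
proof -
  have "t i \<odot>\<^bsub>M\<^esub> z l = (if i = l then z l else \<zero>\<^bsub>M\<^esub>)" if "l \<in> I" for l
  proof -
    have "t i \<odot>\<^bsub>M\<^esub> z l = (t i \<otimes> t l) \<odot>\<^bsub>M\<^esub> z l"
      using z that i by (simp add: M.act_assoc t_mem)
    then show ?thesis
      using z that i by (simp add: t_orth M.act_zero_left)
  qed
  then have "t i \<odot>\<^bsub>M\<^esub> (\<Oplus>\<^bsub>M\<^esub>l\<in>I. z l) = (\<Oplus>\<^bsub>M\<^esub>l\<in>I. if i = l then z l else \<zero>\<^bsub>M\<^esub>)"
    using z i by (subst M.act_finsum_right) (auto simp: t_mem intro!: M.M.finsum_cong')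
  also have "\<dots> = z i"
    using M.M.add.finprod_singleton[of i I z] i finite_I z by simp
  finally show ?thesis .
qed

lemma t_fixed_sum_in_target:
  assumes "\<And>l. l \<in> I \<Longrightarrow> z l \<in> carrier M" "\<And>l. l \<in> I \<Longrightarrow> t l \<odot>\<^bsub>M\<^esub> z l = z l"
  shows "(\<Oplus>\<^bsub>M\<^esub>l\<in>I. z l) \<in> target_part"
proof -
  have "(\<Oplus>\<^bsub>M\<^esub>i\<in>I. t i \<odot>\<^bsub>M\<^esub> (\<Oplus>\<^bsub>M\<^esub>l\<in>I. z l)) = (\<Oplus>\<^bsub>M\<^esub>l\<in>I. z l)"
    using t_act_sum[OF assms] assms(1) by (intro M.M.finsum_cong') auto
  then show ?thesis
    unfolding target_part_def using assms(1) by (auto intro!: M.M.finsum_closed)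
qed

lemma relation_image_subset: "relation_image \<subseteq> target_part"
proof
  fix v assume "v \<in> relation_image"
  then obtain u where u: "u \<in> I \<rightarrow> carrier M" and v: "v = (\<Oplus>\<^bsub>M\<^esub>i\<in>I. w i \<odot>\<^bsub>M\<^esub> u i)"
    unfolding relation_image_def by auto
  show "v \<in> target_part"
    unfolding v using u
    by (intro t_fixed_sum_in_target)
      (auto simp: M.act_closed w_mem t_mem t_w Pi_iff simp flip: M.act_assoc)
qed

lemma target_left_submodule: "left_submodule (class_ring :: 'k ring) target_part (kspace A M)"
proof (rule left_submoduleI)
  show "target_part \<subseteq> carrier (kspace A M)"
    by (auto simp: target_part_def kspace_sel)
  show "\<zero>\<^bsub>kspace A M\<^esub> \<in> target_part"
    by (auto simp: target_part_def kspace_sel M.act_zero_right t_mem cong: M.M.finsum_cong')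
  fix v v' assume "v \<in> target_part" "v' \<in> target_part"
  then have v: "v \<in> carrier M" "v = (\<Oplus>\<^bsub>M\<^esub>i\<in>I. t i \<odot>\<^bsub>M\<^esub> v)"
    and v': "v' \<in> carrier M" "v' = (\<Oplus>\<^bsub>M\<^esub>i\<in>I. t i \<odot>\<^bsub>M\<^esub> v')"
    by (auto simp: target_part_def)
  have "(\<Oplus>\<^bsub>M\<^esub>i\<in>I. t i \<odot>\<^bsub>M\<^esub> (v \<oplus>\<^bsub>M\<^esub> v')) = (\<Oplus>\<^bsub>M\<^esub>i\<in>I. t i \<odot>\<^bsub>M\<^esub> v \<oplus>\<^bsub>M\<^esub> t i \<odot>\<^bsub>M\<^esub> v')"
    using v(1) v'(1) by (intro M.M.finsum_cong') (auto simp: M.act_r_distr M.act_closed t_mem)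
  also have "\<dots> = v \<oplus>\<^bsub>M\<^esub> v'"
    using v v' by (subst M.M.finsum_addf) (auto simp: M.act_closed t_mem)
  finally show "v \<oplus>\<^bsub>kspace A M\<^esub> v' \<in> target_part"
    using v(1) v'(1) by (simp add: kspace_sel target_part_def)
next
  fix c :: 'k and v assume "v \<in> target_part"
  then have v: "v \<in> carrier M" "v = (\<Oplus>\<^bsub>M\<^esub>i\<in>I. t i \<odot>\<^bsub>M\<^esub> v)"
    by (auto simp: target_part_def)
  have "(\<Oplus>\<^bsub>M\<^esub>i\<in>I. t i \<odot>\<^bsub>M\<^esub> ((c \<odot> \<one>) \<odot>\<^bsub>M\<^esub> v)) = (\<Oplus>\<^bsub>M\<^esub>i\<in>I. (c \<odot> \<one>) \<odot>\<^bsub>M\<^esub> (t i \<odot>\<^bsub>M\<^esub> v))"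
    using v(1) by (intro M.M.finsum_cong')
      (auto simp: scalar_act_commute[OF M.left_module_axioms] M.act_closed t_mem smult_closed)
  also have "\<dots> = (c \<odot> \<one>) \<odot>\<^bsub>M\<^esub> v"
    using v by (subst M.act_finsum_right[symmetric]) (auto simp: M.act_closed t_mem smult_closed)
  finally show "c \<odot>\<^bsub>kspace A M\<^esub> v \<in> target_part"
    using v(1) by (simp add: kspace_sel target_part_def M.act_closed smult_closed)
qed

end

text \<open>
From here on \<open>q\<close> is an arbitrary free cover. The quotient of \<open>H\<close> by \<open>N\<close>, i.e. of the homomorphisms on
the kernel by those that extend to \<open>F\<close>, is the candidate for \<open>Ext\<^sup>1\<close>.
\<close>

locale covered_presentation = diagonal_presentation A X M I x s t w
  for A :: "('k::field, 'a) module" (structure) and X :: "('a, 'x) module"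
    and M :: "('a, 'm) module" and I :: "'i set" and x s t w +
  fixes m and q
  assumes cover: "free_cover A X (m, q)"
begin

abbreviation "F \<equiv> free_module A m"

definition K where "K = a_kernel F X q"

abbreviation "H \<equiv> Hom A (F\<lparr>carrier := K\<rparr>) M"

definition N where "N = (\<lambda>f. restrict f K) ` carrier (Hom A F M)"

sublocale F: left_module A F by (rule free_left_module) (rule ring_axioms)

lemma q_hom: "q \<in> module_hom A F X" and q_surj: "q ` carrier F = carrier X"
  using cover by (auto simp: free_cover_def)

lemma K_submodule: "left_submodule A K F"
  unfolding K_def by (rule kernel_left_submodule[OF F.left_module_axioms X.left_module_axioms q_hom])

lemma K_iff: "\<kappa> \<in> K \<longleftrightarrow> \<kappa> \<in> carrier F \<and> q \<kappa> = \<zero>\<^bsub>X\<^esub>"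
  unfolding K_def by (rule a_kernel_iff)

sublocale K: left_module A "F\<lparr>carrier := K\<rparr>"
  by (rule F.submodule_left_module[OF K_submodule])

sublocale H: left_module "class_ring :: 'k ring" H
  by (rule Hom_left_module[OF K.left_module_axioms M.left_module_axioms])

text \<open>
Projectivity of \<open>F\<close>: the cover lifts to \<open>f : F \<rightarrow> \<Oplus> A s\<^sub>i\<close>, since it suffices to express the images of the
basis vectors in the generators. Multiplying the coefficients by \<open>s\<^sub>i\<close> does not change these
expressions and puts \<open>f\<^sub>i\<close> into \<open>A s\<^sub>i\<close>.
\<close>

lemma obtain_lift:
  obtains f where "\<And>i. i \<in> I \<Longrightarrow> f i \<in> module_hom A F (regular_module A)"
    "\<And>i b. i \<in> I \<Longrightarrow> b \<in> carrier F \<Longrightarrow> f i b \<otimes> s i = f i b"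
    "\<And>b. b \<in> carrier F \<Longrightarrow> q b = (\<Oplus>\<^bsub>X\<^esub>i\<in>I. f i b \<odot>\<^bsub>X\<^esub> x i)"
proof -
  let ?u = "free_unit A m"
  have u: "?u l \<in> carrier F" for l by (auto simp: free_unit_def free_sel)
  have "\<exists>y\<in>I \<rightarrow> carrier A. q (?u l) = (\<Oplus>\<^bsub>X\<^esub>i\<in>I. y i \<odot>\<^bsub>X\<^esub> x i)" for l
    using generating[OF module_hom_mem[OF q_hom u]] by blast
  then obtain y where y: "\<And>l. y l \<in> I \<rightarrow> carrier A" "\<And>l. q (?u l) = (\<Oplus>\<^bsub>X\<^esub>i\<in>I. y l i \<odot>\<^bsub>X\<^esub> x i)"
    by metis
  define f where "f i b = (\<Oplus>l\<in>{..<m}. b l \<otimes> (y l i \<otimes> s i))" for i b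
  have yc: "y l i \<in> carrier A" if "i \<in> I" for l i using y(1) that by auto
  have bc: "b l \<in> carrier A" if "b \<in> carrier F" "l < m" for b l
    using that by (auto simp: free_sel)
  have f_hom: "f i \<in> module_hom A F (regular_module A)" if "i \<in> I" for i
  proof -
    have "(\<lambda>b. finsum (regular_module A) (\<lambda>l. b l \<odot>\<^bsub>regular_module A\<^esub> (y l i \<otimes> s i)) {..<m})
        \<in> module_hom A F (regular_module A)"
    proof (rule linear_comb_hom[OF ring_axioms regular_left_module[OF ring_axioms] F.left_module_axioms])
      fix l assume "l \<in> {..<m}"
      then show "(\<lambda>b. b l) \<in> module_hom A F (regular_module A)"
        by (intro module_homI) (auto simp: free_sel regular_sel PiE_iff)
    qed (use that in \<open>auto simp: regular_sel yc s_mem\<close>)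
    then show ?thesis
      by (simp add: f_def[abs_def] finsum_regular regular_sel)
  qed
  moreover have "f i b \<otimes> s i = f i b" if "i \<in> I" "b \<in> carrier F" for i b
  proof -
    have "f i b \<otimes> s i = (\<Oplus>l\<in>{..<m}. b l \<otimes> (y l i \<otimes> s i) \<otimes> s i)"
      unfolding f_def using that by (intro finsum_ldistr) (auto simp: bc yc s_mem)
    also have "\<dots> = f i b"
      unfolding f_def using that by (intro finsum_cong') (auto simp: bc yc s_mem m_assoc s_idem)
    finally show ?thesis .
  qed
  moreover have "q b = (\<Oplus>\<^bsub>X\<^esub>i\<in>I. f i b \<odot>\<^bsub>X\<^esub> x i)" if b: "b \<in> carrier F" for b
  proof -
    have mem: "(\<lambda>l. b l \<odot>\<^bsub>F\<^esub> ?u l) \<in> {..<m} \<rightarrow> carrier F"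
      using u bc[OF b] by (auto intro: F.act_closed)
    have "q b = q (\<Oplus>\<^bsub>F\<^esub>l\<in>{..<m}. b l \<odot>\<^bsub>F\<^esub> ?u l)"
      using free_module_expand[OF ring_axioms b] by simp
    also have "\<dots> = (\<Oplus>\<^bsub>X\<^esub>l\<in>{..<m}. q (b l \<odot>\<^bsub>F\<^esub> ?u l))"
      by (rule module_hom_finsum[OF F.left_module_axioms X.left_module_axioms q_hom mem])
    also have "\<dots> = (\<Oplus>\<^bsub>X\<^esub>l\<in>{..<m}. \<Oplus>\<^bsub>X\<^esub>i\<in>I. (b l \<otimes> (y l i \<otimes> s i)) \<odot>\<^bsub>X\<^esub> x i)"
    proof (intro X.M.finsum_cong')
      fix l assume l: "l \<in> {..<m}"
      have "q (b l \<odot>\<^bsub>F\<^esub> ?u l) = b l \<odot>\<^bsub>X\<^esub> (\<Oplus>\<^bsub>X\<^esub>i\<in>I. y l i \<odot>\<^bsub>X\<^esub> x i)"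
        using module_hom_smult[OF q_hom] bc[OF b] l u y(2) by simp
      also have "\<dots> = (\<Oplus>\<^bsub>X\<^esub>i\<in>I. b l \<odot>\<^bsub>X\<^esub> (y l i \<odot>\<^bsub>X\<^esub> x i))"
        using bc[OF b] l by (intro X.act_finsum_right) (auto simp: yc x_mem X.act_closed)
      also have "\<dots> = (\<Oplus>\<^bsub>X\<^esub>i\<in>I. (b l \<otimes> (y l i \<otimes> s i)) \<odot>\<^bsub>X\<^esub> x i)"
        using bc[OF b] l
        by (intro X.M.finsum_cong') (auto simp: X.act_assoc s_x x_mem yc s_mem X.act_closed)
      finally show "q (b l \<odot>\<^bsub>F\<^esub> ?u l) = (\<Oplus>\<^bsub>X\<^esub>i\<in>I. (b l \<otimes> (y l i \<otimes> s i)) \<odot>\<^bsub>X\<^esub> x i)" .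
    qed (auto simp: bc[OF b] yc s_mem x_mem X.act_closed intro!: X.M.finsum_closed)
    also have "\<dots> = (\<Oplus>\<^bsub>X\<^esub>i\<in>I. \<Oplus>\<^bsub>X\<^esub>l\<in>{..<m}. (b l \<otimes> (y l i \<otimes> s i)) \<odot>\<^bsub>X\<^esub> x i)"
      using bc[OF b] finite_I
      by (intro X.M.add.finprod_finprod_swap) (auto simp: yc s_mem x_mem X.act_closed)
    also have "\<dots> = (\<Oplus>\<^bsub>X\<^esub>i\<in>I. f i b \<odot>\<^bsub>X\<^esub> x i)"
      unfolding f_def using bc[OF b]
      by (intro X.M.finsum_cong' X.act_finsum_left[symmetric])
        (auto simp: yc s_mem x_mem X.act_closed intro!: finsum_closed)
    finally show ?thesis .
  qed
  ultimately show ?thesis using that by blast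
qed

end

section \<open>Ext and Hom out of a presented module\<close>

lemma (in abelian_group) add_minus_cancel:
  assumes "a \<in> carrier G" "b \<in> carrier G" shows "a \<oplus> (b \<ominus> a) = b"
  using assms a_comm[of b "\<ominus> a"] r_neg2[of a b] by (simp add: minus_eq)

lemma (in left_module) finsum_submodule:
  assumes N: "left_submodule R N M" and "f \<in> S \<rightarrow> N"
  shows "finsum (M\<lparr>carrier := N\<rparr>) f S = finsum M f S"
proof -
  have "(\<lambda>x. x) \<in> module_hom R (M\<lparr>carrier := N\<rparr>) M"
    using N by (intro module_homI) (auto simp: left_submodule_def)
  from module_hom_finsum[OF submodule_left_module[OF N] left_module_axioms this, of f S] assms(2)
  show ?thesis by simp
qed

text \<open>
The two maps of Schanuel's lemma: \<open>f\<close> is the lift of the cover to \<open>\<Oplus> A s\<^sub>i\<close>, and the elements \<open>g i\<close>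
determine a lift \<open>\<Oplus> A s\<^sub>i \<rightarrow> F\<close> in the other direction.
\<close>

locale lifted_presentation = covered_presentation A X M I x s t w m q
  for A :: "('k::field, 'a) module" (structure) and X :: "('a, 'x) module"
    and M :: "('a, 'm) module" and I :: "'i set" and x s t w m q +
  fixes f :: "'i \<Rightarrow> (nat \<Rightarrow> 'a) \<Rightarrow> 'a" and g :: "'i \<Rightarrow> nat \<Rightarrow> 'a"
  assumes f_hom: "i \<in> I \<Longrightarrow> f i \<in> module_hom A F (regular_module A)"
    and f_s: "\<lbrakk>i \<in> I; b \<in> carrier F\<rbrakk> \<Longrightarrow> f i b \<otimes> s i = f i b"
    and q_f: "b \<in> carrier F \<Longrightarrow> q b = (\<Oplus>\<^bsub>X\<^esub>i\<in>I. f i b \<odot>\<^bsub>X\<^esub> x i)"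
    and g_mem: "i \<in> I \<Longrightarrow> g i \<in> carrier F"
    and q_g: "i \<in> I \<Longrightarrow> q (g i) = x i"
begin

lemma f_mem: "\<lbrakk>i \<in> I; b \<in> carrier F\<rbrakk> \<Longrightarrow> f i b \<in> carrier A"
  using module_hom_mem[OF f_hom] by (simp add: regular_sel)

lemma f_add: "\<lbrakk>i \<in> I; b \<in> carrier F; b' \<in> carrier F\<rbrakk> \<Longrightarrow> f i (b \<oplus>\<^bsub>F\<^esub> b') = f i b \<oplus> f i b'"
  using module_hom_add[OF f_hom] by (simp add: regular_sel)

lemma f_smult: "\<lbrakk>i \<in> I; a \<in> carrier A; b \<in> carrier F\<rbrakk> \<Longrightarrow> f i (a \<odot>\<^bsub>F\<^esub> b) = a \<otimes> f i b"
  using module_hom_smult[OF f_hom] by (simp add: regular_sel)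

text \<open>
An element of \<open>K\<close> is mapped by \<open>f\<close> to a combination of the relations; these are its coefficients.
They are unique because the relations can be cancelled.
\<close>

definition relation_coeff where
  "relation_coeff i \<kappa> = (THE c. c \<in> carrier A \<and> c \<otimes> t i = c \<and> c \<otimes> w i = f i \<kappa>)"

lemma relation_coeff_unique:
  assumes i: "i \<in> I" and c: "c \<in> carrier A" "c \<otimes> t i = c" and d: "d \<in> carrier A" "d \<otimes> t i = d"
    and eq: "c \<otimes> w i = d \<otimes> w i"
  shows "c = d"
proof -
  have "(c \<ominus> d) \<otimes> w i = \<zero>"
    using i c d eq by (simp add: minus_eq l_distr l_minus w_mem r_neg)
  then have "(c \<ominus> d) \<otimes> t i = \<zero>"
    using w_cancel i c d by simp
  then have "c \<ominus> d = \<zero>"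
    using i c d by (simp add: minus_eq l_distr l_minus t_mem)
  then show ?thesis using c d by simp
qed

lemma relation_coeff_eqI:
  assumes "i \<in> I" "c \<in> carrier A" "c \<otimes> t i = c" "c \<otimes> w i = f i \<kappa>"
  shows "relation_coeff i \<kappa> = c"
  unfolding relation_coeff_def using assms relation_coeff_unique[OF assms(1)] by (intro the_equality) auto

lemma relation_coeff:
  assumes i: "i \<in> I" and \<kappa>: "\<kappa> \<in> K"
  shows relation_coeff_mem: "relation_coeff i \<kappa> \<in> carrier A" and relation_coeff_t: "relation_coeff i \<kappa> \<otimes> t i = relation_coeff i \<kappa>" and relation_coeff_w: "relation_coeff i \<kappa> \<otimes> w i = f i \<kappa>"
proof -
  have \<kappa>F: "\<kappa> \<in> carrier F" and q0: "q \<kappa> = \<zero>\<^bsub>X\<^esub>" using \<kappa> by (auto simp: K_iff)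
  have "\<forall>i\<in>I. \<exists>c\<in>carrier A. f i \<kappa> \<otimes> s i = c \<otimes> w i"
    using relations[of "\<lambda>i. f i \<kappa>"] q_f[OF \<kappa>F] q0 f_mem[OF _ \<kappa>F] by auto
  then obtain c where c: "c \<in> carrier A" "f i \<kappa> = c \<otimes> w i"
    using i f_s[OF i \<kappa>F] by auto
  have tt: "t i \<otimes> t i = t i" using t_orth[of i i] i by simp
  have "c \<otimes> t i \<in> carrier A \<and> (c \<otimes> t i) \<otimes> t i = c \<otimes> t i \<and> (c \<otimes> t i) \<otimes> w i = f i \<kappa>"
    using i c tt by (simp add: t_mem w_mem m_assoc t_w)
  with relation_coeff_eqI[OF i, of "c \<otimes> t i" \<kappa>]
  show "relation_coeff i \<kappa> \<in> carrier A" "relation_coeff i \<kappa> \<otimes> t i = relation_coeff i \<kappa>" "relation_coeff i \<kappa> \<otimes> w i = f i \<kappa>" by auto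
qed

lemma relation_coeff_add:
  assumes "i \<in> I" "\<kappa> \<in> K" "\<kappa>' \<in> K" shows "relation_coeff i (\<kappa> \<oplus>\<^bsub>F\<^esub> \<kappa>') = relation_coeff i \<kappa> \<oplus> relation_coeff i \<kappa>'"
  using assms
  by (intro relation_coeff_eqI) (auto simp: relation_coeff_mem l_distr t_mem w_mem relation_coeff_t relation_coeff_w f_add K_iff)

lemma relation_coeff_smult:
  assumes "i \<in> I" "a \<in> carrier A" "\<kappa> \<in> K" shows "relation_coeff i (a \<odot>\<^bsub>F\<^esub> \<kappa>) = a \<otimes> relation_coeff i \<kappa>"
  using assms
  by (intro relation_coeff_eqI) (auto simp: relation_coeff_mem m_assoc t_mem w_mem relation_coeff_t relation_coeff_w f_smult K_iff)

lemma relation_coeff_hom: "i \<in> I \<Longrightarrow> relation_coeff i \<in> module_hom A (F\<lparr>carrier := K\<rparr>) (regular_module A)"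
  by (rule module_homI) (auto simp: regular_sel relation_coeff_mem relation_coeff_add relation_coeff_smult)

text \<open>
The element of \<open>Hom(K, M)\<close> that corresponds to \<open>v\<close>: it sends the \<open>i\<close>-th relation to the component of \<open>v\<close>
in \<open>t\<^sub>i M\<close>. Here \<open>c v = c t\<^sub>i v\<close> for a coefficient \<open>c\<close> of the \<open>i\<close>-th relation, so no projection is written.
\<close>

definition cocycle where "cocycle v = (\<lambda>\<kappa>\<in>K. \<Oplus>\<^bsub>M\<^esub>i\<in>I. relation_coeff i \<kappa> \<odot>\<^bsub>M\<^esub> v)"

lemma cocycle_mem: assumes "v \<in> carrier M" shows "cocycle v \<in> carrier H"
proof -
  have "(\<lambda>\<kappa>. \<Oplus>\<^bsub>M\<^esub>i\<in>I. relation_coeff i \<kappa> \<odot>\<^bsub>M\<^esub> v) \<in> module_hom A (F\<lparr>carrier := K\<rparr>) M"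
    using assms relation_coeff_hom
    by (intro linear_comb_hom[OF ring_axioms M.left_module_axioms K.left_module_axioms]) auto
  then show ?thesis
    using K.M.a_closed K.act_closed
    by (auto simp: carrier_Hom cocycle_def module_hom_def)
qed

lemma cocycle_hom: "cocycle \<in> module_hom (class_ring :: 'k ring) ((kspace A M)\<lparr>carrier := target_part\<rparr>) H"
proof (rule module_homI)
  fix v assume "v \<in> carrier ((kspace A M)\<lparr>carrier := target_part\<rparr>)"
  then show "cocycle v \<in> carrier H" by (auto simp: target_part_def intro: cocycle_mem)
next
  fix v v' assume "v \<in> carrier ((kspace A M)\<lparr>carrier := target_part\<rparr>)"
    "v' \<in> carrier ((kspace A M)\<lparr>carrier := target_part\<rparr>)"
  then have v: "v \<in> carrier M" "v' \<in> carrier M" by (auto simp: target_part_def)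
  have "(\<Oplus>\<^bsub>M\<^esub>i\<in>I. relation_coeff i \<kappa> \<odot>\<^bsub>M\<^esub> (v \<oplus>\<^bsub>M\<^esub> v')) =
      (\<Oplus>\<^bsub>M\<^esub>i\<in>I. relation_coeff i \<kappa> \<odot>\<^bsub>M\<^esub> v) \<oplus>\<^bsub>M\<^esub> (\<Oplus>\<^bsub>M\<^esub>i\<in>I. relation_coeff i \<kappa> \<odot>\<^bsub>M\<^esub> v')" if "\<kappa> \<in> K" for \<kappa>
  proof -
    have "(\<Oplus>\<^bsub>M\<^esub>i\<in>I. relation_coeff i \<kappa> \<odot>\<^bsub>M\<^esub> (v \<oplus>\<^bsub>M\<^esub> v')) = (\<Oplus>\<^bsub>M\<^esub>i\<in>I. relation_coeff i \<kappa> \<odot>\<^bsub>M\<^esub> v \<oplus>\<^bsub>M\<^esub> relation_coeff i \<kappa> \<odot>\<^bsub>M\<^esub> v')"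
      using v that relation_coeff_mem[of _ \<kappa>] by (intro M.M.finsum_cong') (auto simp: M.act_closed M.act_r_distr)
    then show ?thesis
      using v that relation_coeff_mem[of _ \<kappa>] by (simp add: M.M.finsum_addf M.act_closed Pi_def)
  qed
  then show "cocycle (v \<oplus>\<^bsub>(kspace A M)\<lparr>carrier := target_part\<rparr>\<^esub> v') = cocycle v \<oplus>\<^bsub>H\<^esub> cocycle v'"
    by (auto simp: cocycle_def add_Hom kspace_sel intro!: restrict_ext)
next
  fix c :: 'k and v assume "v \<in> carrier ((kspace A M)\<lparr>carrier := target_part\<rparr>)"
  then have v: "v \<in> carrier M" by (auto simp: target_part_def)
  have "(\<Oplus>\<^bsub>M\<^esub>i\<in>I. relation_coeff i \<kappa> \<odot>\<^bsub>M\<^esub> ((c \<odot> \<one>) \<odot>\<^bsub>M\<^esub> v)) = (c \<odot> \<one>) \<odot>\<^bsub>M\<^esub> (\<Oplus>\<^bsub>M\<^esub>i\<in>I. relation_coeff i \<kappa> \<odot>\<^bsub>M\<^esub> v)"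
    if "\<kappa> \<in> K" for \<kappa>
    using v that relation_coeff_mem[of _ \<kappa>]
    by (subst M.act_finsum_right)
      (auto simp: M.act_closed smult_closed scalar_act_commute[OF M.left_module_axioms]
        intro!: M.M.finsum_cong')
  then show "cocycle (c \<odot>\<^bsub>(kspace A M)\<lparr>carrier := target_part\<rparr>\<^esub> v) = c \<odot>\<^bsub>H\<^esub> cocycle v"
    by (auto simp: cocycle_def smult_Hom kspace_sel intro!: restrict_ext)
qed

lemma restrict_hom:
  "(\<lambda>h. restrict h K) \<in> module_hom (class_ring :: 'k ring) (Hom A F M) H"
proof -
  have sub: "K \<subseteq> carrier F" by (auto simp: K_iff)
  have "restrict h K \<in> module_hom A (F\<lparr>carrier := K\<rparr>) M" if "h \<in> module_hom A F M" for h
    using sub by (intro module_homI)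
      (auto intro: module_hom_mem[OF that] simp: module_hom_add[OF that] module_hom_smult[OF that]
        K.M.a_closed[simplified] K.act_closed[simplified] subsetD)
  then show ?thesis
    using sub by (intro module_homI) (auto simp: Hom_sel restrict_def fun_eq_iff extensional_def)
qed

lemma N_submodule: "left_submodule (class_ring :: 'k ring) N H"
  unfolding N_def
  by (rule image_left_submodule[OF Hom_left_module[OF F.left_module_axioms M.left_module_axioms]
        H.left_module_axioms restrict_hom])

lemma restrict_in_N:
  assumes "\<psi> \<in> module_hom A F M" "\<And>\<kappa>. \<kappa> \<in> K \<Longrightarrow> h \<kappa> = \<psi> \<kappa>"
  shows "restrict h K \<in> N"
proof -
  have "restrict \<psi> (carrier F) \<in> carrier (Hom A F M)"
    using assms(1) F.M.a_closed F.act_closed by (auto simp: carrier_Hom module_hom_def)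
  moreover have "restrict h K = restrict (restrict \<psi> (carrier F)) K"
    using assms(2) by (auto simp: K_iff intro!: restrict_ext)
  ultimately show ?thesis unfolding N_def by blast
qed

text \<open>
The image in \<open>K\<close> of the \<open>i\<close>-th relation under the lift \<open>\<Oplus> A s\<^sub>i \<rightarrow> F\<close>.
\<close>

definition relation_lift where "relation_lift i = w i \<odot>\<^bsub>F\<^esub> g i"

lemma relation_lift_mem: assumes "i \<in> I" shows "relation_lift i \<in> K"
  using assms module_hom_smult[OF q_hom w_mem g_mem, of i i]
  by (simp add: relation_lift_def K_iff F.act_closed w_mem g_mem q_g w_x)

text \<open>
The composite of the two lifts need not be the identity of \<open>\<Oplus> A s\<^sub>i\<close>, but it covers the identity of \<open>X\<close>
and thus differs from it by relations.
\<close>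

lemma f_g_coefficients:
  assumes i: "i \<in> I"
  shows "\<exists>d\<in>I \<rightarrow> carrier A. \<forall>l\<in>I. f l (g i) = (if l = i then s i else \<zero>) \<oplus> d l \<otimes> w l"
proof -
  let ?e = "\<lambda>l. if l = i then s i else \<zero>"
  let ?b = "\<lambda>l. f l (g i) \<ominus> ?e l"
  have fc: "f l (g i) \<in> carrier A" if "l \<in> I" for l using f_mem g_mem i that by simp
  have ec: "?e l \<in> carrier A" if "l \<in> I" for l using s_mem i by simp
  have b: "?b \<in> I \<rightarrow> carrier A" using fc ec by auto
  have "(\<Oplus>\<^bsub>X\<^esub>l\<in>I. ?b l \<odot>\<^bsub>X\<^esub> x l) \<oplus>\<^bsub>X\<^esub> (\<Oplus>\<^bsub>X\<^esub>l\<in>I. ?e l \<odot>\<^bsub>X\<^esub> x l) = (\<Oplus>\<^bsub>X\<^esub>l\<in>I. ?b l \<odot>\<^bsub>X\<^esub> x l \<oplus>\<^bsub>X\<^esub> ?e l \<odot>\<^bsub>X\<^esub> x l)"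
    using b ec by (subst X.M.finsum_addf) (auto simp: X.act_closed x_mem Pi_iff)
  also have "\<dots> = (\<Oplus>\<^bsub>X\<^esub>l\<in>I. f l (g i) \<odot>\<^bsub>X\<^esub> x l)"
    using fc ec
    by (intro X.M.finsum_cong')
      (auto simp: X.act_closed x_mem minus_eq a_assoc l_neg s_mem simp flip: X.act_l_distr)
  also have "\<dots> = x i" using q_f[OF g_mem[OF i]] q_g[OF i] by simp
  also have "(\<Oplus>\<^bsub>X\<^esub>l\<in>I. ?e l \<odot>\<^bsub>X\<^esub> x l) = (\<Oplus>\<^bsub>X\<^esub>l\<in>I. if i = l then x l else \<zero>\<^bsub>X\<^esub>)"
    by (intro X.M.finsum_cong') (auto simp: s_x x_mem X.act_zero_left)
  also have "\<dots> = x i"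
    using X.M.add.finprod_singleton[of i I x] i finite_I by (simp add: x_mem Pi_def)
  finally have "(\<Oplus>\<^bsub>X\<^esub>l\<in>I. ?b l \<odot>\<^bsub>X\<^esub> x l) = \<zero>\<^bsub>X\<^esub>"
    using b i by (simp add: X.M.finsum_closed X.act_closed x_mem Pi_def)
  with relations[OF b] obtain d where d: "\<And>l. l \<in> I \<Longrightarrow> d l \<in> carrier A \<and> ?b l \<otimes> s l = d l \<otimes> w l"
    by metis
  have "f l (g i) = ?e l \<oplus> d l \<otimes> w l" if l: "l \<in> I" for l
  proof -
    have "?b l \<otimes> s l = ?b l"
      using l i fc[OF l] f_s[OF l g_mem[OF i]]
      by (simp add: minus_eq l_distr l_minus s_mem s_idem)
    then have "?b l = d l \<otimes> w l" using d[OF l] by simp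
    then have "?e l \<oplus> d l \<otimes> w l = ?e l \<oplus> ?b l" by simp
    also have "\<dots> = f l (g i)"
      by (rule add_minus_cancel[OF ec[OF l] fc[OF l]])
    finally show ?thesis by simp
  qed
  then show ?thesis using d by (intro bexI[of _ d]) auto
qed

text \<open>
If \<open>v = \<Sum> w\<^sub>i u\<^sub>i\<close>, then \<open>c\<^sub>i(\<kappa>) v = c\<^sub>i(\<kappa>) w\<^sub>i u\<^sub>i = f\<^sub>i(\<kappa>) u\<^sub>i\<close>, and the right-hand side makes sense on all
of \<open>F\<close>. Conversely an extension \<open>\<psi>\<close> is evaluated at \<open>w\<^sub>i g\<^sub>i\<close>: the cocycle has the value \<open>t\<^sub>i v + w\<^sub>i z\<close>
there, with an error term \<open>z\<close> from \<open>f_g_coefficients\<close>, while \<open>\<psi>(w\<^sub>i g\<^sub>i) = w\<^sub>i \<psi>(g\<^sub>i)\<close>. So \<open>t\<^sub>i v\<close> is a multiple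
of \<open>w\<^sub>i\<close> for every \<open>i\<close>.
\<close>

lemma cocycle_in_N_iff:
  assumes v: "v \<in> target_part"
  shows "cocycle v \<in> N \<longleftrightarrow> v \<in> relation_image"
proof
  have vM: "v \<in> carrier M" and v_sum: "v = (\<Oplus>\<^bsub>M\<^esub>i\<in>I. t i \<odot>\<^bsub>M\<^esub> v)"
    using v by (auto simp: target_part_def)
  {
    assume "v \<in> relation_image"
    then obtain u where u: "u \<in> I \<rightarrow> carrier M" and v_eq: "v = (\<Oplus>\<^bsub>M\<^esub>i\<in>I. w i \<odot>\<^bsub>M\<^esub> u i)"
      unfolding relation_image_def by auto
    \<comment> \<open>orthogonality of the target idempotents isolates one summand of \<open>v\<close>\<close>
    have tv: "t i \<odot>\<^bsub>M\<^esub> v = w i \<odot>\<^bsub>M\<^esub> u i" if "i \<in> I" for i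
      unfolding v_eq using u that
      by (intro t_act_sum) (auto simp: M.act_closed w_mem t_mem t_w Pi_iff simp flip: M.act_assoc)
    have Cv: "relation_coeff i \<kappa> \<odot>\<^bsub>M\<^esub> v = f i \<kappa> \<odot>\<^bsub>M\<^esub> u i" if "i \<in> I" "\<kappa> \<in> K" for i \<kappa>
    proof -
      have "relation_coeff i \<kappa> \<odot>\<^bsub>M\<^esub> v = relation_coeff i \<kappa> \<odot>\<^bsub>M\<^esub> (t i \<odot>\<^bsub>M\<^esub> v)"
        using that vM relation_coeff_mem relation_coeff_t by (simp add: t_mem flip: M.act_assoc)
      also have "\<dots> = f i \<kappa> \<odot>\<^bsub>M\<^esub> u i"
        using that u relation_coeff_mem relation_coeff_w by (simp add: tv w_mem Pi_iff flip: M.act_assoc)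
      finally show ?thesis .
    qed
    have "(\<lambda>b. \<Oplus>\<^bsub>M\<^esub>i\<in>I. f i b \<odot>\<^bsub>M\<^esub> u i) \<in> module_hom A F M"
      using u f_hom
      by (intro linear_comb_hom[OF ring_axioms M.left_module_axioms F.left_module_axioms]) auto
    moreover have "(\<Oplus>\<^bsub>M\<^esub>i\<in>I. relation_coeff i \<kappa> \<odot>\<^bsub>M\<^esub> v) = (\<Oplus>\<^bsub>M\<^esub>i\<in>I. f i \<kappa> \<odot>\<^bsub>M\<^esub> u i)" if "\<kappa> \<in> K" for \<kappa>
      using that u Cv by (intro M.M.finsum_cong') (auto simp: f_mem K_iff intro!: M.act_closed)
    ultimately show "cocycle v \<in> N"
      unfolding cocycle_def by (rule restrict_in_N)
  }
  assume "cocycle v \<in> N"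
  then obtain \<psi> where \<psi>: "\<psi> \<in> module_hom A F M" "cocycle v = restrict \<psi> K"
    unfolding N_def by (auto simp: carrier_Hom)
  have "\<exists>u\<in>carrier M. t i \<odot>\<^bsub>M\<^esub> v = w i \<odot>\<^bsub>M\<^esub> u" if i: "i \<in> I" for i
  proof -
    obtain d where d: "d \<in> I \<rightarrow> carrier A"
      and fg: "\<And>l. l \<in> I \<Longrightarrow> f l (g i) = (if l = i then s i else \<zero>) \<oplus> d l \<otimes> w l"
      using f_g_coefficients[OF i] by blast
    have dc: "d l \<in> carrier A" if "l \<in> I" for l using d that by auto
    have Ck: "relation_coeff l (relation_lift i) = (if l = i then t i else \<zero>) \<oplus> w i \<otimes> (d l \<otimes> t l)" if l: "l \<in> I" for l
    proof (rule relation_coeff_eqI[OF l])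
      have "t l \<otimes> t l = t l" using t_orth[OF l l] by simp
      then show "((if l = i then t i else \<zero>) \<oplus> w i \<otimes> (d l \<otimes> t l)) \<otimes> t l =
          (if l = i then t i else \<zero>) \<oplus> w i \<otimes> (d l \<otimes> t l)"
        using l i dc by (auto simp: l_distr t_mem w_mem m_assoc)
      show "((if l = i then t i else \<zero>) \<oplus> w i \<otimes> (d l \<otimes> t l)) \<otimes> w l = f l (relation_lift i)"
        using l i dc
        by (auto simp: relation_lift_def f_smult g_mem w_mem fg l_distr r_distr t_mem s_mem m_assoc t_w w_s)
    qed (use l i dc in \<open>auto simp: t_mem w_mem\<close>)
    define z where "z = (\<Oplus>\<^bsub>M\<^esub>l\<in>I. (d l \<otimes> t l) \<odot>\<^bsub>M\<^esub> v)"
    have zM: "z \<in> carrier M"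
      unfolding z_def using vM dc by (intro M.M.finsum_closed) (auto simp: M.act_closed t_mem)
    have "cocycle v (relation_lift i) = (\<Oplus>\<^bsub>M\<^esub>l\<in>I. relation_coeff l (relation_lift i) \<odot>\<^bsub>M\<^esub> v)"
      using relation_lift_mem[OF i] by (simp add: cocycle_def)
    also have "\<dots> = (\<Oplus>\<^bsub>M\<^esub>l\<in>I. (if i = l then t l \<odot>\<^bsub>M\<^esub> v else \<zero>\<^bsub>M\<^esub>) \<oplus>\<^bsub>M\<^esub> w i \<odot>\<^bsub>M\<^esub> ((d l \<otimes> t l) \<odot>\<^bsub>M\<^esub> v))"
      using i vM dc
      by (intro M.M.finsum_cong')
        (auto simp: Ck M.act_l_distr M.act_closed t_mem w_mem M.act_zero_left M.act_assoc)
    also have "\<dots> = t i \<odot>\<^bsub>M\<^esub> v \<oplus>\<^bsub>M\<^esub> w i \<odot>\<^bsub>M\<^esub> z"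
      unfolding z_def using vM dc i finite_I M.M.add.finprod_singleton[of i I "\<lambda>l. t l \<odot>\<^bsub>M\<^esub> v"]
      by (subst M.M.finsum_addf) (auto simp: M.act_closed t_mem w_mem M.act_finsum_right Pi_def)
    finally have "t i \<odot>\<^bsub>M\<^esub> v \<oplus>\<^bsub>M\<^esub> w i \<odot>\<^bsub>M\<^esub> z = \<psi> (relation_lift i)"
      using \<psi>(2) relation_lift_mem[OF i] by (metis restrict_apply')
    also have "\<dots> = w i \<odot>\<^bsub>M\<^esub> \<psi> (g i)"
      unfolding relation_lift_def using module_hom_smult[OF \<psi>(1)] w_mem g_mem i by simp
    finally have "t i \<odot>\<^bsub>M\<^esub> v \<oplus>\<^bsub>M\<^esub> w i \<odot>\<^bsub>M\<^esub> z = w i \<odot>\<^bsub>M\<^esub> \<psi> (g i)" .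
    moreover have gM: "\<psi> (g i) \<in> carrier M" using module_hom_mem[OF \<psi>(1) g_mem[OF i]] .
    ultimately have "w i \<odot>\<^bsub>M\<^esub> (\<psi> (g i) \<ominus>\<^bsub>M\<^esub> z) = (t i \<odot>\<^bsub>M\<^esub> v \<oplus>\<^bsub>M\<^esub> w i \<odot>\<^bsub>M\<^esub> z) \<ominus>\<^bsub>M\<^esub> w i \<odot>\<^bsub>M\<^esub> z"
      using zM i by (simp add: M.M.minus_eq M.act_r_distr M.act_minus_right w_mem)
    also have "\<dots> = t i \<odot>\<^bsub>M\<^esub> v"
      using zM vM i by (simp add: M.M.minus_eq M.M.a_assoc M.M.r_neg w_mem t_mem M.act_closed)
    finally have "t i \<odot>\<^bsub>M\<^esub> v = w i \<odot>\<^bsub>M\<^esub> (\<psi> (g i) \<ominus>\<^bsub>M\<^esub> z)" by simp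
    then show ?thesis using gM zM by blast
  qed
  then obtain u where u: "\<And>i. i \<in> I \<Longrightarrow> u i \<in> carrier M \<and> t i \<odot>\<^bsub>M\<^esub> v = w i \<odot>\<^bsub>M\<^esub> u i"
    by metis
  have "v = (\<Oplus>\<^bsub>M\<^esub>i\<in>I. w i \<odot>\<^bsub>M\<^esub> u i)"
    by (subst v_sum, intro M.M.finsum_cong') (use u in \<open>auto intro!: M.act_closed w_mem\<close>)
  then show "v \<in> relation_image"
    unfolding relation_image_def using u by blast
qed

text \<open>
With \<open>\<gamma> : F \<rightarrow> F\<close> the composite of the two lifts, \<open>b - \<gamma> b\<close> lies in \<open>K\<close> for every \<open>b\<close>, so
\<open>b \<mapsto> h (b - \<gamma> b)\<close> is defined on all of \<open>F\<close>. What remains of \<open>h\<close> is \<open>h \<circ> \<gamma>\<close>, which is the cocycle of the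
vector \<open>\<Sum> h (w\<^sub>i g\<^sub>i)\<close>.
\<close>

lemma hom_is_cocycle_mod_N:
  assumes h: "h \<in> carrier H"
  shows "\<exists>v\<in>target_part. \<exists>\<nu>\<in>N. h = \<nu> \<oplus>\<^bsub>H\<^esub> cocycle v"
proof -
  have h_hom: "h \<in> module_hom A (F\<lparr>carrier := K\<rparr>) M" and h_ext: "h \<in> extensional K"
    using h by (auto simp: carrier_Hom)
  note h_mem = module_hom_mem[OF h_hom, simplified]
    and h_add = module_hom_add[OF h_hom, simplified]
    and h_smult = module_hom_smult[OF h_hom, simplified]
  define v where "v = (\<Oplus>\<^bsub>M\<^esub>i\<in>I. h (relation_lift i))"
  have hk: "h (relation_lift i) \<in> carrier M" if "i \<in> I" for i using h_mem relation_lift_mem that by blast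
  have thk: "t i \<odot>\<^bsub>M\<^esub> h (relation_lift i) = h (relation_lift i)" if "i \<in> I" for i
    using that by (simp add: h_smult[symmetric] t_mem relation_lift_mem)
      (simp add: relation_lift_def t_w w_mem t_mem g_mem flip: F.act_assoc)
  have tv: "t i \<odot>\<^bsub>M\<^esub> v = h (relation_lift i)" if "i \<in> I" for i
    unfolding v_def using that hk thk by (intro t_act_sum)
  have v: "v \<in> target_part"
    unfolding v_def using hk thk by (rule t_fixed_sum_in_target)
  then have vM: "v \<in> carrier M" by (auto simp: target_part_def)

  define \<gamma> where "\<gamma> b = (\<Oplus>\<^bsub>F\<^esub>i\<in>I. f i b \<odot>\<^bsub>F\<^esub> g i)" for b
  have \<gamma>_hom: "\<gamma> \<in> module_hom A F F"
    unfolding \<gamma>_def[abs_def] using f_hom g_mem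
    by (intro linear_comb_hom[OF ring_axioms F.left_module_axioms F.left_module_axioms])
  note \<gamma>_mem = module_hom_mem[OF \<gamma>_hom]
  have q_\<gamma>: "q (\<gamma> b) = q b" if "b \<in> carrier F" for b
  proof -
    have "q (\<gamma> b) = (\<Oplus>\<^bsub>X\<^esub>i\<in>I. q (f i b \<odot>\<^bsub>F\<^esub> g i))"
      unfolding \<gamma>_def using that
      by (intro module_hom_finsum[OF F.left_module_axioms X.left_module_axioms q_hom])
        (auto simp: f_mem g_mem F.act_closed)
    also have "\<dots> = (\<Oplus>\<^bsub>X\<^esub>i\<in>I. f i b \<odot>\<^bsub>X\<^esub> x i)"
      using that module_hom_smult[OF q_hom] by (intro X.M.finsum_cong')
        (auto simp: f_mem g_mem q_g x_mem intro!: X.act_closed)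
    finally show ?thesis using q_f[OF that] by simp
  qed
  define \<beta> where "\<beta> b = b \<ominus>\<^bsub>F\<^esub> \<gamma> b" for b
  have \<beta>_mem: "\<beta> b \<in> K" if "b \<in> carrier F" for b
    using that \<gamma>_mem[OF that] q_\<gamma>[OF that]
      module_hom_minus[OF F.left_module_axioms X.left_module_axioms q_hom that \<gamma>_mem[OF that]]
    by (simp add: \<beta>_def K_iff module_hom_mem[OF q_hom] X.M.minus_eq X.M.r_neg)
  have \<beta>_add: "\<beta> (b \<oplus>\<^bsub>F\<^esub> c) = \<beta> b \<oplus>\<^bsub>F\<^esub> \<beta> c" if "b \<in> carrier F" "c \<in> carrier F" for b c
    using that \<gamma>_mem module_hom_add[OF \<gamma>_hom]
    by (simp add: \<beta>_def F.M.minus_eq F.M.minus_add F.M.a_ac)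
  have \<beta>_smult: "\<beta> (a \<odot>\<^bsub>F\<^esub> b) = a \<odot>\<^bsub>F\<^esub> \<beta> b" if "a \<in> carrier A" "b \<in> carrier F" for a b
    using that \<gamma>_mem module_hom_smult[OF \<gamma>_hom]
    by (simp add: \<beta>_def F.M.minus_eq F.act_r_distr F.act_minus_right)
  define \<psi> where "\<psi> b = h (\<beta> b)" for b
  have \<psi>_hom: "\<psi> \<in> module_hom A F M"
    by (rule module_homI) (auto simp: \<psi>_def h_mem \<beta>_mem \<beta>_add \<beta>_smult h_add h_smult)
  have h\<kappa>: "h \<kappa> = \<psi> \<kappa> \<oplus>\<^bsub>M\<^esub> cocycle v \<kappa>" if \<kappa>: "\<kappa> \<in> K" for \<kappa>
  proof -
    have \<kappa>F: "\<kappa> \<in> carrier F" using \<kappa> by (simp add: K_iff)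
    have Ck: "f i \<kappa> \<odot>\<^bsub>F\<^esub> g i = relation_coeff i \<kappa> \<odot>\<^bsub>F\<^esub> relation_lift i" if "i \<in> I" for i
      using that \<kappa> by (simp add: relation_lift_def relation_coeff_mem w_mem g_mem relation_coeff_w flip: F.act_assoc)
    have \<gamma>\<kappa>: "\<gamma> \<kappa> \<in> K"
      using q_\<gamma>[OF \<kappa>F] \<gamma>_mem[OF \<kappa>F] \<kappa> by (simp add: K_iff)
    have "\<gamma> \<kappa> = (\<Oplus>\<^bsub>F\<^esub>i\<in>I. relation_coeff i \<kappa> \<odot>\<^bsub>F\<^esub> relation_lift i)"
      unfolding \<gamma>_def using \<kappa> relation_lift_mem by (intro F.M.finsum_cong')
        (auto simp: Ck relation_coeff_mem K_iff intro!: F.act_closed)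
    also have "\<dots> = (\<Oplus>\<^bsub>F\<lparr>carrier := K\<rparr>\<^esub>i\<in>I. relation_coeff i \<kappa> \<odot>\<^bsub>F\<^esub> relation_lift i)"
      using \<kappa> relation_lift_mem by (intro F.finsum_submodule[OF K_submodule, symmetric])
        (auto intro!: K.act_closed[simplified] simp: relation_coeff_mem)
    finally have "h (\<gamma> \<kappa>) = h (\<Oplus>\<^bsub>F\<lparr>carrier := K\<rparr>\<^esub>i\<in>I. relation_coeff i \<kappa> \<odot>\<^bsub>F\<^esub> relation_lift i)" by simp
    also have "\<dots> = (\<Oplus>\<^bsub>M\<^esub>i\<in>I. h (relation_coeff i \<kappa> \<odot>\<^bsub>F\<^esub> relation_lift i))"
      using \<kappa> relation_lift_mem relation_coeff_mem K.act_closed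
      by (intro module_hom_finsum[OF K.left_module_axioms M.left_module_axioms h_hom]) auto
    also have "\<dots> = (\<Oplus>\<^bsub>M\<^esub>i\<in>I. relation_coeff i \<kappa> \<odot>\<^bsub>M\<^esub> v)"
    proof (intro M.M.finsum_cong')
      fix i assume i: "i \<in> I"
      have "h (relation_coeff i \<kappa> \<odot>\<^bsub>F\<^esub> relation_lift i) = relation_coeff i \<kappa> \<odot>\<^bsub>M\<^esub> (t i \<odot>\<^bsub>M\<^esub> v)"
        using i \<kappa> by (simp add: h_smult relation_coeff_mem relation_lift_mem tv)
      also have "\<dots> = relation_coeff i \<kappa> \<odot>\<^bsub>M\<^esub> v"
        using i \<kappa> vM by (simp add: relation_coeff_mem relation_coeff_t t_mem flip: M.act_assoc)
      finally show "h (relation_coeff i \<kappa> \<odot>\<^bsub>F\<^esub> relation_lift i) = relation_coeff i \<kappa> \<odot>\<^bsub>M\<^esub> v" .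
    qed (use \<kappa> vM relation_coeff_mem in \<open>auto intro!: M.act_closed\<close>)
    also have "\<dots> = cocycle v \<kappa>" using \<kappa> by (simp add: cocycle_def)
    finally have h\<gamma>: "h (\<gamma> \<kappa>) = cocycle v \<kappa>" .
    have "\<kappa> = \<beta> \<kappa> \<oplus>\<^bsub>F\<^esub> \<gamma> \<kappa>"
      using \<kappa>F \<gamma>_mem[OF \<kappa>F] by (simp add: \<beta>_def F.M.minus_eq F.M.a_assoc F.M.l_neg)
    then have "h \<kappa> = h (\<beta> \<kappa>) \<oplus>\<^bsub>M\<^esub> h (\<gamma> \<kappa>)"
      using h_add[OF \<beta>_mem[OF \<kappa>F] \<gamma>\<kappa>] by simp
    then show ?thesis by (simp add: \<psi>_def h\<gamma>)
  qed
  have "restrict \<psi> K \<in> N" by (rule restrict_in_N[OF \<psi>_hom]) simp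
  moreover have "h = restrict \<psi> K \<oplus>\<^bsub>H\<^esub> cocycle v"
    by (rule extensionalityI[OF h_ext]) (auto simp: add_Hom h\<kappa>)
  ultimately show ?thesis using v by blast
qed

text \<open>
The connecting homomorphism \<open>Hom(\<Oplus> A t\<^sub>i, M) \<rightarrow> Ext\<^sup>1(X, M)\<close> of the long exact sequence.
\<close>

definition connecting_map where "connecting_map v = N +>\<^bsub>H\<^esub> cocycle v"

lemma kspace_target_left_module:
  "left_module (class_ring :: 'k ring) ((kspace A M)\<lparr>carrier := target_part\<rparr>)"
  by (rule left_module.submodule_left_module[OF kspace_left_module[OF M.left_module_axioms]
        target_left_submodule])

lemma connecting_map_linear:
  "linear_map (class_ring :: 'k ring) ((kspace A M)\<lparr>carrier := target_part\<rparr>) (quot_module H N) connecting_map"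
proof -
  have quot: "left_module (class_ring :: 'k ring) (quot_module H N)"
    by (rule quot_left_module[OF H.left_module_axioms N_submodule])
  have "connecting_map \<in> module_hom (class_ring :: 'k ring) ((kspace A M)\<lparr>carrier := target_part\<rparr>) (quot_module H N)"
    using module_hom_mem[OF cocycle_hom] module_hom_add[OF cocycle_hom] module_hom_smult[OF cocycle_hom]
    by (intro module_homI) (auto simp: connecting_map_def carrier_quot_module_image
        coset_add[OF H.left_module_axioms N_submodule] coset_act[OF H.left_module_axioms N_submodule])
  then show ?thesis
    using class_ring_vectorspace[OF quot] class_ring_vectorspace[OF kspace_target_left_module]
    by (intro linear_map.intro mod_hom.intro mod_hom_axioms.intro) (auto simp: vectorspace_def)
qed

lemma connecting_map_surj: "connecting_map ` target_part = carrier (quot_module H N)"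
proof -
  have "connecting_map v \<in> carrier (quot_module H N)" if "v \<in> target_part" for v
    using module_hom_mem[OF cocycle_hom] that by (auto simp: connecting_map_def carrier_quot_module_image)
  moreover have "\<exists>v\<in>target_part. N +>\<^bsub>H\<^esub> h = connecting_map v" if h: "h \<in> carrier H" for h
  proof -
    obtain v \<nu> where v: "v \<in> target_part" "\<nu> \<in> N" "h = \<nu> \<oplus>\<^bsub>H\<^esub> cocycle v"
      using hom_is_cocycle_mod_N[OF h] by blast
    have cocyclev: "cocycle v \<in> carrier H" using module_hom_mem[OF cocycle_hom] v by auto
    have \<nu>: "\<nu> \<in> carrier H" using v(2) N_submodule by (auto simp: left_submodule_def)
    have "h \<ominus>\<^bsub>H\<^esub> cocycle v = \<nu>"
      using cocyclev \<nu> by (simp add: v(3) H.M.minus_eq H.M.a_assoc H.M.r_neg)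
    then show ?thesis
      using v h cocyclev coset_eq_iff[OF H.left_module_axioms N_submodule h cocyclev]
      by (auto simp: connecting_map_def)
  qed
  ultimately show ?thesis by (fastforce simp: carrier_quot_module_image)
qed

lemma connecting_map_eq_zero_iff:
  assumes "v \<in> target_part"
  shows "connecting_map v = \<zero>\<^bsub>quot_module H N\<^esub> \<longleftrightarrow> v \<in> relation_image"
  using coset_eq_zero_iff[OF H.left_module_axioms N_submodule] module_hom_mem[OF cocycle_hom] cocycle_in_N_iff assms
  by (auto simp: connecting_map_def zero_quot_module)

lemma quotient_trivial_iff:
  "carrier (quot_module H N) = {\<zero>\<^bsub>quot_module H N\<^esub>} \<longleftrightarrow> relation_image = target_part"
proof
  assume "carrier (quot_module H N) = {\<zero>\<^bsub>quot_module H N\<^esub>}"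
  then have "connecting_map v = \<zero>\<^bsub>quot_module H N\<^esub>" if "v \<in> target_part" for v
    using connecting_map_surj that by blast
  then show "relation_image = target_part"
    using connecting_map_eq_zero_iff relation_image_subset by blast
next
  assume "relation_image = target_part"
  then have "connecting_map v = \<zero>\<^bsub>quot_module H N\<^esub>" if "v \<in> target_part" for v
    using connecting_map_eq_zero_iff that by simp
  moreover have "\<zero>\<^bsub>kspace A M\<^esub> \<in> target_part"
    using target_left_submodule by (auto simp: left_submodule_def)
  ultimately show "carrier (quot_module H N) = {\<zero>\<^bsub>quot_module H N\<^esub>}"
    unfolding connecting_map_surj[symmetric] by force
qed

lemma quotient_dim:
  assumes fd: "vectorspace.fin_dim (class_ring :: 'k ring) ((kspace A M)\<lparr>carrier := target_part\<rparr>)"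
  shows "vectorspace.dim (class_ring :: 'k ring) ((kspace A M)\<lparr>carrier := target_part\<rparr>) =
    vectorspace.dim (class_ring :: 'k ring) (quot_module H N) +
    vectorspace.dim (class_ring :: 'k ring) ((kspace A M)\<lparr>carrier := relation_image\<rparr>)"
proof -
  interpret connecting_map: linear_map "class_ring :: 'k ring" "(kspace A M)\<lparr>carrier := target_part\<rparr>"
    "quot_module H N" connecting_map by (rule connecting_map_linear)
  have im: "connecting_map.imT = carrier (quot_module H N)"
    using connecting_map_surj by (simp add: connecting_map.im_def)
  have ker: "connecting_map.kerT = relation_image"
    using connecting_map_eq_zero_iff relation_image_subset by (auto simp: connecting_map.ker_def)
  show ?thesis
    using connecting_map.rank_nullity[OF fd] unfolding im ker by simp
qed

end

context diagonal_presentation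
begin

text \<open>
The generators provide one cover, so the cover chosen in the definition of \<open>Ext\<^sup>1\<close> exists. Free modules
are indexed by initial segments of the natural numbers, hence the enumeration of \<open>I\<close>.
\<close>

lemma free_cover_exists: "\<exists>mq. free_cover A X mq"
proof -
  obtain h where h: "bij_betw h I {..<card I}"
    using finite_I ex_bij_betw_finite_nat atLeast0LessThan by metis
  define q where "q b = (\<Oplus>\<^bsub>X\<^esub>i\<in>I. b (h i) \<odot>\<^bsub>X\<^esub> x i)" for b :: "nat \<Rightarrow> 'a"
  let ?F = "free_module A (card I)"
  have hi: "h i < card I" if "i \<in> I" for i using h that by (auto simp: bij_betw_def)
  have q: "q \<in> module_hom A ?F X"
    unfolding q_def[abs_def]
  proof (rule linear_comb_hom[OF ring_axioms X.left_module_axioms free_left_module[OF ring_axioms]])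
    fix i assume "i \<in> I"
    then show "(\<lambda>b. b (h i)) \<in> module_hom A ?F (regular_module A)"
      using hi by (intro module_homI) (auto simp: free_sel regular_sel PiE_iff)
  qed (rule x_mem)
  moreover have "y \<in> q ` carrier ?F" if y: "y \<in> carrier X" for y
  proof -
    obtain b where b: "b \<in> I \<rightarrow> carrier A" "y = (\<Oplus>\<^bsub>X\<^esub>i\<in>I. b i \<odot>\<^bsub>X\<^esub> x i)"
      using generating[OF y] by blast
    define b' where "b' = (\<lambda>l\<in>{..<card I}. b (inv_into I h l))"
    have "b' \<in> carrier ?F"
      using b(1) h unfolding b'_def by (auto simp: free_sel bij_betw_def intro!: inv_into_into)
    moreover have "b' (h i) = b i" if "i \<in> I" for i
      using hi[OF that] h that unfolding b'_def by (auto simp: bij_betw_def)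
    then have "q b' = y"
      unfolding q_def b(2) using b(1) by (intro X.M.finsum_cong') (auto intro!: X.act_closed x_mem)
    ultimately show ?thesis by auto
  qed
  ultimately have "free_cover A X (card I, q)"
    using module_hom_mem[OF q] by (auto simp: free_cover_def)
  then show ?thesis by blast
qed

lemma Ext1_as_lifted_presentation:
  "\<exists>m q f g. lifted_presentation A X M I x s t w m q f g \<and>
     Ext1 A X M = quot_module (Hom A ((free_module A m)\<lparr>carrier := covered_presentation.K A X m q\<rparr>) M)
        (covered_presentation.N A X M m q)"
proof -
  obtain m q where mq: "(SOME mq. free_cover A X mq) = (m, q)" by force
  have cover: "free_cover A X (m, q)"
    using someI_ex[OF free_cover_exists] mq by simp
  interpret covered_presentation A X M I x s t w m q
    by unfold_locales (rule cover)
  obtain f where f: "\<And>i. i \<in> I \<Longrightarrow> f i \<in> module_hom A F (regular_module A)"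
    "\<And>i b. i \<in> I \<Longrightarrow> b \<in> carrier F \<Longrightarrow> f i b \<otimes> s i = f i b"
    "\<And>b. b \<in> carrier F \<Longrightarrow> q b = (\<Oplus>\<^bsub>X\<^esub>i\<in>I. f i b \<odot>\<^bsub>X\<^esub> x i)"
    by (rule obtain_lift) blast
  have "\<exists>g. g \<in> carrier F \<and> q g = x i" if "i \<in> I" for i
    using q_surj x_mem[OF that] by (metis imageE)
  then obtain g where g: "\<And>i. i \<in> I \<Longrightarrow> g i \<in> carrier F \<and> q (g i) = x i"
    by metis
  have "lifted_presentation A X M I x s t w m q f g"
    by unfold_locales (fact f, fact f, fact f, use g in blast, use g in blast)
  moreover have "Ext1 A X M = quot_module (Hom A (F\<lparr>carrier := K\<rparr>) M) N"
    unfolding Ext1_def mq Let_def N_def K_def by simp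
  ultimately show ?thesis by blast
qed

theorem Ext1_trivial_iff:
  "carrier (Ext1 A X M) = {\<zero>\<^bsub>Ext1 A X M\<^esub>} \<longleftrightarrow> relation_image = target_part"
  using Ext1_as_lifted_presentation lifted_presentation.quotient_trivial_iff by metis

theorem Ext1_dim:
  assumes "vectorspace.fin_dim (class_ring :: 'k ring) ((kspace A M)\<lparr>carrier := target_part\<rparr>)"
  shows "vectorspace.dim (class_ring :: 'k ring) ((kspace A M)\<lparr>carrier := target_part\<rparr>) =
    vectorspace.dim (class_ring :: 'k ring) (Ext1 A X M) +
    vectorspace.dim (class_ring :: 'k ring) ((kspace A M)\<lparr>carrier := relation_image\<rparr>)"
  using Ext1_as_lifted_presentation lifted_presentation.quotient_dim[OF _ assms] by metis

text \<open>
A homomorphism is determined by the images \<open>u\<^sub>i\<close> of the generators, which satisfy \<open>s\<^sub>i u\<^sub>i = u\<^sub>i\<close> and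
\<open>w\<^sub>i u\<^sub>i = 0\<close>. Conversely, one such vector \<open>u\<close> at index \<open>i\<close> gives a homomorphism \<open>\<Sum> b\<^sub>l x\<^sub>l \<mapsto> b\<^sub>i u\<close>; it is
well defined because of \<open>relations\<close>.
\<close>

theorem Hom_trivial_iff:
  "carrier (Hom A X M) = {\<zero>\<^bsub>Hom A X M\<^esub>} \<longleftrightarrow>
    (\<forall>i\<in>I. \<forall>u\<in>carrier M. s i \<odot>\<^bsub>M\<^esub> u = u \<longrightarrow> w i \<odot>\<^bsub>M\<^esub> u = \<zero>\<^bsub>M\<^esub> \<longrightarrow> u = \<zero>\<^bsub>M\<^esub>)"
proof (intro iffI ballI impI)
  fix i u assume triv: "carrier (Hom A X M) = {\<zero>\<^bsub>Hom A X M\<^esub>}"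
    and i: "i \<in> I" and u: "u \<in> carrier M" "s i \<odot>\<^bsub>M\<^esub> u = u" "w i \<odot>\<^bsub>M\<^esub> u = \<zero>\<^bsub>M\<^esub>"
  \<comment> \<open>the value does not depend on the coefficients that represent an element\<close>
  have well: "b i \<odot>\<^bsub>M\<^esub> u = b' i \<odot>\<^bsub>M\<^esub> u"
    if b: "b \<in> I \<rightarrow> carrier A" "b' \<in> I \<rightarrow> carrier A"
      and eq: "(\<Oplus>\<^bsub>X\<^esub>l\<in>I. b l \<odot>\<^bsub>X\<^esub> x l) = (\<Oplus>\<^bsub>X\<^esub>l\<in>I. b' l \<odot>\<^bsub>X\<^esub> x l)" for b b'
  proof -
    have bc: "b l \<in> carrier A" "b' l \<in> carrier A" if "l \<in> I" for l using b that by auto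
    have "(\<Oplus>\<^bsub>X\<^esub>l\<in>I. (b l \<ominus> b' l) \<odot>\<^bsub>X\<^esub> x l) \<oplus>\<^bsub>X\<^esub> (\<Oplus>\<^bsub>X\<^esub>l\<in>I. b' l \<odot>\<^bsub>X\<^esub> x l)
        = (\<Oplus>\<^bsub>X\<^esub>l\<in>I. (b l \<ominus> b' l) \<odot>\<^bsub>X\<^esub> x l \<oplus>\<^bsub>X\<^esub> b' l \<odot>\<^bsub>X\<^esub> x l)"
      using bc by (subst X.M.finsum_addf) (auto simp: X.act_closed x_mem)
    also have "\<dots> = (\<Oplus>\<^bsub>X\<^esub>l\<in>I. b l \<odot>\<^bsub>X\<^esub> x l)"
      using bc by (intro X.M.finsum_cong')
        (auto simp: X.act_closed x_mem minus_eq a_assoc l_neg simp flip: X.act_l_distr)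
    finally have "(\<Oplus>\<^bsub>X\<^esub>l\<in>I. (b l \<ominus> b' l) \<odot>\<^bsub>X\<^esub> x l) = \<zero>\<^bsub>X\<^esub>"
      using eq bc by (simp add: X.M.finsum_closed X.act_closed x_mem Pi_def)
    then obtain c where c: "c \<in> carrier A" "(b i \<ominus> b' i) \<otimes> s i = c \<otimes> w i"
      using relations[of "\<lambda>l. b l \<ominus> b' l"] bc i by auto
    have "(b i \<ominus> b' i) \<odot>\<^bsub>M\<^esub> u = ((b i \<ominus> b' i) \<otimes> s i) \<odot>\<^bsub>M\<^esub> u"
      using bc i u by (simp add: M.act_assoc s_mem)
    also have "\<dots> = \<zero>\<^bsub>M\<^esub>"
      using c i u by (simp add: M.act_assoc w_mem M.act_zero_right)
    finally have "(b i \<ominus> b' i) \<odot>\<^bsub>M\<^esub> u \<oplus>\<^bsub>M\<^esub> b' i \<odot>\<^bsub>M\<^esub> u = b' i \<odot>\<^bsub>M\<^esub> u"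
      using bc i u by (simp add: M.act_closed)
    then show ?thesis
      using bc i u by (simp add: minus_eq a_assoc l_neg flip: M.act_l_distr)
  qed
  obtain co where co: "\<And>y. y \<in> carrier X \<Longrightarrow> co y \<in> I \<rightarrow> carrier A \<and> y = (\<Oplus>\<^bsub>X\<^esub>l\<in>I. co y l \<odot>\<^bsub>X\<^esub> x l)"
    using generating by metis
  have co_mem: "co y l \<in> carrier A" if "y \<in> carrier X" "l \<in> I" for y l
    using co[OF that(1)] that(2) by auto
  have co_eqI: "co y i \<odot>\<^bsub>M\<^esub> u = b i \<odot>\<^bsub>M\<^esub> u"
    if "y \<in> carrier X" "b \<in> I \<rightarrow> carrier A" "y = (\<Oplus>\<^bsub>X\<^esub>l\<in>I. b l \<odot>\<^bsub>X\<^esub> x l)" for y b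
    using well[of "co y" b] co[OF that(1)] that by metis
  define h where "h = (\<lambda>y\<in>carrier X. co y i \<odot>\<^bsub>M\<^esub> u)"
  have "h \<in> module_hom A X M"
  proof (rule module_homI)
    fix y y' assume y: "y \<in> carrier X" "y' \<in> carrier X"
    have "y \<oplus>\<^bsub>X\<^esub> y' = (\<Oplus>\<^bsub>X\<^esub>l\<in>I. co y l \<odot>\<^bsub>X\<^esub> x l) \<oplus>\<^bsub>X\<^esub> (\<Oplus>\<^bsub>X\<^esub>l\<in>I. co y' l \<odot>\<^bsub>X\<^esub> x l)"
      using co y by simp
    also have "\<dots> = (\<Oplus>\<^bsub>X\<^esub>l\<in>I. co y l \<odot>\<^bsub>X\<^esub> x l \<oplus>\<^bsub>X\<^esub> co y' l \<odot>\<^bsub>X\<^esub> x l)"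
      using co_mem y by (subst X.M.finsum_addf) (auto simp: X.act_closed x_mem)
    also have "\<dots> = (\<Oplus>\<^bsub>X\<^esub>l\<in>I. (co y l \<oplus> co y' l) \<odot>\<^bsub>X\<^esub> x l)"
      using co_mem y by (intro X.M.finsum_cong') (auto simp: X.act_closed x_mem X.act_l_distr)
    finally have eq: "y \<oplus>\<^bsub>X\<^esub> y' = (\<Oplus>\<^bsub>X\<^esub>l\<in>I. (co y l \<oplus> co y' l) \<odot>\<^bsub>X\<^esub> x l)" .
    have "co (y \<oplus>\<^bsub>X\<^esub> y') i \<odot>\<^bsub>M\<^esub> u = (co y i \<oplus> co y' i) \<odot>\<^bsub>M\<^esub> u"
      using co_mem y by (intro co_eqI[OF _ _ eq]) auto
    then show "h (y \<oplus>\<^bsub>X\<^esub> y') = h y \<oplus>\<^bsub>M\<^esub> h y'"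
      using co_mem y u i by (simp add: h_def M.act_l_distr)
  next
    fix a y assume a: "a \<in> carrier A" and y: "y \<in> carrier X"
    have "a \<odot>\<^bsub>X\<^esub> y = a \<odot>\<^bsub>X\<^esub> (\<Oplus>\<^bsub>X\<^esub>l\<in>I. co y l \<odot>\<^bsub>X\<^esub> x l)"
      using co y by simp
    also have "\<dots> = (\<Oplus>\<^bsub>X\<^esub>l\<in>I. a \<odot>\<^bsub>X\<^esub> (co y l \<odot>\<^bsub>X\<^esub> x l))"
      using co_mem a y by (intro X.act_finsum_right) (auto simp: X.act_closed x_mem)
    also have "\<dots> = (\<Oplus>\<^bsub>X\<^esub>l\<in>I. (a \<otimes> co y l) \<odot>\<^bsub>X\<^esub> x l)"
      using co_mem a y by (intro X.M.finsum_cong') (auto simp: X.act_closed x_mem X.act_assoc)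
    finally have eq: "a \<odot>\<^bsub>X\<^esub> y = (\<Oplus>\<^bsub>X\<^esub>l\<in>I. (a \<otimes> co y l) \<odot>\<^bsub>X\<^esub> x l)" .
    have "co (a \<odot>\<^bsub>X\<^esub> y) i \<odot>\<^bsub>M\<^esub> u = (a \<otimes> co y i) \<odot>\<^bsub>M\<^esub> u"
      using co_mem a y by (intro co_eqI[OF _ _ eq]) (auto simp: X.act_closed)
    then show "h (a \<odot>\<^bsub>X\<^esub> y) = a \<odot>\<^bsub>M\<^esub> h y"
      using co_mem a y u i by (simp add: h_def M.act_assoc X.act_closed)
  qed (use co_mem u i in \<open>auto simp: h_def M.act_closed\<close>)
  then have "h \<in> carrier (Hom A X M)" by (auto simp: carrier_Hom h_def)
  then have "h (x i) = \<zero>\<^bsub>M\<^esub>" using triv x_mem[OF i] by (simp add: zero_Hom)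
  moreover have "h (x i) = u"
  proof -
    let ?b = "\<lambda>l. if l = i then s i else \<zero>"
    have "x i = (\<Oplus>\<^bsub>X\<^esub>l\<in>I. ?b l \<odot>\<^bsub>X\<^esub> x l)"
    proof -
      have "(\<Oplus>\<^bsub>X\<^esub>l\<in>I. ?b l \<odot>\<^bsub>X\<^esub> x l) = (\<Oplus>\<^bsub>X\<^esub>l\<in>I. if i = l then x l else \<zero>\<^bsub>X\<^esub>)"
        by (intro X.M.finsum_cong') (auto simp: s_x x_mem X.act_zero_left)
      also have "\<dots> = x i"
        using X.M.add.finprod_singleton[of i I x] i finite_I by (simp add: x_mem Pi_def)
      finally show ?thesis by simp
    qed
    from co_eqI[OF _ _ this] have "co (x i) i \<odot>\<^bsub>M\<^esub> u = ?b i \<odot>\<^bsub>M\<^esub> u"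
      using i s_mem x_mem by auto
    then show ?thesis using x_mem[OF i] u by (simp add: h_def)
  qed
  ultimately show "u = \<zero>\<^bsub>M\<^esub>" by simp
next
  assume triv: "\<forall>i\<in>I. \<forall>u\<in>carrier M. s i \<odot>\<^bsub>M\<^esub> u = u \<longrightarrow> w i \<odot>\<^bsub>M\<^esub> u = \<zero>\<^bsub>M\<^esub> \<longrightarrow> u = \<zero>\<^bsub>M\<^esub>"
  {
    fix h assume h: "h \<in> carrier (Hom A X M)"
    then have hom: "h \<in> module_hom A X M" and ext: "h \<in> extensional (carrier X)"
      by (auto simp: carrier_Hom)
    have hx: "h (x i) = \<zero>\<^bsub>M\<^esub>" if i: "i \<in> I" for i
    proof -
      have "s i \<odot>\<^bsub>M\<^esub> h (x i) = h (x i)"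
        using module_hom_smult[OF hom s_mem x_mem, of i i] i by (simp add: s_x)
      moreover have "w i \<odot>\<^bsub>M\<^esub> h (x i) = \<zero>\<^bsub>M\<^esub>"
        using module_hom_smult[OF hom w_mem x_mem, of i i] i
          module_hom_zero[OF X.left_module_axioms M.left_module_axioms hom] by (simp add: w_x)
      ultimately show ?thesis
        using triv i module_hom_mem[OF hom x_mem[OF i]] by blast
    qed
    have "h y = \<zero>\<^bsub>M\<^esub>" if y: "y \<in> carrier X" for y
    proof -
      obtain b where b: "b \<in> I \<rightarrow> carrier A" "y = (\<Oplus>\<^bsub>X\<^esub>i\<in>I. b i \<odot>\<^bsub>X\<^esub> x i)"
        using generating[OF y] by blast
      have "h y = (\<Oplus>\<^bsub>M\<^esub>i\<in>I. h (b i \<odot>\<^bsub>X\<^esub> x i))"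
        unfolding b(2) using b(1)
        by (intro module_hom_finsum[OF X.left_module_axioms M.left_module_axioms hom])
          (auto intro!: X.act_closed x_mem)
      also have "\<dots> = (\<Oplus>\<^bsub>M\<^esub>i\<in>I. \<zero>\<^bsub>M\<^esub>)"
      proof (intro M.M.finsum_cong')
        fix i assume i: "i \<in> I"
        then show "h (b i \<odot>\<^bsub>X\<^esub> x i) = \<zero>\<^bsub>M\<^esub>"
          using module_hom_smult[OF hom _ x_mem[OF i], of "b i"] b(1) hx[OF i]
          by (auto simp: M.act_zero_right Pi_iff)
      qed auto
      finally show ?thesis by simp
    qed
    then have "h = \<zero>\<^bsub>Hom A X M\<^esub>"
      using ext by (intro extensionalityI[OF ext]) (auto simp: zero_Hom)
  }
  moreover have "\<zero>\<^bsub>Hom A X M\<^esub> \<in> carrier (Hom A X M)"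
    using left_module.axioms(2)[OF Hom_left_module[OF X.left_module_axioms M.left_module_axioms]]
    by (simp add: abelian_group.axioms(1) abelian_monoid.zero_closed)
  ultimately show "carrier (Hom A X M) = {\<zero>\<^bsub>Hom A X M\<^esub>}" by blast
qed

end

section \<open>Path algebras\<close>

lemma lookup_scale: "Poly_Mapping.lookup (Poly_Mapping.map ((*) c) f) x = c * (Poly_Mapping.lookup f x :: 'k::semiring_0)"
  by (simp add: Poly_Mapping.map.rep_eq when_def)

lemma poly_mapping_sum_singles:
  "f = (\<Sum>x\<in>Poly_Mapping.keys f. Poly_Mapping.single x (Poly_Mapping.lookup f x))"
  by (rule poly_mapping_eqI) (simp add: lookup_sum lookup_single when_def in_keys_iff)

text \<open>
Identities for path algebras are multilinear. This induction reduces them to single paths.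
\<close>

lemma poly_mapping_induct_on [consumes 1, case_names zero single add]:
  fixes P :: "('a \<Rightarrow>\<^sub>0 'b::comm_monoid_add) \<Rightarrow> bool"
  assumes f: "Poly_Mapping.keys f \<subseteq> S" and zero: "P 0" and single: "\<And>x c. x \<in> S \<Longrightarrow> P (Poly_Mapping.single x c)"
    and add: "\<And>f g. P f \<Longrightarrow> P g \<Longrightarrow> P (f + g)"
  shows "P f"
proof -
  have "P (\<Sum>x\<in>X. Poly_Mapping.single x (c x))" if "finite X" "X \<subseteq> S" for X and c :: "'a \<Rightarrow> 'b"
    using that by (induct X) (auto intro: zero single add)
  from this[of "Poly_Mapping.keys f" "Poly_Mapping.lookup f"] f show ?thesis
    using poly_mapping_sum_singles[of f] by simp
qed

lemmas poly_mapping_induct = poly_mapping_induct_on[of _ UNIV, simplified, case_names zero single add]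

context
  fixes G :: "('v, 'e) pre_digraph"
begin

lemma path_mult_add_left: "path_mult G (f + f') g = path_mult G f g + path_mult G f' g"
proof -
  let ?F = "\<lambda>(v, q) c. \<Sum>(u, p)\<in>Poly_Mapping.keys g. if pre_digraph.awlast G u p = v
     then Poly_Mapping.single (u, p @ q) (c * Poly_Mapping.lookup g (u, p)) else 0"
  have eq: "path_mult G h g = (\<Sum>x\<in>Poly_Mapping.keys h. ?F x (Poly_Mapping.lookup h x))" for h
    unfolding path_mult_def by (intro sum.cong) auto
  show ?thesis
    unfolding eq
    by (rule setsum_keys_plus_distrib)
      (auto simp: distrib_right single_add simp flip: sum.distrib intro!: sum.cong sum.neutral)
qed

lemma path_mult_add_right: "path_mult G f (g + g') = path_mult G f g + path_mult G f g'"
proof -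
  let ?F = "\<lambda>vq (u, p) c. if pre_digraph.awlast G u p = fst vq
     then Poly_Mapping.single (u, p @ snd vq) (Poly_Mapping.lookup f vq * c) else 0"
  have eq: "path_mult G f h = (\<Sum>vq\<in>Poly_Mapping.keys f. \<Sum>x\<in>Poly_Mapping.keys h. ?F vq x (Poly_Mapping.lookup h x))" for h
    unfolding path_mult_def by (intro sum.cong) (auto intro!: sum.cong)
  show ?thesis
    unfolding eq sum.distrib[symmetric]
    by (intro sum.cong refl setsum_keys_plus_distrib)
      (auto simp: distrib_left single_add)
qed

lemma path_mult_zero: "path_mult G 0 g = 0" "path_mult G f 0 = 0"
  by (simp_all add: path_mult_def)

lemma path_mult_single:
  "path_mult G (Poly_Mapping.single (v, q) a) (Poly_Mapping.single (u, p) b) =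
   (if pre_digraph.awlast G u p = v then Poly_Mapping.single (u, p @ q) (a * b) else 0)"
  by (auto simp: path_mult_def)

lemma path_mult_sum_left: "path_mult G (\<Sum>i\<in>S. f i) g = (\<Sum>i\<in>S. path_mult G (f i) g)"
  by (induct S rule: infinite_finite_induct) (simp_all add: path_mult_zero path_mult_add_left)

lemma path_mult_sum_right: "path_mult G f (\<Sum>i\<in>S. g i) = (\<Sum>i\<in>S. path_mult G f (g i))"
  by (induct S rule: infinite_finite_induct) (simp_all add: path_mult_zero path_mult_add_right)

lemma awlast_append: "pre_digraph.awlast G u (p @ q) = pre_digraph.awlast G (pre_digraph.awlast G u p) q"
  by (simp add: pre_digraph.awalk_verts_conv)

lemma path_mult_assoc: "path_mult G (path_mult G f g) h = path_mult G f (path_mult G g h)"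
proof (induct f rule: poly_mapping_induct)
  case (single x a)
  show ?case
  proof (induct g rule: poly_mapping_induct)
    case (single y b)
    show ?case
    proof (induct h rule: poly_mapping_induct)
      case (single z c)
      show ?case
        by (cases x; cases y; cases z) (auto simp: path_mult_single path_mult_zero awlast_append mult.assoc)
    qed (simp_all add: path_mult_zero path_mult_add_right)
  qed (simp_all add: path_mult_zero path_mult_add_right path_mult_add_left)
qed (simp_all add: path_mult_zero path_mult_add_left)

lemma scale_add: "Poly_Mapping.map ((*) c) (f + g) =
    Poly_Mapping.map ((*) c) f + Poly_Mapping.map ((*) (c::'k::field)) g"
  by (rule poly_mapping_eqI) (simp add: lookup_scale lookup_add distrib_left)

lemma path_mult_scale:
  fixes c :: "'k::field"
  shows path_mult_scale_left: "path_mult G (Poly_Mapping.map ((*) c) f) g = Poly_Mapping.map ((*) c) (path_mult G f g)"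
    and path_mult_scale_right: "path_mult G f (Poly_Mapping.map ((*) c) g) = Poly_Mapping.map ((*) c) (path_mult G f g)"
proof -
  have z: "Poly_Mapping.map ((*) c) 0 = 0" by (rule poly_mapping_eqI) (simp add: lookup_scale)
  have s: "Poly_Mapping.map ((*) c) (Poly_Mapping.single x a) = Poly_Mapping.single x (c * a)" for x :: "'v \<times> 'e list" and a
    by (rule poly_mapping_eqI) (simp add: lookup_scale lookup_single when_def)
  show "path_mult G (Poly_Mapping.map ((*) c) f) g = Poly_Mapping.map ((*) c) (path_mult G f g)"
  proof (induct f rule: poly_mapping_induct)
    case (single x a)
    obtain v q where [simp]: "x = (v, q)" by force
    show ?case
      by (induct g rule: poly_mapping_induct)
        (auto simp: path_mult_zero path_mult_add_right path_mult_single s z scale_add mult.assoc split_paired_all)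
  qed (simp_all add: z path_mult_zero path_mult_add_left scale_add)
  show "path_mult G f (Poly_Mapping.map ((*) c) g) = Poly_Mapping.map ((*) c) (path_mult G f g)"
  proof (induct f rule: poly_mapping_induct)
    case (single x a)
    obtain v q where [simp]: "x = (v, q)" by force
    show ?case
      by (induct g rule: poly_mapping_induct)
        (auto simp: path_mult_zero path_mult_add_right path_mult_single s z scale_add mult.left_commute split_paired_all)
  qed (simp_all add: z path_mult_zero path_mult_add_left scale_add)
qed

end

lemma path_algebra_sel:
  shows carrier_path_algebra: "carrier (path_algebra G) = {f. Poly_Mapping.keys f \<subseteq> quiver_paths G}"
    and mult_path_algebra: "mult (path_algebra G) = path_mult G"
    and one_path_algebra: "one (path_algebra G) = (\<Sum>v\<in>verts G. Poly_Mapping.single (v, []) 1)"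
    and zero_path_algebra: "zero (path_algebra G) = 0"
    and add_path_algebra: "add (path_algebra G) = (+)"
    and smult_path_algebra: "smult (path_algebra G) = (\<lambda>c. Poly_Mapping.map ((*) c))"
  by (simp_all add: path_algebra_def)

lemma single_in_path_algebra: "x \<in> quiver_paths G \<Longrightarrow> Poly_Mapping.single x c \<in> carrier (path_algebra G)"
  by (auto simp: carrier_path_algebra)

context wf_digraph
begin

lemma quiver_paths_iff: "(u, p) \<in> quiver_paths G \<longleftrightarrow> awalk u p (awlast u p)"
  by (auto simp: quiver_paths_def dest: awalkE)

lemma path_mult_closed:
  assumes f: "Poly_Mapping.keys f \<subseteq> quiver_paths G" and g: "Poly_Mapping.keys g \<subseteq> quiver_paths G"
  shows "Poly_Mapping.keys (path_mult G f g) \<subseteq> quiver_paths G"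
  using f
proof (induct f rule: poly_mapping_induct_on)
  case (single x c)
  show ?case using g
  proof (induct g rule: poly_mapping_induct_on)
    case (single y d)
    with \<open>x \<in> quiver_paths G\<close> show ?case
      by (cases x; cases y) (auto simp: path_mult_single quiver_paths_iff awlast_append)
  next
    case (add f g)
    then show ?case using keys_add[of "path_mult G (Poly_Mapping.single x c) f"]
      by (fastforce simp: path_mult_add_right)
  qed (simp add: path_mult_zero)
next
  case (add f f')
  then show ?case using keys_add[of "path_mult G f g" "path_mult G f' g"]
    by (fastforce simp: path_mult_add_left)
qed (simp add: path_mult_zero)

lemma path_algebra_ring:
  assumes fin: "finite (verts G)"
  shows "ring (path_algebra G :: ('k::field, _) module)"
proof (intro ringI abelian_groupI monoidI)
  let ?A = "path_algebra G :: ('k, _) module"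
  note sel = carrier_path_algebra mult_path_algebra zero_path_algebra add_path_algebra
  fix f g :: "('a \<times> 'b list) \<Rightarrow>\<^sub>0 'k" assume f: "f \<in> carrier ?A" and g: "g \<in> carrier ?A"
  show "f \<oplus>\<^bsub>?A\<^esub> g \<in> carrier ?A"
    using f g keys_add[of f g] by (auto simp: sel)
  show "f \<otimes>\<^bsub>?A\<^esub> g \<in> carrier ?A"
    using f g path_mult_closed by (simp add: sel)
  show "f \<oplus>\<^bsub>?A\<^esub> g = g \<oplus>\<^bsub>?A\<^esub> f" by (simp add: sel add.commute)
next
  let ?A = "path_algebra G :: ('k, _) module"
  note sel = carrier_path_algebra mult_path_algebra zero_path_algebra add_path_algebra
  fix f :: "('a \<times> 'b list) \<Rightarrow>\<^sub>0 'k" assume f: "f \<in> carrier ?A"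
  show "\<exists>g\<in>carrier ?A. g \<oplus>\<^bsub>?A\<^esub> f = \<zero>\<^bsub>?A\<^esub>"
    using f by (intro bexI[of _ "- f"]) (auto simp: sel in_keys_iff subset_iff)
  have unit: "path_mult G (Poly_Mapping.single (v, []) 1) (Poly_Mapping.single (u, p) c) =
      (if awlast u p = v then Poly_Mapping.single (u, p) c else 0)"
    "path_mult G (Poly_Mapping.single (u, p) c) (Poly_Mapping.single (v, []) 1) =
      (if u = v then Poly_Mapping.single (u, p) c else 0)" for v u p and c :: 'k
    by (auto simp: path_mult_single)
  from f have keys: "Poly_Mapping.keys f \<subseteq> quiver_paths G" by (simp add: sel)
  then have "path_mult G \<one>\<^bsub>?A\<^esub> f = f \<and> path_mult G f \<one>\<^bsub>?A\<^esub> = f"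
  proof (induct f rule: poly_mapping_induct_on)
    case (single x c)
    obtain u p where x: "x = (u, p)" by force
    with single have "u \<in> verts G" "awlast u p \<in> verts G" by (auto simp: quiver_paths_iff)
    then show ?case
      using fin by (simp add: x one_path_algebra path_mult_sum_left path_mult_sum_right unit)
  qed (simp_all add: path_mult_zero path_mult_add_left path_mult_add_right)
  then show "\<one>\<^bsub>?A\<^esub> \<otimes>\<^bsub>?A\<^esub> f = f" "f \<otimes>\<^bsub>?A\<^esub> \<one>\<^bsub>?A\<^esub> = f" by (simp_all add: sel)
next
  let ?A = "path_algebra G :: ('k, _) module"
  have "Poly_Mapping.keys (\<Sum>v\<in>verts G. Poly_Mapping.single (v, []::'b list) (1::'k)) \<subseteq> quiver_paths G"
    using keys_sum[of "\<lambda>v. Poly_Mapping.single (v, []::'b list) (1::'k)" "verts G"]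
    by (fastforce simp: quiver_paths_iff awalk_Nil_iff)
  then show "\<one>\<^bsub>?A\<^esub> \<in> carrier ?A"
    by (simp add: carrier_path_algebra one_path_algebra)
qed (auto simp: carrier_path_algebra mult_path_algebra zero_path_algebra add_path_algebra add.assoc
    path_mult_assoc path_mult_add_left path_mult_add_right)

lemma path_algebra_field_algebra:
  assumes fin: "finite (verts G)"
  shows "field_algebra (path_algebra G :: ('k::field, _) module)"
proof -
  let ?A = "path_algebra G :: ('k, _) module"
  note sel = carrier_path_algebra mult_path_algebra zero_path_algebra add_path_algebra smult_path_algebra
  interpret ring ?A by (rule path_algebra_ring[OF fin])
  have "left_module (class_ring :: 'k ring) ?A"
  proof (intro left_moduleI class_ring.ring_axioms)
    show "abelian_group ?A" by (rule abelian_group_axioms)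
  qed (auto simp: sel scale_add in_keys_iff lookup_scale subset_iff
      intro!: poly_mapping_eqI simp: lookup_add algebra_simps)
  then show ?thesis
    by (intro field_algebra.intro field_algebra_axioms.intro)
      (auto simp: sel path_mult_scale_left path_mult_scale_right ring_axioms[unfolded sel] ring_axioms)
qed

end

section \<open>The relations of the Beilinson algebra and commuting monomials\<close>


abbreviation "Q \<equiv> beilinson_quiver"

lemma beilinson_quiver_sel:
  "verts (Q n r) = {..<n}" "arcs (Q n r) = {(i, s). Suc i < n \<and> s < r}"
  "tail (Q n r) = fst" "head (Q n r) = (\<lambda>(i, s). Suc i)"
  by (simp_all add: beilinson_quiver_def)

lemma beilinson_quiver_wf: "wf_digraph (Q n r)"
  by unfold_locales (auto simp: beilinson_quiver_sel)

abbreviation end_vertex :: "nat \<Rightarrow> nat \<Rightarrow> nat \<Rightarrow> (nat \<times> nat) list \<Rightarrow> nat" where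
  "end_vertex n r \<equiv> pre_digraph.awlast (Q n r)"

text \<open>
A path of the Beilinson quiver is its source together with the word of its labels, since each arrow
leads to the next vertex.
\<close>

primrec label_path :: "nat \<Rightarrow> nat list \<Rightarrow> (nat \<times> nat) list" where
  "label_path u [] = []"
| "label_path u (s # ls) = (u, s) # label_path (Suc u) ls"

lemma end_vertex_label_path: "end_vertex n r u (label_path u ls) = u + length ls"
  by (induct ls arbitrary: u) (auto simp: pre_digraph.awalk_verts.simps beilinson_quiver_sel 
      pre_digraph.awalk_verts_non_Nil)

lemma quiver_paths_Q:
  "quiver_paths (Q n r) = {(u, label_path u ls) | u ls. u + length ls < n \<and> set ls \<subseteq> {..<r}}"
proof -
  interpret wf_digraph "Q n r" by (rule beilinson_quiver_wf)
  have 1: "\<exists>ls. p = label_path u ls \<and> u + length ls < n \<and> set ls \<subseteq> {..<r}" if "awalk u p v" for u p v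
    using that
  proof (induct p arbitrary: u)
    case Nil
    then show ?case by (intro exI[of _ "[]"]) (auto simp: awalk_Nil_iff beilinson_quiver_sel)
  next
    case (Cons a p)
    then have a: "a \<in> arcs (Q n r)" "u = fst a" "awalk (Suc u) p v"
      by (auto simp: awalk_Cons_iff beilinson_quiver_sel split: prod.splits)
    obtain ls where "p = label_path (Suc u) ls \<and> Suc u + length ls < n \<and> set ls \<subseteq> {..<r}"
      using Cons(1)[OF a(3)] by blast
    with a show ?case
      by (intro exI[of _ "snd a # ls"]) (auto simp: beilinson_quiver_sel)
  qed
  have 2: "awalk u (label_path u ls) (u + length ls)" if "u + length ls < n" "set ls \<subseteq> {..<r}" for u ls
    using that
  proof (induct ls arbitrary: u)
    case (Cons a ls)
    from Cons.hyps[of "Suc u"] Cons.prems show ?case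
      by (auto simp: awalk_Cons_iff beilinson_quiver_sel)
  qed (auto simp: awalk_Nil_iff beilinson_quiver_sel)
  show ?thesis
    unfolding quiver_paths_def using 1 2 by blast
qed

definition label_monomial :: "nat list \<Rightarrow> nat \<Rightarrow>\<^sub>0 nat" where
  "label_monomial ls = (\<Sum>s\<leftarrow>ls. Poly_Mapping.single s 1)"

lemma label_monomial_simps [simp]:
  "label_monomial [] = 0" "label_monomial (s # ls) = Poly_Mapping.single s 1 + label_monomial ls"
  "label_monomial (ls @ ls') = label_monomial ls + label_monomial ls'"
  by (simp_all add: label_monomial_def)

lemma lookup_label_monomial: "Poly_Mapping.lookup (label_monomial ls) s = count (mset ls) s"
  by (induct ls) (auto simp: lookup_add lookup_single when_def)

lemma label_monomial_eq_iff: "label_monomial ls = label_monomial ls' \<longleftrightarrow> mset ls = mset ls'"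
  using lookup_label_monomial by (metis (full_types) multiset_eqI poly_mapping_eqI)

text \<open>
The entry at \<open>(u, v)\<close> of the matrix of polynomials attached to \<open>f\<close>: the sum over all paths from \<open>u\<close> to
\<open>v\<close> of the coefficient times the commutative monomial of the labels. Polynomials are finitely supported
functions on monomials, which are themselves finitely supported functions from variables to exponents.
\<close>

definition entry ::
    "nat \<Rightarrow> nat \<Rightarrow> nat \<Rightarrow> nat \<Rightarrow> ((nat, nat \<times> nat) path \<Rightarrow>\<^sub>0 'k::field) \<Rightarrow> (nat \<Rightarrow>\<^sub>0 nat) \<Rightarrow>\<^sub>0 'k" where
  "entry n r u v f = (\<Sum>x\<in>Poly_Mapping.keys f. if fst x = u \<and> end_vertex n r u (snd x) = v
     then Poly_Mapping.single (label_monomial (map snd (snd x))) (Poly_Mapping.lookup f x) else 0)"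

lemma entry_zero [simp]: "entry n r u v 0 = 0"
  by (simp add: entry_def)

lemma entry_add: "entry n r u v (f + g) = entry n r u v f + entry n r u v g"
  unfolding entry_def
  by (rule setsum_keys_plus_distrib[where f = "\<lambda>x c. if fst x = u \<and> end_vertex n r u (snd x) = v
     then Poly_Mapping.single (label_monomial (map snd (snd x))) c else 0"])
   (auto simp: single_add)

lemma entry_single: "entry n r u v (Poly_Mapping.single x c) =
    (if fst x = u \<and> end_vertex n r u (snd x) = v
     then Poly_Mapping.single (label_monomial (map snd (snd x))) c else 0)"
  by (auto simp: entry_def)

lemma entry_sum: "entry n r u v (\<Sum>i\<in>S. f i) = (\<Sum>i\<in>S. entry n r u v (f i))"
  by (induct S rule: infinite_finite_induct) (simp_all add: entry_add)

lemma entry_uminus: "entry n r u v (- f) = - entry n r u v f"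
  using entry_add[of n r u v f "- f"] by (simp add: eq_neg_iff_add_eq_0 add.commute)

text \<open>
The arrows compose from right to left, so the attached matrices multiply in the opposite order. The sum
runs over the vertex in the middle; for two single paths only the source of the left factor contributes.
\<close>

lemma entry_mult:
  assumes f: "f \<in> carrier (path_algebra (Q n r))" and g: "g \<in> carrier (path_algebra (Q n r))"
  shows "entry n r u v (path_mult (Q n r) f g) = (\<Sum>l<n. entry n r l v f * entry n r u l g)"
proof -
  from f have "Poly_Mapping.keys f \<subseteq> quiver_paths (Q n r)" by (simp add: carrier_path_algebra)
  then show ?thesis
  proof (induct f rule: poly_mapping_induct_on)
    case (single x c)
    obtain b q where x: "x = (b, q)" by force
    have b: "b < n" using single by (auto simp: x quiver_paths_Q)
    from g have "Poly_Mapping.keys g \<subseteq> quiver_paths (Q n r)" by (simp add: carrier_path_algebra)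
    then show ?case
    proof (induct g rule: poly_mapping_induct_on)
      case (single y d)
      obtain a p where y: "y = (a, p)" by force
      have "(\<Sum>l<n. entry n r l v (Poly_Mapping.single x c) * entry n r u l (Poly_Mapping.single y d)) =
        (\<Sum>l<n. if l = b then entry n r b v (Poly_Mapping.single x c) * entry n r u b (Poly_Mapping.single y d) else 0)"
        by (intro sum.cong) (auto simp: entry_single x)
      also have "\<dots> = entry n r b v (Poly_Mapping.single x c) * entry n r u b (Poly_Mapping.single y d)"
        using b by simp
      also have "\<dots> = entry n r u v (path_mult (Q n r) (Poly_Mapping.single x c) (Poly_Mapping.single y d))"
        by (auto simp: x y entry_single path_mult_single mult_single awlast_append add.commute)
      finally show ?case by simp
    qed (simp_all add: path_mult_zero path_mult_add_right entry_add distrib_left sum.distrib)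
  qed (simp_all add: path_mult_zero path_mult_add_left entry_add distrib_right sum.distrib)
qed

definition entry_kernel :: "nat \<Rightarrow> nat \<Rightarrow> ((nat, nat \<times> nat) path \<Rightarrow>\<^sub>0 'k::field) set" where
  "entry_kernel n r = {f \<in> carrier (path_algebra (Q n r)). \<forall>u v. entry n r u v f = 0}"

lemma Q_field_algebra: "field_algebra (path_algebra (Q n r) :: ('k::field, _) module)"
  by (rule wf_digraph.path_algebra_field_algebra[OF beilinson_quiver_wf]) (simp add: beilinson_quiver_sel)

lemma relations_subset:
  "(beilinson_relations n r :: ((nat, nat \<times> nat) path \<Rightarrow>\<^sub>0 'k::field) set) \<subseteq> entry_kernel n r"
proof
  fix f :: "(nat, nat \<times> nat) path \<Rightarrow>\<^sub>0 'k" assume "f \<in> beilinson_relations n r"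
  then obtain j s t where j: "1 \<le> j" "Suc j < n" and st: "s < r" "t < r" and
    f: "f = Poly_Mapping.single (j - 1, [(j - 1, t), (j, s)]) 1 - Poly_Mapping.single (j - 1, [(j - 1, s), (j, t)]) 1"
    unfolding beilinson_relations_def by blast
  have p: "(j - 1, [(j - 1, a), (j, b)]) \<in> quiver_paths (Q n r)" if "a < r" "b < r" for a b
    unfolding quiver_paths_Q using j that by (auto intro!: exI[of _ "j - 1"] exI[of _ "[a, b]"])
  have e: "end_vertex n r u [(j - 1, a), (j, b)] = Suc j" for a b u
    using j by (simp add: pre_digraph.awalk_verts.simps beilinson_quiver_sel)
  have "Poly_Mapping.keys f \<subseteq> quiver_paths (Q n r)"
    using keys_diff[of "Poly_Mapping.single (j - 1, [(j - 1, t), (j, s)]) (1::'k)" "Poly_Mapping.single (j - 1, [(j - 1, s), (j, t)]) 1"]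
      p[OF st] p[OF st(2) st(1)] unfolding f by (auto split: if_splits)
  moreover have "entry n r u v f = 0" for u v
    unfolding f diff_conv_add_uminus entry_add entry_uminus entry_single
    by (auto simp: e[simplified] add.commute)
  ultimately show "f \<in> entry_kernel n r"
    by (simp add: entry_kernel_def carrier_path_algebra)
qed

lemma entry_kernel_ideal: "ideal (entry_kernel n r) (path_algebra (Q n r) :: ('k::field, _) module)"
proof -
  let ?A = "path_algebra (Q n r) :: ('k, _) module"
  interpret field_algebra ?A by (rule Q_field_algebra)
  note sel = zero_path_algebra add_path_algebra
  have inv: "\<ominus>\<^bsub>?A\<^esub> f = - f" if "f \<in> carrier ?A" for f
    using minus_equality[of "- f" f] that
    by (auto simp: sel carrier_path_algebra in_keys_iff subset_iff)
  show ?thesis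
  proof (rule idealI)
    show "ring ?A" by (rule ring_axioms)
    show "subgroup (entry_kernel n r) (add_monoid ?A)"
    proof (rule add.subgroupI)
      show "\<ominus>\<^bsub>?A\<^esub> f \<in> entry_kernel n r" if "f \<in> entry_kernel n r" for f
        using that inv[of f] a_inv_closed[of f]
        by (auto simp: entry_kernel_def entry_uminus)
      show "(entry_kernel n r :: ((nat, nat \<times> nat) path \<Rightarrow>\<^sub>0 'k) set) \<noteq> {}"
        using zero_closed by (auto simp: entry_kernel_def sel intro!: exI[of _ 0])
      show "f \<oplus>\<^bsub>?A\<^esub> g \<in> entry_kernel n r"
        if "f \<in> entry_kernel n r" "g \<in> entry_kernel n r" for f g
        using that a_closed[of f g] by (auto simp: entry_kernel_def entry_add sel)
    qed (auto simp: entry_kernel_def)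
    show "f \<otimes>\<^bsub>?A\<^esub> g \<in> entry_kernel n r" "g \<otimes>\<^bsub>?A\<^esub> f \<in> entry_kernel n r"
      if "g \<in> entry_kernel n r" "f \<in> carrier ?A" for f g
      using that m_closed[of f g] m_closed[of g f]
      by (auto simp: entry_kernel_def entry_mult mult_path_algebra)
  qed
qed

locale beilinson =
  fixes n r :: nat and field_type :: "'k::field itself"
begin

abbreviation (input) "PA \<equiv> path_algebra (Q n r) :: ('k, _) module"
abbreviation (input) "J \<equiv> beilinson_ideal n r :: ((nat, nat \<times> nat) path \<Rightarrow>\<^sub>0 'k) set"

sublocale PA: field_algebra PA by (rule Q_field_algebra)

lemma beilinson_ideal: "ideal J PA"
  unfolding beilinson_ideal_def
  by (rule PA.genideal_ideal) (use relations_subset in \<open>auto simp: entry_kernel_def\<close>)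

sublocale J: ideal J PA by (rule beilinson_ideal)

lemma beilinson_ideal_subset: "J \<subseteq> entry_kernel n r"
  unfolding beilinson_ideal_def
  by (rule PA.genideal_minimal[OF entry_kernel_ideal relations_subset])

definition label_single :: "nat \<Rightarrow> nat list \<Rightarrow> (nat, nat \<times> nat) path \<Rightarrow>\<^sub>0 'k" where
  "label_single u ls = Poly_Mapping.single (u, label_path u ls) 1"

text \<open>
Two words of labels, read from the vertex \<open>u\<close>, define the same element of the Beilinson algebra.
\<close>

definition label_cong :: "nat \<Rightarrow> nat list \<Rightarrow> nat list \<Rightarrow> bool" where
  "label_cong u ls ls' \<longleftrightarrow> label_single u ls - label_single u ls' \<in> J"

lemma J_add: "f \<in> J \<Longrightarrow> g \<in> J \<Longrightarrow> f + g \<in> J"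
  using J.a_closed by (simp add: add_path_algebra)

lemma J_mult: "f \<in> J \<Longrightarrow> g \<in> carrier PA \<Longrightarrow> path_mult (Q n r) f g \<in> J"
    "f \<in> J \<Longrightarrow> g \<in> carrier PA \<Longrightarrow> path_mult (Q n r) g f \<in> J"
  using J.I_l_closed J.I_r_closed by (simp_all add: mult_path_algebra)

lemma J_zero: "0 \<in> J"
  using J.zero_closed by (simp add: zero_path_algebra)

lemma label_cong_refl: "label_cong u ls ls"
  by (simp add: label_cong_def J_zero)

lemma label_cong_trans: "label_cong u a b \<Longrightarrow> label_cong u b c \<Longrightarrow> label_cong u a c"
  using J_add[of "label_single u a - label_single u b" "label_single u b - label_single u c"]
  by (simp add: label_cong_def)

text \<open>
A further arrow in front is a factor on the right, because products run through the right factor first.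
\<close>

lemma label_cong_cons:
  assumes "label_cong (Suc u) a b" "Suc u < n" "s < r"
  shows "label_cong u (s # a) (s # b)"
proof -
  let ?e = "Poly_Mapping.single (u, [(u, s)]) (1::'k)"
  have "?e \<in> carrier PA"
    using assms by (intro single_in_path_algebra)
      (auto simp: quiver_paths_Q intro!: exI[of _ u] exI[of _ "[s]"])
  from J_mult(1)[OF assms(1)[unfolded label_cong_def] this]
  show ?thesis
    by (simp add: label_cong_def label_single_def diff_conv_add_uminus path_mult_add_left
        single_uminus[symmetric] path_mult_single pre_digraph.awalk_verts.simps beilinson_quiver_sel
        del: add_uminus_conv_diff)
qed

lemma label_cong_swap:
  assumes "Suc (Suc u) + length a < n" "s < r" "t < r" "set a \<subseteq> {..<r}"
  shows "label_cong u (s # t # a) (t # s # a)"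
proof -
  let ?p = "\<lambda>a b. Poly_Mapping.single (u, [(u, a), (Suc u, b)]) (1::'k)"
  have "?p s t - ?p t s \<in> beilinson_relations n r"
    unfolding beilinson_relations_def mem_Collect_eq using assms
    by (intro exI[of _ "Suc u"] exI[of _ t] exI[of _ s]) auto
  moreover have "beilinson_relations n r \<subseteq> J"
    unfolding beilinson_ideal_def
    by (rule PA.genideal_self) (use relations_subset in \<open>auto simp: entry_kernel_def\<close>)
  ultimately have rel: "?p s t - ?p t s \<in> J" by blast
  have "label_single (Suc (Suc u)) a \<in> carrier PA"
    unfolding label_single_def using assms by (intro single_in_path_algebra) (auto simp: quiver_paths_Q)
  from J_mult(2)[OF rel this] show ?thesis
    by (simp add: label_cong_def label_single_def diff_conv_add_uminus path_mult_add_right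
        single_uminus[symmetric] path_mult_single pre_digraph.awalk_verts.simps beilinson_quiver_sel
        del: add_uminus_conv_diff)
qed

lemma label_cong_move:
  assumes "u + length A + length B + 1 < n" "x < r" "set A \<subseteq> {..<r}" "set B \<subseteq> {..<r}"
  shows "label_cong u (x # A @ B) (A @ x # B)"
  using assms
proof (induct A arbitrary: u)
  case Nil
  then show ?case by (simp add: label_cong_refl)
next
  case (Cons a A)
  have "label_cong u (x # a # A @ B) (a # x # A @ B)"
    using Cons.prems by (intro label_cong_swap) auto
  moreover have "label_cong u (a # x # A @ B) (a # A @ x # B)"
    using Cons by (intro label_cong_cons Cons.hyps) auto
  ultimately show ?case by (auto intro: label_cong_trans)
qed

text \<open>
Any rearrangement is a composite of swaps of neighbours: the first letter of \<open>a\<close> is moved to its place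
in \<open>b\<close>, and the induction hypothesis treats the rest.
\<close>

lemma label_cong_mset:
  assumes "mset a = mset b" "u + length a < n" "set a \<subseteq> {..<r}"
  shows "label_cong u a b"
  using assms
proof (induct a arbitrary: u b)
  case Nil
  then show ?case by (simp add: label_cong_refl)
next
  case (Cons x a)
  then have "x \<in> set b" by (metis list.set_intros(1) set_mset_mset)
  then obtain A B where b: "b = A @ x # B" by (auto dest: split_list)
  have ms: "mset a = mset (A @ B)" using Cons.prems(1) by (simp add: b)
  then have AB: "set a = set A \<union> set B" "length a = length A + length B"
    by (metis set_append set_mset_mset) (use ms mset_eq_length in fastforce)
  have "label_cong u (x # a) (x # A @ B)"
    using Cons.prems ms by (intro label_cong_cons Cons.hyps) auto
  moreover have "label_cong u (x # A @ B) (A @ x # B)"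
    using Cons.prems AB by (intro label_cong_move) auto
  ultimately show ?case unfolding b by (rule label_cong_trans)
qed

lemma map_snd_label_path: "map snd (label_path u ls) = ls"
  by (induct ls arbitrary: u) auto

definition word_of_monomial :: "(nat \<Rightarrow>\<^sub>0 nat) \<Rightarrow> nat list" where
  "word_of_monomial m = (SOME ls. label_monomial ls = m)"

lemma mset_word_of_monomial: "mset (word_of_monomial (label_monomial ls)) = mset ls"
  using someI[of "\<lambda>l. label_monomial l = label_monomial ls" ls]
  by (simp add: word_of_monomial_def label_monomial_eq_iff)

text \<open>
A linear section of the passage from words to monomials: each monomial is lifted to one chosen word,
read from the vertex \<open>u\<close>.
\<close>

definition word_lift :: "nat \<Rightarrow> ((nat \<Rightarrow>\<^sub>0 nat) \<Rightarrow>\<^sub>0 'k) \<Rightarrow> (nat, nat \<times> nat) path \<Rightarrow>\<^sub>0 'k" where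
  "word_lift u P = (\<Sum>m\<in>Poly_Mapping.keys P.
     Poly_Mapping.single (u, label_path u (word_of_monomial m)) (Poly_Mapping.lookup P m))"

lemma word_lift_zero: "word_lift u 0 = 0"
  by (simp add: word_lift_def)

lemma word_lift_add: "word_lift u (P + P') = word_lift u P + word_lift u P'"
  unfolding word_lift_def by (rule setsum_keys_plus_distrib) (simp_all add: single_add)

lemma word_lift_single:
  "word_lift u (Poly_Mapping.single m c) = Poly_Mapping.single (u, label_path u (word_of_monomial m)) c"
  by (simp add: word_lift_def)

text \<open>
Lifting the entries of \<open>f\<close> back to paths replaces every path by the chosen word with the same monomial,
which is congruent to it.
\<close>

lemma cong_word_lift:
  assumes "f \<in> carrier PA"
  shows "f - (\<Sum>u<n. \<Sum>v<n. word_lift u (entry n r u v f)) \<in> J"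
proof -
  from assms have "Poly_Mapping.keys f \<subseteq> quiver_paths (Q n r)" by (simp add: carrier_path_algebra)
  then show ?thesis
  proof (induct f rule: poly_mapping_induct_on)
    case (single x c)
    then obtain a ls where x: "x = (a, label_path a ls)" and ls: "a + length ls < n" "set ls \<subseteq> {..<r}"
      by (auto simp: quiver_paths_Q)
    let ?ls = "word_of_monomial (label_monomial ls)"
    have "word_lift u (entry n r u v (Poly_Mapping.single x c)) =
        (if v = a + length ls then if u = a then Poly_Mapping.single (a, label_path a ?ls) c else 0 else 0)" for u v
      by (auto simp: x entry_single end_vertex_label_path word_lift_zero word_lift_single map_snd_label_path)
    then have "(\<Sum>u<n. \<Sum>v<n. word_lift u (entry n r u v (Poly_Mapping.single x c))) =
        (\<Sum>u<n. if u = a then Poly_Mapping.single (a, label_path a ?ls) c else 0)"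
      using ls by simp
    also have "\<dots> = Poly_Mapping.single (a, label_path a ?ls) c"
      using ls by simp
    finally have eq: "(\<Sum>u<n. \<Sum>v<n. word_lift u (entry n r u v (Poly_Mapping.single x c))) =
      Poly_Mapping.single (a, label_path a ?ls) c" .
    have "label_single a ls - label_single a ?ls \<in> J"
      using label_cong_mset[OF mset_word_of_monomial[symmetric] ls] by (simp add: label_cong_def)
    then have "c \<odot>\<^bsub>PA\<^esub> (label_single a ls - label_single a ?ls) \<in> J"
      using PA.ideal_left_submodule[OF beilinson_ideal] by (simp add: left_submodule_def)
    also have "c \<odot>\<^bsub>PA\<^esub> (label_single a ls - label_single a ?ls) =
        Poly_Mapping.single x c - Poly_Mapping.single (a, label_path a ?ls) c"
      by (rule poly_mapping_eqI)
        (simp add: smult_path_algebra lookup_scale label_single_def lookup_minus lookup_single x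
          when_def right_diff_distrib)
    finally show ?case unfolding eq .
  next
    case (add f g)
    have eq: "f + g - (\<Sum>u<n. \<Sum>v<n. word_lift u (entry n r u v (f + g))) =
      (f - (\<Sum>u<n. \<Sum>v<n. word_lift u (entry n r u v f))) +
      (g - (\<Sum>u<n. \<Sum>v<n. word_lift u (entry n r u v g)))"
      by (simp add: entry_add word_lift_add sum.distrib)
    show ?case unfolding eq by (rule J_add[OF add(1) add(2)])
  qed (simp add: word_lift_zero J_zero)
qed

text \<open>
The right-hand side is an ideal that contains the relations. If all entries of \<open>f\<close> vanish, then so does
the lift of the entries, to which \<open>f\<close> is congruent.
\<close>

theorem beilinson_ideal_eq: "J = entry_kernel n r"
proof
  show "entry_kernel n r \<subseteq> J"
  proof
    fix f :: "(nat, nat \<times> nat) path \<Rightarrow>\<^sub>0 'k" assume f: "f \<in> entry_kernel n r"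
    then have "(\<Sum>u<n. \<Sum>v<n. word_lift u (entry n r u v f)) = 0"
      by (simp add: entry_kernel_def word_lift_zero)
    with cong_word_lift[of f] f show "f \<in> J"
      by (simp add: entry_kernel_def)
  qed
qed (rule beilinson_ideal_subset)

end

section \<open>The Beilinson algebra and the presentation of the test modules\<close>

context beilinson
begin

abbreviation (input) "B \<equiv> beilinson_algebra n r :: ('k, 'k beil) module"
abbreviation (input) "XS \<equiv> X_summand n r :: 'k vec \<Rightarrow> _"
abbreviation (input) "XM \<equiv> X_module n r :: 'k vec \<Rightarrow> _"

lemma beilinson_field_algebra: "field_algebra B"
  unfolding beilinson_algebra_def
  by (rule field_algebra_quotient[OF PA.field_algebra_axioms beilinson_ideal])

sublocale B: field_algebra B by (rule beilinson_field_algebra)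

definition residue :: "((nat, nat \<times> nat) path \<Rightarrow>\<^sub>0 'k) \<Rightarrow> 'k beil" where
  "residue f = J +>\<^bsub>PA\<^esub> f"

lemma carrier_B: "carrier B = residue ` carrier PA"
  by (simp add: beilinson_algebra_def carrier_quot_module_image residue_def[abs_def])

lemma residue_mem: "f \<in> carrier PA \<Longrightarrow> residue f \<in> carrier B"
  by (simp add: carrier_B)

lemma residue_mult:
  "f \<in> carrier PA \<Longrightarrow> g \<in> carrier PA \<Longrightarrow> residue f \<otimes>\<^bsub>B\<^esub> residue g = residue (path_mult (Q n r) f g)"
  by (simp add: beilinson_algebra_def mult_quot_module residue_def J.rcoset_mult_add mult_path_algebra)

lemma residue_add:
  "f \<in> carrier PA \<Longrightarrow> g \<in> carrier PA \<Longrightarrow> residue f \<oplus>\<^bsub>B\<^esub> residue g = residue (f + g)"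
  using coset_add[OF PA.vs.left_module_axioms PA.ideal_left_submodule[OF beilinson_ideal]]
  by (simp add: beilinson_algebra_def residue_def add_path_algebra)

lemma residue_smult:
  "f \<in> carrier PA \<Longrightarrow> c \<odot>\<^bsub>B\<^esub> residue f = residue (c \<odot>\<^bsub>PA\<^esub> f)"
  using coset_act[OF PA.vs.left_module_axioms PA.ideal_left_submodule[OF beilinson_ideal], of c f]
  by (simp add: beilinson_algebra_def residue_def)

lemma residue_eq_zero_iff: "f \<in> carrier PA \<Longrightarrow> residue f = \<zero>\<^bsub>B\<^esub> \<longleftrightarrow> f \<in> entry_kernel n r"
  using coset_eq_zero_iff[OF PA.vs.left_module_axioms PA.ideal_left_submodule[OF beilinson_ideal], of f]
  by (simp add: beilinson_algebra_def residue_def zero_quot_module beilinson_ideal_eq)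

lemma residue_one: "residue (\<Sum>v<n. Poly_Mapping.single (v, []) 1) = \<one>\<^bsub>B\<^esub>"
  by (simp add: beilinson_algebra_def residue_def one_quot_module one_path_algebra beilinson_quiver_sel)

lemma PA_sum: "(\<And>i. i \<in> S \<Longrightarrow> f i \<in> carrier PA) \<Longrightarrow> (\<Sum>i\<in>S. f i) \<in> carrier PA"
  using keys_sum[of f S] by (fastforce simp: carrier_path_algebra)

lemma PA_zero: "0 \<in> carrier PA" by (simp add: carrier_path_algebra)

lemma residue_zero: "residue 0 = \<zero>\<^bsub>B\<^esub>"
  by (simp add: residue_eq_zero_iff PA_zero entry_kernel_def)

lemma residue_finsum:
  assumes "\<And>i. i \<in> S \<Longrightarrow> f i \<in> carrier PA"
  shows "(\<Oplus>\<^bsub>B\<^esub>i\<in>S. residue (f i)) = residue (\<Sum>i\<in>S. f i)"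
  using assms
proof (induct S rule: infinite_finite_induct)
  case (insert i S)
  then have "(\<lambda>i. residue (f i)) \<in> S \<rightarrow> carrier B" "residue (f i) \<in> carrier B"
    by (auto simp: residue_mem)
  with insert show ?case
    by (simp add: residue_add PA_sum)
qed (simp_all add: residue_zero)

abbreviation vertex_path :: "nat \<Rightarrow> (nat, nat \<times> nat) path \<Rightarrow>\<^sub>0 'k" where
  "vertex_path i \<equiv> Poly_Mapping.single (i, []) 1"

definition linear_form_path :: "'k vec \<Rightarrow> nat \<Rightarrow> (nat, nat \<times> nat) path \<Rightarrow>\<^sub>0 'k" where
  "linear_form_path \<alpha> i = (\<Sum>s<r. Poly_Mapping.single (i, [(i, s)]) (\<alpha> $ s))"

lemma vertex_path_mem: "i < n \<Longrightarrow> vertex_path i \<in> carrier PA"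
  by (intro single_in_path_algebra) (auto simp: quiver_paths_Q intro!: exI[of _ "[]"])

lemma arrow_path_mem: "Suc i < n \<Longrightarrow> s < r \<Longrightarrow> Poly_Mapping.single (i, [(i, s)]) c \<in> carrier PA"
  by (intro single_in_path_algebra) (auto simp: quiver_paths_Q intro!: exI[of _ i] exI[of _ "[s]"])

lemma linear_form_path_mem: "Suc i < n \<Longrightarrow> linear_form_path \<alpha> i \<in> carrier PA"
  unfolding linear_form_path_def by (intro PA_sum arrow_path_mem) auto

lemma idem_residue: "idem n r i = residue (vertex_path i)"
  by (simp add: idem_def path_class_def residue_def)

lemma arrow_comb_residue:
  assumes "Suc i < n" shows "arrow_comb n r \<alpha> i = residue (linear_form_path \<alpha> i)"
proof -
  have "(\<alpha> $ s) \<odot>\<^bsub>B\<^esub> arrow n r i s = residue (Poly_Mapping.single (i, [(i, s)]) (\<alpha> $ s))" if "s < r" for s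
  proof -
    have "(\<alpha> $ s) \<odot>\<^bsub>PA\<^esub> Poly_Mapping.single (i, [(i, s)]) 1 = Poly_Mapping.single (i, [(i, s)]) (\<alpha> $ s)"
      by (rule poly_mapping_eqI) (simp add: smult_path_algebra lookup_scale lookup_single when_def)
    then show ?thesis
      using residue_smult[OF arrow_path_mem[OF assms that, of 1], of "\<alpha> $ s"]
      by (simp add: arrow_def path_class_def residue_def)
  qed
  then have "arrow_comb n r \<alpha> i = (\<Oplus>\<^bsub>B\<^esub>s\<in>{..<r}. residue (Poly_Mapping.single (i, [(i, s)]) (\<alpha> $ s)))"
    unfolding arrow_comb_def using assms by (intro B.finsum_cong') (auto intro!: residue_mem arrow_path_mem)
  also have "\<dots> = residue (linear_form_path \<alpha> i)"
    unfolding linear_form_path_def using assms by (intro residue_finsum arrow_path_mem) auto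
  finally show ?thesis .
qed

lemma idem_mem: "i < n \<Longrightarrow> (idem n r i :: 'k beil) \<in> carrier B"
  by (simp add: idem_residue residue_mem vertex_path_mem)

lemma arrow_comb_mem: "Suc i < n \<Longrightarrow> (arrow_comb n r \<alpha> i :: 'k beil) \<in> carrier B"
  by (simp add: arrow_comb_residue residue_mem linear_form_path_mem)

lemma idem_mult: "i < n \<Longrightarrow> l < n \<Longrightarrow>
    (idem n r i :: 'k beil) \<otimes>\<^bsub>B\<^esub> idem n r l = (if i = l then idem n r i else \<zero>\<^bsub>B\<^esub>)"
  by (auto simp: idem_residue residue_mult vertex_path_mem path_mult_single
      pre_digraph.awalk_verts.simps residue_zero)

lemma idem_sum: "(\<Oplus>\<^bsub>B\<^esub>i\<in>{..<n}. idem n r i :: 'k beil) = \<one>\<^bsub>B\<^esub>"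
  unfolding idem_residue residue_one[symmetric] by (intro residue_finsum vertex_path_mem) simp

lemma idem_arrow_comb: "Suc i < n \<Longrightarrow> (idem n r (Suc i) :: 'k beil) \<otimes>\<^bsub>B\<^esub> arrow_comb n r \<alpha> i = arrow_comb n r \<alpha> i"
  by (simp add: idem_residue arrow_comb_residue residue_mult vertex_path_mem linear_form_path_mem)
    (simp add: linear_form_path_def path_mult_sum_right path_mult_single pre_digraph.awalk_verts.simps
      beilinson_quiver_sel)

lemma arrow_comb_idem: "Suc i < n \<Longrightarrow> (arrow_comb n r \<alpha> i :: 'k beil) \<otimes>\<^bsub>B\<^esub> idem n r i = arrow_comb n r \<alpha> i"
  by (simp add: idem_residue arrow_comb_residue residue_mult vertex_path_mem linear_form_path_mem)
    (simp add: linear_form_path_def path_mult_sum_left path_mult_single pre_digraph.awalk_verts.simps)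

lemma linear_form_nonzero:
  assumes "\<alpha> \<in> carrier_vec r - {0\<^sub>v r}"
  shows "(\<Sum>s<r. Poly_Mapping.single (Poly_Mapping.single s 1 :: nat \<Rightarrow>\<^sub>0 nat) (\<alpha> $ s :: 'k)) \<noteq> 0"
proof -
  obtain s where s: "s < r" "\<alpha> $ s \<noteq> 0"
    using assms by (metis Diff_iff carrier_vecD eq_vecI index_zero_vec singletonI)
  \<comment> \<open>distinct variables are distinct monomials, so the coefficients can be compared\<close>
  have inj: "Poly_Mapping.single l (1::nat) = Poly_Mapping.single s 1 \<longleftrightarrow> l = s" for l :: nat
    by (metis lookup_single_eq lookup_single_not_eq one_neq_zero)
  have "Poly_Mapping.lookup (\<Sum>l<r. Poly_Mapping.single (Poly_Mapping.single l 1 :: nat \<Rightarrow>\<^sub>0 nat) (\<alpha> $ l))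
      (Poly_Mapping.single s 1) = (\<Sum>l<r. if l = s then \<alpha> $ s else 0)"
    unfolding lookup_sum by (intro sum.cong) (auto simp: lookup_single when_def inj[simplified])
  also have "\<dots> = \<alpha> $ s" using s by simp
  finally show ?thesis using s by auto
qed

text \<open>
In terms of entries, row \<open>i\<close> of the product is row \<open>i + 1\<close> of \<open>x\<close> times one nonzero linear polynomial,
and polynomials over a field have no zero divisors.
\<close>

lemma arrow_comb_cancel:
  assumes \<alpha>: "\<alpha> \<in> carrier_vec r - {0\<^sub>v r}" and i: "Suc i < n" and x: "x \<in> carrier B"
    and zero: "x \<otimes>\<^bsub>B\<^esub> arrow_comb n r \<alpha> i = \<zero>\<^bsub>B\<^esub>"
  shows "x \<otimes>\<^bsub>B\<^esub> idem n r (Suc i) = \<zero>\<^bsub>B\<^esub>"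
proof -
  obtain f where f: "f \<in> carrier PA" "x = residue f" using x by (auto simp: carrier_B)
  let ?L = "\<Sum>s<r. Poly_Mapping.single (Poly_Mapping.single s 1 :: nat \<Rightarrow>\<^sub>0 nat) (\<alpha> $ s :: 'k)"
  have mem: "path_mult (Q n r) f (linear_form_path \<alpha> i) \<in> carrier PA"
    "path_mult (Q n r) f (vertex_path (Suc i)) \<in> carrier PA"
    using PA.m_closed[OF f(1)] linear_form_path_mem[OF i] vertex_path_mem[OF i]
    by (auto simp: mult_path_algebra)
  have "path_mult (Q n r) f (linear_form_path \<alpha> i) \<in> entry_kernel n r"
    using zero f i mem
    by (simp add: arrow_comb_residue residue_mult linear_form_path_mem residue_eq_zero_iff)
  then have *: "(\<Sum>l<n. entry n r l v f * entry n r i l (linear_form_path \<alpha> i)) = 0" for v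
    using entry_mult[OF f(1) linear_form_path_mem[OF i]] by (simp add: entry_kernel_def)
  have "entry n r i l (linear_form_path \<alpha> i) = (if l = Suc i then ?L else 0)" for l
    unfolding linear_form_path_def entry_sum entry_single
    by (auto simp: pre_digraph.awalk_verts.simps beilinson_quiver_sel intro!: sum.cong)
  then have "entry n r (Suc i) v f * ?L = 0" for v
    using *[of v] i by (simp add: if_distrib[of "(*) x" for x] cong: if_cong)
  then have **: "entry n r (Suc i) v f = 0" for v
    using linear_form_nonzero[OF \<alpha>] by simp
  have "entry n r u v (path_mult (Q n r) f (vertex_path (Suc i))) = 0" for u v
    unfolding entry_mult[OF f(1) vertex_path_mem[OF i]] entry_single
    by (rule sum.neutral) (auto simp: ** pre_digraph.awalk_verts.simps)
  then have "path_mult (Q n r) f (vertex_path (Suc i)) \<in> entry_kernel n r"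
    using mem by (simp add: entry_kernel_def)
  then show ?thesis
    using f i mem by (simp add: idem_residue residue_mult vertex_path_mem residue_eq_zero_iff)
qed

lemma arrow_comb_power:
  assumes "i + j < n"
  shows arrow_comb_power_mem: "(arrow_comb_power n r \<alpha> i j :: 'k beil) \<in> carrier B"
    and idem_arrow_comb_power: "idem n r (i + j) \<otimes>\<^bsub>B\<^esub> arrow_comb_power n r \<alpha> i j = arrow_comb_power n r \<alpha> i j"
    and arrow_comb_power_idem: "arrow_comb_power n r \<alpha> i j \<otimes>\<^bsub>B\<^esub> idem n r i = arrow_comb_power n r \<alpha> i j"
  using assms
proof (induct j)
  case (Suc j)
  case 1 then show ?case using Suc by (simp add: arrow_comb_mem)
  case 2 then show ?case
    using Suc by (simp add: arrow_comb_mem idem_mem idem_arrow_comb flip: B.m_assoc)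
  case 3 then show ?case
    using Suc by (simp add: arrow_comb_mem idem_mem B.m_assoc)
qed (auto simp: idem_mem idem_mult)

lemma arrow_comb_power_cancel:
  assumes \<alpha>: "\<alpha> \<in> carrier_vec r - {0\<^sub>v r}" and "i + j < n" and "x \<in> carrier B"
    and "x \<otimes>\<^bsub>B\<^esub> arrow_comb_power n r \<alpha> i j = \<zero>\<^bsub>B\<^esub>"
  shows "x \<otimes>\<^bsub>B\<^esub> idem n r (i + j) = \<zero>\<^bsub>B\<^esub>"
  using assms(2-)
proof (induct j arbitrary: x)
  case (Suc j)
  let ?a = "arrow_comb n r \<alpha> (i + j) :: 'k beil"
  have a: "?a \<in> carrier B" using Suc.prems by (intro arrow_comb_mem) simp
  have "(x \<otimes>\<^bsub>B\<^esub> ?a) \<otimes>\<^bsub>B\<^esub> arrow_comb_power n r \<alpha> i j = \<zero>\<^bsub>B\<^esub>"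
    using Suc.prems a by (simp add: B.m_assoc arrow_comb_power_mem)
  then have "(x \<otimes>\<^bsub>B\<^esub> ?a) \<otimes>\<^bsub>B\<^esub> idem n r (i + j) = \<zero>\<^bsub>B\<^esub>"
    using Suc.prems a by (intro Suc.hyps) auto
  then have "x \<otimes>\<^bsub>B\<^esub> ?a = \<zero>\<^bsub>B\<^esub>"
    using Suc.prems a arrow_comb_idem[of "i + j" \<alpha>] by (simp add: B.m_assoc idem_mem)
  then show ?case
    using arrow_comb_cancel[OF \<alpha>, of "i + j" x] Suc.prems by simp
qed simp


lemma proj_sel:
  shows carrier_proj: "carrier (proj_module n r i) = (\<lambda>b. b \<otimes>\<^bsub>B\<^esub> idem n r i) ` carrier B"
    and zero_proj: "zero (proj_module n r i) = zero B"
    and add_proj: "add (proj_module n r i) = add B"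
    and smult_proj: "smult (proj_module n r i) = mult B"
  by (simp_all add: proj_module_def regular_sel)

lemma proj_left_module: assumes i: "i < n" shows "left_module B (proj_module n r i :: ('k beil, 'k beil) module)"
proof -
  interpret R: left_module B "regular_module B" by (rule regular_left_module[OF B.ring_axioms])
  have "left_submodule B (carrier (proj_module n r i)) (regular_module B)"
    unfolding carrier_proj
  proof (rule left_submoduleI)
    show "\<zero>\<^bsub>regular_module B\<^esub> \<in> (\<lambda>b. b \<otimes>\<^bsub>B\<^esub> idem n r i) ` carrier B"
      using i by (auto simp: regular_sel idem_mem image_iff intro!: bexI[of _ "\<zero>\<^bsub>B\<^esub>"])
  qed (use i in \<open>auto simp: regular_sel idem_mem simp flip: B.l_distr B.m_assoc intro!: imageI\<close>)
  from R.submodule_left_module[OF this] show ?thesis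
    by (simp add: proj_module_def)
qed

definition relation_submodule :: "'k vec \<Rightarrow> nat \<Rightarrow> nat \<Rightarrow> 'k beil set" where
  "relation_submodule \<alpha> i j = (\<lambda>c. c \<otimes>\<^bsub>B\<^esub> arrow_comb_power n r \<alpha> i j) ` carrier B"

text \<open>
An element of \<open>B e\<^sub>i\<^sub>+\<^sub>j\<close> is \<open>c e\<^sub>i\<^sub>+\<^sub>j\<close>, and \<open>c e\<^sub>i\<^sub>+\<^sub>j w = c w\<close>.
\<close>

lemma alpha_map_image:
  assumes "i + j < n"
  shows "alpha_map n r \<alpha> i j ` carrier (proj_module n r (i + j)) = relation_submodule \<alpha> i j"
proof -
  have "alpha_map n r \<alpha> i j ` carrier (proj_module n r (i + j)) =
      (\<lambda>c. (c \<otimes>\<^bsub>B\<^esub> idem n r (i + j)) \<otimes>\<^bsub>B\<^esub> arrow_comb_power n r \<alpha> i j) ` carrier B"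
    unfolding alpha_map_def by (auto simp: carrier_proj)
  also have "\<dots> = relation_submodule \<alpha> i j"
    unfolding relation_submodule_def using assms
    by (intro image_cong) (simp_all add: B.m_assoc idem_mem arrow_comb_power_mem idem_arrow_comb_power)
  finally show ?thesis .
qed

lemma relation_left_submodule:
  assumes "i + j < n" shows "left_submodule B (relation_submodule \<alpha> i j) (proj_module n r i)"
proof (rule left_submoduleI)
  have w: "arrow_comb_power n r \<alpha> i j \<in> carrier B" using assms by (rule arrow_comb_power_mem)
  have "c \<otimes>\<^bsub>B\<^esub> arrow_comb_power n r \<alpha> i j = (c \<otimes>\<^bsub>B\<^esub> arrow_comb_power n r \<alpha> i j) \<otimes>\<^bsub>B\<^esub> idem n r i"
    if "c \<in> carrier B" for c
    using that assms w by (simp add: B.m_assoc idem_mem arrow_comb_power_idem)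
  then show "relation_submodule \<alpha> i j \<subseteq> carrier (proj_module n r i)"
    using w by (auto simp: relation_submodule_def carrier_proj)
  show "\<zero>\<^bsub>proj_module n r i\<^esub> \<in> relation_submodule \<alpha> i j"
    using w by (auto simp: relation_submodule_def proj_sel image_iff intro!: bexI[of _ "\<zero>\<^bsub>B\<^esub>"])
  show "x \<oplus>\<^bsub>proj_module n r i\<^esub> y \<in> relation_submodule \<alpha> i j"
    if "x \<in> relation_submodule \<alpha> i j" "y \<in> relation_submodule \<alpha> i j" for x y
    using that w by (auto simp: relation_submodule_def proj_sel simp flip: B.l_distr)
  show "a \<odot>\<^bsub>proj_module n r i\<^esub> x \<in> relation_submodule \<alpha> i j"
    if "a \<in> carrier B" "x \<in> relation_submodule \<alpha> i j" for a x
    using that w by (auto simp: relation_submodule_def proj_sel simp flip: B.m_assoc)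
qed

lemma X_summand_eq:
  assumes "i + j < n"
  shows "XS \<alpha> i j = quot_module (proj_module n r i) (relation_submodule \<alpha> i j)"
  using assms by (simp add: X_summand_def alpha_map_image)

lemma X_summand_left_module: "i + j < n \<Longrightarrow> left_module B (XS \<alpha> i j)"
  by (simp add: X_summand_eq quot_left_module proj_left_module relation_left_submodule)

lemma X_left_module: "left_module B (XM \<alpha> j)"
  unfolding X_module_def
  by (intro direct_sum_left_module B.ring_axioms X_summand_left_module) auto

definition summand_coset :: "'k vec \<Rightarrow> nat \<Rightarrow> nat \<Rightarrow> 'k beil \<Rightarrow> 'k beil set" where
  "summand_coset \<alpha> j i b = relation_submodule \<alpha> i j +>\<^bsub>proj_module n r i\<^esub> (b \<otimes>\<^bsub>B\<^esub> idem n r i)"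

text \<open>
The family with the class of \<open>e\<^sub>i\<close> at position \<open>i\<close> and zero elsewhere. The zero of a quotient is the
submodule itself, which gives the values at the other positions.
\<close>

definition X_generator :: "'k vec \<Rightarrow> nat \<Rightarrow> nat \<Rightarrow> nat \<Rightarrow> 'k beil set" where
  "X_generator \<alpha> j i = (\<lambda>l\<in>{..<n - j}. if l = i then summand_coset \<alpha> j i \<one>\<^bsub>B\<^esub> else relation_submodule \<alpha> l j)"

lemma carrier_X_summand: "i + j < n \<Longrightarrow> carrier (XS \<alpha> i j) = summand_coset \<alpha> j i ` carrier B"
  by (auto simp: X_summand_eq carrier_quot_module_image carrier_proj summand_coset_def image_image)

lemma act_summand_coset:
  assumes "i + j < n" "a \<in> carrier B" "b \<in> carrier B"
  shows "a \<odot>\<^bsub>XS \<alpha> i j\<^esub> summand_coset \<alpha> j i b = summand_coset \<alpha> j i (a \<otimes>\<^bsub>B\<^esub> b)"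
  using assms coset_act[OF proj_left_module relation_left_submodule[of i j \<alpha>], of a "b \<otimes>\<^bsub>B\<^esub> idem n r i"]
  by (auto simp: X_summand_eq summand_coset_def proj_sel B.m_assoc idem_mem)

lemma summand_coset_zero_iff:
  assumes "i + j < n" "b \<in> carrier B"
  shows "summand_coset \<alpha> j i b = \<zero>\<^bsub>XS \<alpha> i j\<^esub> \<longleftrightarrow>
    (\<exists>c\<in>carrier B. b \<otimes>\<^bsub>B\<^esub> idem n r i = c \<otimes>\<^bsub>B\<^esub> arrow_comb_power n r \<alpha> i j)"
  using assms coset_eq_zero_iff[OF proj_left_module relation_left_submodule[of i j \<alpha>], of "b \<otimes>\<^bsub>B\<^esub> idem n r i"]
  by (auto simp: X_summand_eq summand_coset_def carrier_proj zero_quot_module relation_submodule_def)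

lemma X_zero: "\<zero>\<^bsub>XM \<alpha> j\<^esub> = (\<lambda>l\<in>{..<n - j}. \<zero>\<^bsub>XS \<alpha> l j\<^esub>)"
  by (simp add: X_module_def direct_sum_sel)

lemma X_generator_apply:
  assumes "l < n - j"
  shows "X_generator \<alpha> j i l = (if l = i then summand_coset \<alpha> j i \<one>\<^bsub>B\<^esub> else \<zero>\<^bsub>XS \<alpha> l j\<^esub>)"
  using assms by (simp add: X_generator_def X_summand_eq zero_quot_module)

lemma X_generator_mem: "X_generator \<alpha> j i \<in> carrier (XM \<alpha> j)"
proof -
  have "X_generator \<alpha> j i l \<in> carrier (XS \<alpha> l j)" if l: "l < n - j" for l
  proof -
    interpret S: left_module B "XS \<alpha> l j" using l by (intro X_summand_left_module) auto
    show ?thesis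
      using l by (auto simp: X_generator_apply carrier_X_summand[symmetric])
        (auto simp: carrier_X_summand)
  qed
  then show ?thesis
    by (auto simp: X_module_def direct_sum_sel X_generator_def)
qed

lemma X_sum_apply:
  assumes b: "b \<in> {..<n - j} \<rightarrow> carrier B" and l: "l < n - j"
  shows "(\<Oplus>\<^bsub>XM \<alpha> j\<^esub>i\<in>{..<n - j}. b i \<odot>\<^bsub>XM \<alpha> j\<^esub> X_generator \<alpha> j i) l = summand_coset \<alpha> j l (b l)"
proof -
  interpret X: left_module B "XM \<alpha> j" by (rule X_left_module)
  interpret S: left_module B "XS \<alpha> l j" using l by (intro X_summand_left_module) auto
  have mem: "(\<lambda>i. b i \<odot>\<^bsub>XM \<alpha> j\<^esub> X_generator \<alpha> j i) \<in> {..<n - j} \<rightarrow> carrier (XM \<alpha> j)"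
    using b X_generator_mem by (auto intro!: X.act_closed)
  have cl: "summand_coset \<alpha> j l (b l) \<in> carrier (XS \<alpha> l j)"
    using b l by (auto simp: carrier_X_summand)
  have "(\<Oplus>\<^bsub>XM \<alpha> j\<^esub>i\<in>{..<n - j}. b i \<odot>\<^bsub>XM \<alpha> j\<^esub> X_generator \<alpha> j i) l =
      (\<Oplus>\<^bsub>XS \<alpha> l j\<^esub>i\<in>{..<n - j}. (b i \<odot>\<^bsub>XM \<alpha> j\<^esub> X_generator \<alpha> j i) l)"
    using mem l X_summand_left_module unfolding X_module_def
    by (intro direct_sum_finsum[OF B.ring_axioms]) auto
  also have "\<dots> = (\<Oplus>\<^bsub>XS \<alpha> l j\<^esub>i\<in>{..<n - j}. if l = i then summand_coset \<alpha> j l (b l) else \<zero>\<^bsub>XS \<alpha> l j\<^esub>)"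
  proof (intro S.M.finsum_cong')
    fix i assume i: "i \<in> {..<n - j}"
    have "(b i \<odot>\<^bsub>XM \<alpha> j\<^esub> X_generator \<alpha> j i) l = b i \<odot>\<^bsub>XS \<alpha> l j\<^esub> X_generator \<alpha> j i l"
      using l by (simp add: X_module_def direct_sum_sel)
    then show "(b i \<odot>\<^bsub>XM \<alpha> j\<^esub> X_generator \<alpha> j i) l =
        (if l = i then summand_coset \<alpha> j l (b l) else \<zero>\<^bsub>XS \<alpha> l j\<^esub>)"
      using b i l by (auto simp: X_generator_apply act_summand_coset S.act_zero_right Pi_iff)
  qed (use cl in auto)
  also have "\<dots> = summand_coset \<alpha> j l (b l)"
    using S.M.add.finprod_singleton[of l "{..<n - j}" "\<lambda>_. summand_coset \<alpha> j l (b l)"] l cl by simp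
  finally show ?thesis .
qed

lemma X_sum_eq:
  assumes b: "b \<in> {..<n - j} \<rightarrow> carrier B"
  shows "(\<Oplus>\<^bsub>XM \<alpha> j\<^esub>i\<in>{..<n - j}. b i \<odot>\<^bsub>XM \<alpha> j\<^esub> X_generator \<alpha> j i) =
    (\<lambda>l\<in>{..<n - j}. summand_coset \<alpha> j l (b l))"
proof -
  interpret X: left_module B "XM \<alpha> j" by (rule X_left_module)
  have "(\<Oplus>\<^bsub>XM \<alpha> j\<^esub>i\<in>{..<n - j}. b i \<odot>\<^bsub>XM \<alpha> j\<^esub> X_generator \<alpha> j i)
      \<in> carrier (XM \<alpha> j)"
    using b X_generator_mem by (intro X.M.finsum_closed) (auto intro!: X.act_closed)
  then show ?thesis
    using X_sum_apply[OF b]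
    by (intro extensionalityI[of _ "{..<n - j}"]) (auto simp: X_module_def carrier_direct_sum PiE_iff)
qed

text \<open>
A combination \<open>\<Sum> b\<^sub>i x\<^sub>i\<close> is the family of the classes of \<open>b\<^sub>i e\<^sub>i\<close> (\<open>X_sum_eq\<close>). Generation and the
description of the relations can be read off from it summand by summand.
\<close>

lemma X_module_presentation:
  assumes \<alpha>: "\<alpha> \<in> carrier_vec r - {0\<^sub>v r}" and M: "left_module B M"
  shows "diagonal_presentation B (XM \<alpha> j) M {..<n - j} (X_generator \<alpha> j)
    (idem n r) (\<lambda>i. idem n r (i + j)) (\<lambda>i. arrow_comb_power n r \<alpha> i j)"
proof (intro diagonal_presentation.intro diagonal_presentation_axioms.intro)
  show "field_algebra B" by (rule beilinson_field_algebra)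
  show "left_module B (XM \<alpha> j)" by (rule X_left_module)
  show "left_module B M" by (rule M)
  fix i assume i: "i \<in> {..<n - j}"
  show "idem n r i \<odot>\<^bsub>XM \<alpha> j\<^esub> X_generator \<alpha> j i = X_generator \<alpha> j i"
  proof (rule extensionalityI[of _ "{..<n - j}"])
    fix l assume l: "l \<in> {..<n - j}"
    then interpret S: left_module B "XS \<alpha> l j" by (intro X_summand_left_module) auto
    have "summand_coset \<alpha> j i (idem n r i) = summand_coset \<alpha> j i \<one>\<^bsub>B\<^esub>"
      using i by (simp add: summand_coset_def idem_mult idem_mem)
    then show "(idem n r i \<odot>\<^bsub>XM \<alpha> j\<^esub> X_generator \<alpha> j i) l = X_generator \<alpha> j i l"
      using i l by (auto simp: X_module_def smult_direct_sum X_generator_apply act_summand_coset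
          S.act_zero_right idem_mem)
  qed (auto simp: X_module_def smult_direct_sum X_generator_def)
  show "c \<otimes>\<^bsub>B\<^esub> idem n r (i + j) = \<zero>\<^bsub>B\<^esub>"
    if "c \<in> carrier B" "c \<otimes>\<^bsub>B\<^esub> arrow_comb_power n r \<alpha> i j = \<zero>\<^bsub>B\<^esub>" for c
    using that i by (intro arrow_comb_power_cancel[OF \<alpha>]) auto
next
  fix y assume y: "y \<in> carrier (XM \<alpha> j)"
  then have "\<exists>c\<in>carrier B. y l = summand_coset \<alpha> j l c" if "l < n - j" for l
    using that by (auto simp: X_module_def carrier_direct_sum PiE_iff carrier_X_summand)
  then obtain b where b: "\<And>l. l < n - j \<Longrightarrow> b l \<in> carrier B \<and> y l = summand_coset \<alpha> j l (b l)"
    by metis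
  have "y = (\<lambda>l\<in>{..<n - j}. summand_coset \<alpha> j l (b l))"
    using y b by (intro extensionalityI[of _ "{..<n - j}"])
      (auto simp: X_module_def carrier_direct_sum PiE_iff)
  then show "\<exists>b\<in>{..<n - j} \<rightarrow> carrier B.
      y = (\<Oplus>\<^bsub>XM \<alpha> j\<^esub>i\<in>{..<n - j}. b i \<odot>\<^bsub>XM \<alpha> j\<^esub> X_generator \<alpha> j i)"
    using b X_sum_eq[of b j \<alpha>] by (intro bexI[of _ b]) auto
next
  fix b :: "nat \<Rightarrow> 'k beil" assume b: "b \<in> {..<n - j} \<rightarrow> carrier B"
  have "(\<lambda>l\<in>{..<n - j}. summand_coset \<alpha> j l (b l)) = (\<lambda>l\<in>{..<n - j}. \<zero>\<^bsub>XS \<alpha> l j\<^esub>) \<longleftrightarrow>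
      (\<forall>l\<in>{..<n - j}. summand_coset \<alpha> j l (b l) = \<zero>\<^bsub>XS \<alpha> l j\<^esub>)"
    by (auto simp: fun_eq_iff restrict_def)
  also have "\<dots> \<longleftrightarrow> (\<forall>l\<in>{..<n - j}. \<exists>c\<in>carrier B. b l \<otimes>\<^bsub>B\<^esub> idem n r l = c \<otimes>\<^bsub>B\<^esub> arrow_comb_power n r \<alpha> l j)"
    using b by (intro ball_cong refl summand_coset_zero_iff) auto
  finally show "((\<Oplus>\<^bsub>XM \<alpha> j\<^esub>i\<in>{..<n - j}. b i \<odot>\<^bsub>XM \<alpha> j\<^esub> X_generator \<alpha> j i) = \<zero>\<^bsub>XM \<alpha> j\<^esub>) \<longleftrightarrow>
      (\<forall>l\<in>{..<n - j}. \<exists>c\<in>carrier B. b l \<otimes>\<^bsub>B\<^esub> idem n r l = c \<otimes>\<^bsub>B\<^esub> arrow_comb_power n r \<alpha> l j)"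
    unfolding X_sum_eq[OF b] X_zero .
qed (auto simp: X_generator_mem idem_mem idem_mult arrow_comb_power_mem idem_arrow_comb_power
    arrow_comb_power_idem)

end

section \<open>Images, kernels and ranks\<close>

context beilinson
begin

lemma arrow_sum_mem: "(\<Oplus>\<^bsub>B\<^esub>i\<in>{..<n - 1}. arrow_comb n r \<alpha> i) \<in> carrier B"
  by (intro B.finsum_closed) (auto intro!: arrow_comb_mem)

lemma arrow_sum_idem:
  assumes m: "m < n"
  shows "(\<Oplus>\<^bsub>B\<^esub>i\<in>{..<n - 1}. arrow_comb n r \<alpha> i) \<otimes>\<^bsub>B\<^esub> idem n r m =
    (if Suc m < n then arrow_comb n r \<alpha> m else \<zero>\<^bsub>B\<^esub>)"
proof -
  have "(\<Oplus>\<^bsub>B\<^esub>i\<in>{..<n - 1}. arrow_comb n r \<alpha> i) \<otimes>\<^bsub>B\<^esub> idem n r m =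
      (\<Oplus>\<^bsub>B\<^esub>i\<in>{..<n - 1}. arrow_comb n r \<alpha> i \<otimes>\<^bsub>B\<^esub> idem n r m)"
    using m by (intro B.finsum_ldistr) (auto simp: idem_mem arrow_comb_mem)
  also have "\<dots> = (\<Oplus>\<^bsub>B\<^esub>i\<in>{..<n - 1}. if i = m then arrow_comb n r \<alpha> i else \<zero>\<^bsub>B\<^esub>)"
  proof (intro B.finsum_cong')
    fix i assume i: "i \<in> {..<n - 1}"
    then have "arrow_comb n r \<alpha> i \<otimes>\<^bsub>B\<^esub> idem n r m = arrow_comb n r \<alpha> i \<otimes>\<^bsub>B\<^esub> (idem n r i \<otimes>\<^bsub>B\<^esub> idem n r m)"
      using m by (simp add: arrow_comb_idem arrow_comb_mem idem_mem flip: B.m_assoc)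
    then show "arrow_comb n r \<alpha> i \<otimes>\<^bsub>B\<^esub> idem n r m = (if i = m then arrow_comb n r \<alpha> i else \<zero>\<^bsub>B\<^esub>)"
      using i m by (simp add: arrow_comb_mem idem_mult arrow_comb_idem)
  qed (auto intro!: arrow_comb_mem)
  also have "\<dots> = (if Suc m < n then arrow_comb n r \<alpha> m else \<zero>\<^bsub>B\<^esub>)"
  proof (cases "Suc m < n")
    case True
    then show ?thesis by (simp add: B.finsum_delta arrow_comb_mem)
  next
    case False
    then have "(\<Oplus>\<^bsub>B\<^esub>i\<in>{..<n - 1}. if i = m then arrow_comb n r \<alpha> i else \<zero>\<^bsub>B\<^esub>) = (\<Oplus>\<^bsub>B\<^esub>i\<in>{..<n - 1}. \<zero>\<^bsub>B\<^esub>)"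
      by (intro B.finsum_cong') auto
    with False show ?thesis by simp
  qed
  finally show ?thesis .
qed

context
  fixes M :: "('k beil, 'm) module"
  assumes M: "left_module B M"
begin

interpretation M: left_module B M by (rule M)

lemma vertex_decomposition:
  assumes "x \<in> carrier M" shows "(\<Oplus>\<^bsub>M\<^esub>i\<in>{..<n}. idem n r i \<odot>\<^bsub>M\<^esub> x) = x"
  using M.act_finsum_left[OF assms, of "idem n r" "{..<n}"] assms
  by (simp add: idem_sum M.act_one idem_mem Pi_def)

lemma idem_act_idem:
  "x \<in> carrier M \<Longrightarrow> i < n \<Longrightarrow> l < n \<Longrightarrow>
    idem n r i \<odot>\<^bsub>M\<^esub> (idem n r l \<odot>\<^bsub>M\<^esub> x) = (if i = l then idem n r i \<odot>\<^bsub>M\<^esub> x else \<zero>\<^bsub>M\<^esub>)"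
  by (simp add: idem_mem idem_mult M.act_zero_left flip: M.act_assoc)

lemma vertex_part_iff: "i < n \<Longrightarrow> x \<in> vertex_part n r M i \<longleftrightarrow> x \<in> carrier M \<and> idem n r i \<odot>\<^bsub>M\<^esub> x = x"
  unfolding vertex_part_def by (auto simp: idem_mem M.act_closed idem_act_idem image_iff intro: bexI[of _ x])

lemma alpha_mult_act:
  "a \<in> carrier B \<Longrightarrow> m < n \<Longrightarrow> idem n r m \<otimes>\<^bsub>B\<^esub> a = a \<Longrightarrow> x \<in> carrier M \<Longrightarrow>
   alpha_mult n r \<alpha> M (a \<odot>\<^bsub>M\<^esub> x) = (if Suc m < n then (arrow_comb n r \<alpha> m \<otimes>\<^bsub>B\<^esub> a) \<odot>\<^bsub>M\<^esub> x else \<zero>\<^bsub>M\<^esub>)"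
proof -
  assume a: "a \<in> carrier B" "m < n" "idem n r m \<otimes>\<^bsub>B\<^esub> a = a" and x: "x \<in> carrier M"
  let ?s = "\<Oplus>\<^bsub>B\<^esub>i\<in>{..<n - 1}. arrow_comb n r \<alpha> i"
  have "alpha_mult n r \<alpha> M (a \<odot>\<^bsub>M\<^esub> x) = (?s \<otimes>\<^bsub>B\<^esub> a) \<odot>\<^bsub>M\<^esub> x"
    unfolding alpha_mult_def by (rule M.act_assoc[OF arrow_sum_mem a(1) x, symmetric])
  also have "?s \<otimes>\<^bsub>B\<^esub> a = (?s \<otimes>\<^bsub>B\<^esub> idem n r m) \<otimes>\<^bsub>B\<^esub> a"
    using B.m_assoc[OF arrow_sum_mem idem_mem[OF a(2)] a(1)] a(3) by simp
  also have "\<dots> = (if Suc m < n then arrow_comb n r \<alpha> m \<otimes>\<^bsub>B\<^esub> a else \<zero>\<^bsub>B\<^esub>)"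
    unfolding arrow_sum_idem[OF a(2)] using a(1) by simp
  finally show ?thesis using x by (simp add: M.act_zero_left)
qed

lemma alpha_mult_finsum:
  assumes "f \<in> S \<rightarrow> carrier M"
  shows "alpha_mult n r \<alpha> M (finsum M f S) = (\<Oplus>\<^bsub>M\<^esub>i\<in>S. alpha_mult n r \<alpha> M (f i))"
  unfolding alpha_mult_def by (rule M.act_finsum_right[OF arrow_sum_mem assms])

text \<open>
The sum of the linear forms maps the component at vertex \<open>i\<close> to the component at vertex \<open>i + 1\<close>, and it
kills the last one. In each step the summand that has arrived at the last vertex drops out.
\<close>

lemma alpha_mult_power:
  assumes x: "x \<in> carrier M" and j: "j \<le> n"
  shows "(alpha_mult n r \<alpha> M ^^ j) x = (\<Oplus>\<^bsub>M\<^esub>i\<in>{..<n - j}. arrow_comb_power n r \<alpha> i j \<odot>\<^bsub>M\<^esub> x)"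
  using j
proof (induct j)
  case 0
  then show ?case using vertex_decomposition[OF x] by simp
next
  case (Suc j)
  let ?w = "\<lambda>j i. arrow_comb_power n r \<alpha> i j \<odot>\<^bsub>M\<^esub> x"
  have wm: "?w j i \<in> carrier M" if "i + j < n" for i j
    using that x by (simp add: M.act_closed arrow_comb_power_mem)
  have "(alpha_mult n r \<alpha> M ^^ Suc j) x = alpha_mult n r \<alpha> M (\<Oplus>\<^bsub>M\<^esub>i\<in>{..<n - j}. ?w j i)"
    using Suc by simp
  also have "\<dots> = (\<Oplus>\<^bsub>M\<^esub>i\<in>{..<n - j}. alpha_mult n r \<alpha> M (?w j i))"
    using wm by (intro alpha_mult_finsum) auto
  also have "\<dots> = (\<Oplus>\<^bsub>M\<^esub>i\<in>{..<n - j}. if i < n - Suc j then ?w (Suc j) i else \<zero>\<^bsub>M\<^esub>)"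
  proof (intro M.M.finsum_cong')
    fix i assume i: "i \<in> {..<n - j}"
    then have "alpha_mult n r \<alpha> M (?w j i) =
        (if Suc (i + j) < n then (arrow_comb n r \<alpha> (i + j) \<otimes>\<^bsub>B\<^esub> arrow_comb_power n r \<alpha> i j) \<odot>\<^bsub>M\<^esub> x else \<zero>\<^bsub>M\<^esub>)"
      using x by (intro alpha_mult_act) (auto simp: arrow_comb_power_mem idem_arrow_comb_power)
    also have "\<dots> = (if i < n - Suc j then ?w (Suc j) i else \<zero>\<^bsub>M\<^esub>)"
      by auto
    finally show "alpha_mult n r \<alpha> M (?w j i) = (if i < n - Suc j then ?w (Suc j) i else \<zero>\<^bsub>M\<^esub>)" .
  qed (use wm[of _ "Suc j"] in auto)
  also have "\<dots> = (\<Oplus>\<^bsub>M\<^esub>i\<in>{..<n - Suc j}. if i < n - Suc j then ?w (Suc j) i else \<zero>\<^bsub>M\<^esub>)"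
    using wm[of _ "Suc j"]
    by (intro M.M.add.finprod_mono_neutral_cong_right) auto
  also have "\<dots> = (\<Oplus>\<^bsub>M\<^esub>i\<in>{..<n - Suc j}. ?w (Suc j) i)"
    using wm[of _ "Suc j"] by (intro M.M.finsum_cong') auto
  finally show ?case .
qed

context
  fixes \<alpha> :: "'k vec" and j :: nat
  assumes \<alpha>: "\<alpha> \<in> carrier_vec r - {0\<^sub>v r}" and j: "j \<le> n"
begin

interpretation P: diagonal_presentation B "XM \<alpha> j" M "{..<n - j}" "X_generator \<alpha> j"
  "idem n r" "\<lambda>i. idem n r (i + j)" "\<lambda>i. arrow_comb_power n r \<alpha> i j"
  by (rule X_module_presentation[OF \<alpha> M])

text \<open>
Only the component at vertex \<open>i\<close> of a vector matters for \<open>w\<^sub>i\<close>, so a family of vectors can be replaced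
by the sum of its components.
\<close>

lemma relation_image_eq: "P.relation_image = (alpha_mult n r \<alpha> M ^^ j) ` carrier M"
proof safe
  fix x assume x: "x \<in> carrier M"
  then show "(alpha_mult n r \<alpha> M ^^ j) x \<in> P.relation_image"
    unfolding P.relation_image_def using alpha_mult_power[OF x j] by auto
next
  fix v assume "v \<in> P.relation_image"
  then obtain u where u: "u \<in> {..<n - j} \<rightarrow> carrier M"
    and v: "v = (\<Oplus>\<^bsub>M\<^esub>i\<in>{..<n - j}. arrow_comb_power n r \<alpha> i j \<odot>\<^bsub>M\<^esub> u i)"
    unfolding P.relation_image_def by auto
  have um: "u l \<in> carrier M" if "l < n - j" for l using u that by auto
  let ?x = "\<Oplus>\<^bsub>M\<^esub>l\<in>{..<n - j}. idem n r l \<odot>\<^bsub>M\<^esub> u l"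
  have x: "?x \<in> carrier M" using um by (intro M.M.finsum_closed) (auto intro!: M.act_closed idem_mem)
  have "arrow_comb_power n r \<alpha> i j \<odot>\<^bsub>M\<^esub> ?x = arrow_comb_power n r \<alpha> i j \<odot>\<^bsub>M\<^esub> u i" if i: "i < n - j" for i
  proof -
    have "idem n r i \<odot>\<^bsub>M\<^esub> ?x = (\<Oplus>\<^bsub>M\<^esub>l\<in>{..<n - j}. if i = l then idem n r l \<odot>\<^bsub>M\<^esub> u l else \<zero>\<^bsub>M\<^esub>)"
      using i um by (subst M.act_finsum_right)
        (auto simp: idem_mem M.act_closed idem_act_idem intro!: M.M.finsum_cong')
    also have "\<dots> = idem n r i \<odot>\<^bsub>M\<^esub> u i"
      using M.M.add.finprod_singleton[of i "{..<n - j}" "\<lambda>l. idem n r l \<odot>\<^bsub>M\<^esub> u l"] i um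
      by (auto simp: idem_mem M.act_closed Pi_iff)
    finally have *: "idem n r i \<odot>\<^bsub>M\<^esub> ?x = idem n r i \<odot>\<^bsub>M\<^esub> u i" .
    have w: "arrow_comb_power n r \<alpha> i j \<odot>\<^bsub>M\<^esub> y = arrow_comb_power n r \<alpha> i j \<odot>\<^bsub>M\<^esub> (idem n r i \<odot>\<^bsub>M\<^esub> y)"
      if "y \<in> carrier M" for y
      using that i by (simp add: arrow_comb_power_mem idem_mem arrow_comb_power_idem flip: M.act_assoc)
    show ?thesis using w[OF x] w[OF um[OF i]] * by simp
  qed
  then have "v = (\<Oplus>\<^bsub>M\<^esub>i\<in>{..<n - j}. arrow_comb_power n r \<alpha> i j \<odot>\<^bsub>M\<^esub> ?x)" (is "_ = ?s")
    unfolding v using um x by (intro M.M.finsum_cong') (auto intro!: M.act_closed arrow_comb_power_mem)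
  also have "\<dots> = (alpha_mult n r \<alpha> M ^^ j) ?x"
    by (rule alpha_mult_power[OF x j, symmetric])
  finally show "v \<in> (alpha_mult n r \<alpha> M ^^ j) ` carrier M"
    using x by (rule image_eqI)
qed

text \<open>
The target part is the image of \<open>M\<close> under the projection \<open>v \<mapsto> \<Sum> e\<^sub>i\<^sub>+\<^sub>j v\<close>.
\<close>

lemma target_fin_dim:
  assumes fd: "vectorspace.fin_dim (class_ring :: 'k ring) (kspace B M)"
  shows "vectorspace.fin_dim (class_ring :: 'k ring) ((kspace B M)\<lparr>carrier := P.target_part\<rparr>)"
proof -
  let ?T = "\<lambda>v. \<Oplus>\<^bsub>M\<^esub>i\<in>{..<n - j}. idem n r (i + j) \<odot>\<^bsub>M\<^esub> v"
  have im: "?T v \<in> P.target_part" if "v \<in> carrier M" for v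
    using that by (intro P.t_fixed_sum_in_target) (auto simp: M.act_closed idem_mem idem_act_idem)
  note K = B.kspace_left_module[OF M]
  have sub: "left_module (class_ring :: 'k ring) ((kspace B M)\<lparr>carrier := P.target_part\<rparr>)"
    by (rule left_module.submodule_left_module[OF K P.target_left_submodule])
  have "?T \<in> module_hom class_ring (kspace B M) ((kspace B M)\<lparr>carrier := P.target_part\<rparr>)"
  proof (rule module_homI)
    fix v v' assume "v \<in> carrier (kspace B M)" "v' \<in> carrier (kspace B M)"
    then have v: "v \<in> carrier M" "v' \<in> carrier M" by (auto simp: kspace_sel)
    have "?T (v \<oplus>\<^bsub>M\<^esub> v') = (\<Oplus>\<^bsub>M\<^esub>i\<in>{..<n - j}. idem n r (i + j) \<odot>\<^bsub>M\<^esub> v \<oplus>\<^bsub>M\<^esub> idem n r (i + j) \<odot>\<^bsub>M\<^esub> v')"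
      using v by (intro M.M.finsum_cong') (auto simp: M.act_r_distr idem_mem M.act_closed)
    then show "?T (v \<oplus>\<^bsub>kspace B M\<^esub> v') = ?T v \<oplus>\<^bsub>(kspace B M)\<lparr>carrier := P.target_part\<rparr>\<^esub> ?T v'"
      using v by (simp add: kspace_sel M.M.finsum_addf M.act_closed idem_mem Pi_def)
  next
    fix c :: 'k and v assume "v \<in> carrier (kspace B M)"
    then have v: "v \<in> carrier M" by (auto simp: kspace_sel)
    have "?T ((c \<odot>\<^bsub>B\<^esub> \<one>\<^bsub>B\<^esub>) \<odot>\<^bsub>M\<^esub> v) = (\<Oplus>\<^bsub>M\<^esub>i\<in>{..<n - j}. (c \<odot>\<^bsub>B\<^esub> \<one>\<^bsub>B\<^esub>) \<odot>\<^bsub>M\<^esub> (idem n r (i + j) \<odot>\<^bsub>M\<^esub> v))"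
      using v by (intro M.M.finsum_cong')
        (auto simp: B.scalar_act_commute[OF M] B.smult_closed idem_mem M.act_closed)
    then show "?T (c \<odot>\<^bsub>kspace B M\<^esub> v) = c \<odot>\<^bsub>(kspace B M)\<lparr>carrier := P.target_part\<rparr>\<^esub> ?T v"
      using v by (simp add: kspace_sel M.act_finsum_right B.smult_closed M.act_closed idem_mem Pi_def)
  qed (use im in \<open>auto simp: kspace_sel\<close>)
  then interpret T: linear_map "class_ring :: 'k ring" "kspace B M"
    "(kspace B M)\<lparr>carrier := P.target_part\<rparr>" ?T
    using class_ring_vectorspace[OF K] class_ring_vectorspace[OF sub]
    by (intro linear_map.intro mod_hom.intro mod_hom_axioms.intro) (auto simp: vectorspace_def)
  have "?T ` carrier (kspace B M) = P.target_part"
    using im by (force simp: kspace_sel P.target_part_def)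
  then show ?thesis
    using T.rank_nullity_main(2)[OF fd] by simp
qed

lemma Ext1_dim_alpha_rank:
  assumes fd: "vectorspace.fin_dim (class_ring :: 'k ring) (kspace B M)"
  shows "vectorspace.dim (class_ring :: 'k ring) ((kspace B M)\<lparr>carrier := P.target_part\<rparr>) =
    vectorspace.dim (class_ring :: 'k ring) (Ext1 B (XM \<alpha> j) M) + alpha_rank n r j \<alpha> M"
  unfolding alpha_rank_def relation_image_eq[symmetric] by (rule P.Ext1_dim[OF target_fin_dim[OF fd]])

lemma target_part_eq:
  "P.target_part = {\<Oplus>\<^bsub>M\<^esub>i\<in>{j..<n}. x i | x. x \<in> (\<Pi> i\<in>{j..<n}. vertex_part n r M i)}"
proof -
  have shift: "(\<lambda>i. i + j) ` {..<n - j} = {j..<n}"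
    using j by (simp add: lessThan_atLeast0 image_add_atLeastLessThan')
  have reindex: "(\<Oplus>\<^bsub>M\<^esub>l\<in>{j..<n}. y l) = (\<Oplus>\<^bsub>M\<^esub>i\<in>{..<n - j}. y (i + j))" if "y \<in> {j..<n} \<rightarrow> carrier M" for y
    using M.M.add.finprod_reindex[of y "\<lambda>i. i + j" "{..<n - j}"] that unfolding shift
    by (simp add: inj_on_def)
  show ?thesis
  proof (intro equalityI subsetI)
    fix v assume "v \<in> P.target_part"
    then have v: "v \<in> carrier M" "v = (\<Oplus>\<^bsub>M\<^esub>i\<in>{..<n - j}. idem n r (i + j) \<odot>\<^bsub>M\<^esub> v)"
      by (auto simp: P.target_part_def)
    have "v = (\<Oplus>\<^bsub>M\<^esub>l\<in>{j..<n}. idem n r l \<odot>\<^bsub>M\<^esub> v)"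
      using v reindex[of "\<lambda>l. idem n r l \<odot>\<^bsub>M\<^esub> v"] by (auto simp: M.act_closed idem_mem)
    then show "v \<in> {\<Oplus>\<^bsub>M\<^esub>i\<in>{j..<n}. x i | x. x \<in> (\<Pi> i\<in>{j..<n}. vertex_part n r M i)}"
      using v(1) by (auto simp: vertex_part_def intro!: exI[of _ "\<lambda>l. idem n r l \<odot>\<^bsub>M\<^esub> v"])
  next
    fix v assume "v \<in> {\<Oplus>\<^bsub>M\<^esub>i\<in>{j..<n}. x i | x. x \<in> (\<Pi> i\<in>{j..<n}. vertex_part n r M i)}"
    then obtain x where x: "x \<in> (\<Pi> i\<in>{j..<n}. vertex_part n r M i)" and v: "v = (\<Oplus>\<^bsub>M\<^esub>i\<in>{j..<n}. x i)"
      by auto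
    have xl: "x l \<in> carrier M \<and> idem n r l \<odot>\<^bsub>M\<^esub> x l = x l" if "j \<le> l" "l < n" for l
      using x that vertex_part_iff[of l "x l"] by auto
    have "v = (\<Oplus>\<^bsub>M\<^esub>i\<in>{..<n - j}. x (i + j))"
      unfolding v using xl by (intro reindex) auto
    also have "\<dots> \<in> P.target_part"
      using xl by (intro P.t_fixed_sum_in_target) auto
    finally show "v \<in> P.target_part" .
  qed
qed

lemma Ext1_trivial_iff_image:
  "carrier (Ext1 B (XM \<alpha> j) M) = {\<zero>\<^bsub>Ext1 B (XM \<alpha> j) M\<^esub>} \<longleftrightarrow>
   (alpha_mult n r \<alpha> M ^^ j) ` carrier M = {\<Oplus>\<^bsub>M\<^esub>i\<in>{j..<n}. x i | x. x \<in> (\<Pi> i\<in>{j..<n}. vertex_part n r M i)}"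
  unfolding relation_image_eq[symmetric] target_part_eq[symmetric] by (rule P.Ext1_trivial_iff)

lemma Hom_trivial_iff_injective:
  "carrier (Hom B (XM \<alpha> j) M) = {\<zero>\<^bsub>Hom B (XM \<alpha> j) M\<^esub>} \<longleftrightarrow>
   (\<forall>i<n - j. \<forall>u\<in>vertex_part n r M i. arrow_comb_power n r \<alpha> i j \<odot>\<^bsub>M\<^esub> u = \<zero>\<^bsub>M\<^esub> \<longrightarrow> u = \<zero>\<^bsub>M\<^esub>)"
  unfolding P.Hom_trivial_iff using vertex_part_iff by auto

end

text \<open>
The components of \<open>\<alpha>\<^sub>M x\<close> at different vertices are independent, so \<open>\<alpha>\<^sub>M x = 0\<close> if and only if the linear
form kills every component of \<open>x\<close>. At the last vertex this is automatic, at the others it is the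
question of injectivity that the homomorphisms out of the test module decide.
\<close>

theorem EKP_condition_iff:
  assumes \<alpha>: "\<alpha> \<in> carrier_vec r - {0\<^sub>v r}" and n: "1 \<le> n"
  shows "a_kernel M M (alpha_mult n r \<alpha> M) = vertex_part n r M (n - 1) \<longleftrightarrow>
    carrier (Hom B (XM \<alpha> 1) M) = {\<zero>\<^bsub>Hom B (XM \<alpha> 1) M\<^esub>}"
proof -
  let ?A = "alpha_mult n r \<alpha> M"
  have power: "arrow_comb_power n r \<alpha> i 1 = arrow_comb n r \<alpha> i" if "i < n - 1" for i
    using that by (simp add: arrow_comb_idem)
  have Hom: "carrier (Hom B (XM \<alpha> 1) M) = {\<zero>\<^bsub>Hom B (XM \<alpha> 1) M\<^esub>} \<longleftrightarrow>
      (\<forall>i<n - 1. \<forall>u\<in>vertex_part n r M i. arrow_comb n r \<alpha> i \<odot>\<^bsub>M\<^esub> u = \<zero>\<^bsub>M\<^esub> \<longrightarrow> u = \<zero>\<^bsub>M\<^esub>)"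
    unfolding Hom_trivial_iff_injective[OF \<alpha> n] using power by simp
  have Ae: "?A u = (if Suc i < n then arrow_comb n r \<alpha> i \<odot>\<^bsub>M\<^esub> u else \<zero>\<^bsub>M\<^esub>)"
    if u: "u \<in> vertex_part n r M i" and i: "i < n" for u i
    using alpha_mult_act[of "idem n r i" i u \<alpha>] u i arrow_comb_idem[of i \<alpha>]
    by (simp add: vertex_part_iff idem_mem idem_mult)
  show ?thesis
    unfolding Hom
  proof (intro iffI allI impI ballI)
    fix i u assume ker: "a_kernel M M ?A = vertex_part n r M (n - 1)" and i: "i < n - 1"
      and u: "u \<in> vertex_part n r M i" and zero: "arrow_comb n r \<alpha> i \<odot>\<^bsub>M\<^esub> u = \<zero>\<^bsub>M\<^esub>"
    have "u \<in> a_kernel M M ?A"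
      using Ae[OF u] i u zero by (simp add: a_kernel_iff vertex_part_iff)
    then have "u = idem n r (n - 1) \<odot>\<^bsub>M\<^esub> u" "u = idem n r i \<odot>\<^bsub>M\<^esub> u" "u \<in> carrier M"
      using ker u i by (auto simp: vertex_part_iff)
    then show "u = \<zero>\<^bsub>M\<^esub>"
      using idem_act_idem[of u i "n - 1"] i by simp
  next
    assume inj: "\<forall>i<n - 1. \<forall>u\<in>vertex_part n r M i. arrow_comb n r \<alpha> i \<odot>\<^bsub>M\<^esub> u = \<zero>\<^bsub>M\<^esub> \<longrightarrow> u = \<zero>\<^bsub>M\<^esub>"
    show "a_kernel M M ?A = vertex_part n r M (n - 1)"
    proof (intro equalityI subsetI)
      fix u assume "u \<in> vertex_part n r M (n - 1)"
      then show "u \<in> a_kernel M M ?A"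
        using Ae[of u "n - 1"] n by (simp add: a_kernel_iff vertex_part_iff)
    next
      fix x assume "x \<in> a_kernel M M ?A"
      then have x: "x \<in> carrier M" and Ax: "?A x = \<zero>\<^bsub>M\<^esub>" by (auto simp: a_kernel_iff)
      have am: "arrow_comb n r \<alpha> i \<odot>\<^bsub>M\<^esub> x \<in> carrier M"
        and ia: "idem n r (i + 1) \<odot>\<^bsub>M\<^esub> (arrow_comb n r \<alpha> i \<odot>\<^bsub>M\<^esub> x) = arrow_comb n r \<alpha> i \<odot>\<^bsub>M\<^esub> x"
        if "i \<in> {..<n - 1}" for i
        using that x by (auto simp: M.act_closed arrow_comb_mem idem_arrow_comb idem_mem simp flip: M.act_assoc)
      have "?A x = (\<Oplus>\<^bsub>M\<^esub>i\<in>{..<n - 1}. arrow_comb_power n r \<alpha> i 1 \<odot>\<^bsub>M\<^esub> x)"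
        using alpha_mult_power[OF x n, of \<alpha>] by simp
      also have "\<dots> = (\<Oplus>\<^bsub>M\<^esub>i\<in>{..<n - 1}. arrow_comb n r \<alpha> i \<odot>\<^bsub>M\<^esub> x)"
        using am power by (intro M.M.finsum_cong') auto
      finally have Ax_sum: "?A x = (\<Oplus>\<^bsub>M\<^esub>i\<in>{..<n - 1}. arrow_comb n r \<alpha> i \<odot>\<^bsub>M\<^esub> x)" .
      have "idem n r i \<odot>\<^bsub>M\<^esub> x = \<zero>\<^bsub>M\<^esub>" if i: "i < n - 1" for i
      proof -
        have "idem n r (Suc i) \<odot>\<^bsub>M\<^esub> ?A x = arrow_comb n r \<alpha> i \<odot>\<^bsub>M\<^esub> x"
          unfolding Ax_sum
          using diagonal_presentation.t_act_sum[OF X_module_presentation[OF \<alpha> M, of 1],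
              of "\<lambda>l. arrow_comb n r \<alpha> l \<odot>\<^bsub>M\<^esub> x" i, OF am ia] i by simp
        then have "arrow_comb n r \<alpha> i \<odot>\<^bsub>M\<^esub> (idem n r i \<odot>\<^bsub>M\<^esub> x) = \<zero>\<^bsub>M\<^esub>"
          using i x Ax by (simp add: M.act_zero_right idem_mem arrow_comb_mem arrow_comb_idem flip: M.act_assoc)
        then show ?thesis
          using inj i x by (simp add: vertex_part_def)
      qed
      then have "idem n r i \<odot>\<^bsub>M\<^esub> x = (if i = n - 1 then idem n r i \<odot>\<^bsub>M\<^esub> x else \<zero>\<^bsub>M\<^esub>)" if "i < n" for i
        using that by auto
      then have "x = (\<Oplus>\<^bsub>M\<^esub>i\<in>{..<n}. if i = n - 1 then idem n r i \<odot>\<^bsub>M\<^esub> x else \<zero>\<^bsub>M\<^esub>)"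
        using vertex_decomposition[OF x] x
        by (subst (asm) M.M.finsum_cong'[of "{..<n}" "{..<n}" "\<lambda>i. if i = n - 1 then idem n r i \<odot>\<^bsub>M\<^esub> x else \<zero>\<^bsub>M\<^esub>"])
          (auto simp: M.act_closed idem_mem)
      also have "\<dots> = (\<Oplus>\<^bsub>M\<^esub>i\<in>{..<n}. if n - 1 = i then idem n r i \<odot>\<^bsub>M\<^esub> x else \<zero>\<^bsub>M\<^esub>)"
        using x by (intro M.M.finsum_cong') (auto simp: M.act_closed idem_mem)
      also have "\<dots> = idem n r (n - 1) \<odot>\<^bsub>M\<^esub> x"
        using M.M.add.finprod_singleton[of "n - 1" "{..<n}" "\<lambda>i. idem n r i \<odot>\<^bsub>M\<^esub> x"] n x
        by (simp add: M.act_closed idem_mem Pi_def)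
      finally show "x \<in> vertex_part n r M (n - 1)"
        using x by (auto simp: vertex_part_def)
    qed
  qed
qed

end

end

section \<open>Characterisation of the three subcategories\<close>

theorem theorem2p2p1:
  fixes n r p :: nat
  assumes "CHAR('k::alg_closed_field) = p" and "p > 0" and "r \<ge> 2" and "2 \<le> n" and "n \<le> p"
  shows "(EIP n r :: ('k beil, 'm) module set) =
      {M \<in> fd_modules (beilinson_algebra n r). \<forall>\<alpha>\<in>carrier_vec r - {0\<^sub>v r}.
        carrier (Ext1 (beilinson_algebra n r) (X_module n r \<alpha> 1) M) =
          {\<zero>\<^bsub>Ext1 (beilinson_algebra n r) (X_module n r \<alpha> 1) M\<^esub>}} \<and>
    (EKP n r :: ('k beil, 'm) module set) =
      {M \<in> fd_modules (beilinson_algebra n r). \<forall>\<alpha>\<in>carrier_vec r - {0\<^sub>v r}.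
        carrier (Hom (beilinson_algebra n r) (X_module n r \<alpha> 1) M) =
          {\<zero>\<^bsub>Hom (beilinson_algebra n r) (X_module n r \<alpha> 1) M\<^esub>}} \<and>
    (\<forall>j. 1 \<le> j \<and> j \<le> n - 1 \<longrightarrow>
      (CR j n r :: ('k beil, 'm) module set) =
        {M \<in> fd_modules (beilinson_algebra n r). \<exists>c. \<forall>\<alpha>\<in>carrier_vec r - {0\<^sub>v r}.
          vectorspace.dim class_ring (Ext1 (beilinson_algebra n r) (X_module n r \<alpha> j) M) = c})"
proof (intro conjI allI impI)
  interpret beilinson n r "TYPE('k)" .
  have n: "1 \<le> n" and interval: "{1..n - 1} = {1..<n}" using assms(4) by auto
  have fd: "left_module (beilinson_algebra n r) M \<and>
      vectorspace.fin_dim class_ring (kspace (beilinson_algebra n r) M)"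
    if "M \<in> fd_modules (beilinson_algebra n r)" for M :: "('k beil, 'm) module"
    using that by (simp add: fd_modules_def)
  show "(EIP n r :: ('k beil, 'm) module set) =
      {M \<in> fd_modules (beilinson_algebra n r). \<forall>\<alpha>\<in>carrier_vec r - {0\<^sub>v r}.
        carrier (Ext1 (beilinson_algebra n r) (X_module n r \<alpha> 1) M) =
          {\<zero>\<^bsub>Ext1 (beilinson_algebra n r) (X_module n r \<alpha> 1) M\<^esub>}}"
    unfolding EIP_def interval
    using Ext1_trivial_iff_image[OF conjunct1[OF fd] _ n] by (intro Collect_cong conj_cong ball_cong refl) auto
  show "(EKP n r :: ('k beil, 'm) module set) =
      {M \<in> fd_modules (beilinson_algebra n r). \<forall>\<alpha>\<in>carrier_vec r - {0\<^sub>v r}.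
        carrier (Hom (beilinson_algebra n r) (X_module n r \<alpha> 1) M) =
          {\<zero>\<^bsub>Hom (beilinson_algebra n r) (X_module n r \<alpha> 1) M\<^esub>}}"
    unfolding EKP_def
    using EKP_condition_iff[OF conjunct1[OF fd] _ n] by (intro Collect_cong conj_cong ball_cong refl) auto
  fix j assume "1 \<le> j \<and> j \<le> n - 1"
  then have jn: "j \<le> n" by arith
  show "(CR j n r :: ('k beil, 'm) module set) =
        {M \<in> fd_modules (beilinson_algebra n r). \<exists>c. \<forall>\<alpha>\<in>carrier_vec r - {0\<^sub>v r}.
          vectorspace.dim class_ring (Ext1 (beilinson_algebra n r) (X_module n r \<alpha> j) M) = c}"
    unfolding CR_def
  proof (intro Collect_cong conj_cong refl)
    fix M :: "('k beil, 'm) module" assume M: "M \<in> fd_modules (beilinson_algebra n r)"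
    \<comment> \<open>the dimension of \<open>M\<^sub>j \<oplus> \<dots> \<oplus> M\<^sub>n\<^sub>-\<^sub>1\<close>, in which \<open>\<alpha>\<close> does not occur\<close>
    define D where "D = vectorspace.dim (class_ring :: 'k ring) ((kspace (beilinson_algebra n r) M)
      \<lparr>carrier := diagonal_presentation.target_part M {..<n - j} (\<lambda>i. idem n r (i + j))\<rparr>)"
    have dim: "D = vectorspace.dim class_ring (Ext1 (beilinson_algebra n r) (X_module n r \<alpha> j) M) +
        alpha_rank n r j \<alpha> M" if "\<alpha> \<in> carrier_vec r - {0\<^sub>v r}" for \<alpha>
      unfolding D_def
      using Ext1_dim_alpha_rank[OF conjunct1[OF fd[OF M]] that jn conjunct2[OF fd[OF M]]] .
    show "(\<exists>c. \<forall>\<alpha>\<in>carrier_vec r - {0\<^sub>v r}. alpha_rank n r j \<alpha> M = c) \<longleftrightarrow>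
      (\<exists>c. \<forall>\<alpha>\<in>carrier_vec r - {0\<^sub>v r}.
          vectorspace.dim class_ring (Ext1 (beilinson_algebra n r) (X_module n r \<alpha> j) M) = c)"
    proof
      assume "\<exists>c. \<forall>\<alpha>\<in>carrier_vec r - {0\<^sub>v r}. alpha_rank n r j \<alpha> M = c"
      then obtain c where "\<forall>\<alpha>\<in>carrier_vec r - {0\<^sub>v r}. alpha_rank n r j \<alpha> M = c" ..
      with dim show "\<exists>c. \<forall>\<alpha>\<in>carrier_vec r - {0\<^sub>v r}.
          vectorspace.dim class_ring (Ext1 (beilinson_algebra n r) (X_module n r \<alpha> j) M) = c"
        by (intro exI[of _ "D - c"]) (metis add_diff_cancel_right')
    next
      assume "\<exists>c. \<forall>\<alpha>\<in>carrier_vec r - {0\<^sub>v r}.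
          vectorspace.dim class_ring (Ext1 (beilinson_algebra n r) (X_module n r \<alpha> j) M) = c"
      then obtain c where "\<forall>\<alpha>\<in>carrier_vec r - {0\<^sub>v r}.
          vectorspace.dim class_ring (Ext1 (beilinson_algebra n r) (X_module n r \<alpha> j) M) = c" ..
      with dim show "\<exists>c. \<forall>\<alpha>\<in>carrier_vec r - {0\<^sub>v r}. alpha_rank n r j \<alpha> M = c"
        by (intro exI[of _ "D - c"]) (metis add_diff_cancel_left')
    qed
  qed
qed

end
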